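(* For every $C,\upsilon,K>0$ the following holds for all sufficiently small $\gamma>0$ (depending on $C,\upsilon,K$). Let $M$ be a symmetric $n\times n$ matrix with at most $r$ negative eigenvalues, and let $\widetilde{M}=M+\Delta$ where $\Delta$ is symmetric and supported on $Q\times Q$ for some $Q\subseteq[n]$ with $|Q|\le\gamma n$, and where every row and column of $M$ and of $\Delta$ has $\ell_1$ norm at most $K$. There is an efficient (polynomial-time, randomized) algorithm that takes $\widetilde{M}$ together with $C$ and $\upsilon$ as input and, with high probability over its own randomness, outputs a subspace $U\subseteq\mathbb{R}^n$ such that: 1. $\dim U\le O\!\left(\frac{K}{\upsilon}\,r\right)$; 2. every diagonal entry of the orthogonal projection matrix $\Pi_U$ onto $U$ is at most $O\!\left(\frac{C^2K^3}{\upsilon^3}\cdot\frac{r}{n}\right)$; 3. for every $C$-delocalized unit vector $y\in\mathbb{R}^n$ with $\langle y,My\rangle<-\upsilon$, one has $\langle y,\Pi_U y\rangle\ge\Omega\!\left(\frac{\upsilon}{K}\right)$.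
   Context: A vector $x\in\mathbb{R}^n$ is $C$-delocalized if $|x_i|^2\le\frac{C}{n}\|x\|^2$ for all $i\in[n]$. The $O(\cdot)$ and $\Omega(\cdot)$ hide absolute constants. "With high probability" means with probability $1-o_n(1)$. *)

theory Defs
  imports
    "HOL-Probability.Probability"
    "Jordan_Normal_Form.Char_Poly"
    "Jordan_Normal_Form.DL_Rank"
begin

no_notation Finite_Cartesian_Product.vec_nth (infixl \<open>$\<close> 90)
no_notation Inner_Product.real_inner_class.inner (infix \<open>\<bullet>\<close> 70)

section \<open>Randomized polynomial time on real inputs\<close>

text \<open>
  The inputs are real matrices, so algorithms are programs of a randomized real RAM. Real numbers
  are the cells of two-dimensional arrays; the only operations on them are the four field
  operations and comparison (no rounding, no roots, no spectral primitives; division by zero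
  yields 0, as usual in HOL). Natural-number registers serve as counters and as array indices.
  The only real constants of a program are naturals, so no information can be hidden in a program
  in the form of a real constant. The only source of randomness are independent fair coin flips.
  Running time is the number of steps of the small-step semantics: as the expressions
  occurring in a fixed program have bounded size, charging one step for the evaluation of an
  expression agrees with charging one step per arithmetic operation up to a constant factor.
\<close>

type_synonym vname = nat

record store =
  reg :: "vname \<Rightarrow> nat"
  arr :: "vname \<Rightarrow> nat \<Rightarrow> nat \<Rightarrow> real"

datatype nexp =
    NConst nat
  | NReg vname
  | NAdd nexp nexp
  | NSub nexp nexp

datatype rexp =
    RNat nexp
  | RElem vname nexp nexp
  | RAdd rexp rexp
  | RSub rexp rexp
  | RMul rexp rexp
  | RDiv rexp rexp

datatype bexp =
    NLess nexp nexp
  | RLess rexp rexp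
  | BNot bexp
  | BAnd bexp bexp

datatype cmd =
    Skip
  | NAssign vname nexp
  | RAssign vname nexp nexp rexp
  | Flip vname
  | Seq cmd cmd
  | Cond bexp cmd cmd
  | While bexp cmd

primrec nval :: "nexp \<Rightarrow> store \<Rightarrow> nat" where
  "nval (NConst k) s = k"
| "nval (NReg x) s = reg s x"
| "nval (NAdd a b) s = nval a s + nval b s"
| "nval (NSub a b) s = nval a s - nval b s"

primrec rval :: "rexp \<Rightarrow> store \<Rightarrow> real" where
  "rval (RNat a) s = real (nval a s)"
| "rval (RElem x a b) s = arr s x (nval a s) (nval b s)"
| "rval (RAdd e f) s = rval e s + rval f s"
| "rval (RSub e f) s = rval e s - rval f s"
| "rval (RMul e f) s = rval e s * rval f s"
| "rval (RDiv e f) s = rval e s / rval f s"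

primrec bval :: "bexp \<Rightarrow> store \<Rightarrow> bool" where
  "bval (NLess a b) s \<longleftrightarrow> nval a s < nval b s"
| "bval (RLess e f) s \<longleftrightarrow> rval e s < rval f s"
| "bval (BNot b) s \<longleftrightarrow> \<not> bval b s"
| "bval (BAnd b c) s \<longleftrightarrow> bval b s \<and> bval c s"

definition set_reg :: "vname \<Rightarrow> nat \<Rightarrow> store \<Rightarrow> store" where
  "set_reg x k s = s\<lparr>reg := (reg s)(x := k)\<rparr>"

definition set_arr :: "vname \<Rightarrow> nat \<Rightarrow> nat \<Rightarrow> real \<Rightarrow> store \<Rightarrow> store" where
  "set_arr x i j v s = s\<lparr>arr := (arr s)(x := (arr s x)(i := (arr s x i)(j := v)))\<rparr>"

text \<open>
  A configuration consists of the stack of commands that remain to be executed and the store.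
\<close>

type_synonym config = "cmd list \<times> store"

fun step :: "config \<Rightarrow> config pmf" where
  "step ([], s) = return_pmf ([], s)"
| "step (Skip # k, s) = return_pmf (k, s)"
| "step (NAssign x a # k, s) = return_pmf (k, set_reg x (nval a s) s)"
| "step (RAssign x a b e # k, s) =
     return_pmf (k, set_arr x (nval a s) (nval b s) (rval e s) s)"
| "step (Flip x # k, s) =
     map_pmf (\<lambda>b. (k, set_reg x (if b then 1 else 0) s)) (bernoulli_pmf (1 / 2))"
| "step (Seq c d # k, s) = return_pmf (c # d # k, s)"
| "step (Cond b c d # k, s) = return_pmf ((if bval b s then c else d) # k, s)"
| "step (While b c # k, s) = return_pmf (if bval b s then c # While b c # k else k, s)"

primrec steps :: "nat \<Rightarrow> config \<Rightarrow> config pmf" where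
  "steps 0 c = return_pmf c"
| "steps (Suc t) c = bind_pmf (step c) (steps t)"

definition halted :: "config \<Rightarrow> bool" where
  "halted c \<longleftrightarrow> fst c = []"

text \<open>
  Input convention: register 0 holds the dimension n, array 0 the input matrix, and the
  (0,0)-entries of arrays 1 and 2 the two real parameters; everything else is 0.
\<close>

definition input_store :: "nat \<Rightarrow> real mat \<Rightarrow> real \<Rightarrow> real \<Rightarrow> store" where
  "input_store n A C \<upsilon> =
    \<lparr>reg = (\<lambda>_. 0)(0 := n),
     arr = (\<lambda>x i j.
       if x = 0 \<and> i < n \<and> j < n then A $$ (i, j)
       else if x = 1 \<and> i = 0 \<and> j = 0 then C
       else if x = 2 \<and> i = 0 \<and> j = 0 then \<upsilon>
       else 0)\<rparr>"

definition run :: "cmd \<Rightarrow> nat \<Rightarrow> nat \<Rightarrow> real mat \<Rightarrow> real \<Rightarrow> real \<Rightarrow> config pmf" where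
  "run p t n A C \<upsilon> = steps t ([p], input_store n A C \<upsilon>)"

text \<open>
  The running time of program \<open>p\<close> on every input of dimension n, for every outcome
  of the coin flips, is at most \<open>q(n)\<close>. The input consists of
  \<open>n^2 + 2\<close> real numbers, so polynomial in n is polynomial in the input size.
\<close>

definition runs_within :: "cmd \<Rightarrow> nat poly \<Rightarrow> bool" where
  "runs_within p q \<longleftrightarrow>
    (\<forall>n. \<forall>A \<in> carrier_mat n n. \<forall>C > 0. \<forall>\<upsilon> > 0.
      \<forall>c \<in> set_pmf (run p (poly q n) n A C \<upsilon>). halted c)"


section \<open>Subspaces and orthogonal projections\<close>

text \<open>
  Output convention: a program outputs a subspace of \<open>\<real>\<^sup>n\<close> by a
  list of spanning vectors, namely the columns of array 0; register 0 holds their number.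
\<close>

definition output_mat :: "nat \<Rightarrow> config \<Rightarrow> real mat" where
  "output_mat n c = Matrix.mat n (reg (snd c) 0) (\<lambda>(i, j). arr (snd c) 0 i j)"

definition span_vecs :: "nat \<Rightarrow> real Matrix.vec set \<Rightarrow> real Matrix.vec set" where
  "span_vecs n S = LinearCombinations.module.span class_ring (module_vec TYPE(real) n) S"

definition output_space :: "nat \<Rightarrow> config \<Rightarrow> real Matrix.vec set" where
  "output_space n c = span_vecs n (set (cols (output_mat n c)))"

definition subspace_dim :: "nat \<Rightarrow> real Matrix.vec set \<Rightarrow> nat" where
  "subspace_dim n U =
    vectorspace.dim (class_ring :: real ring) ((module_vec TYPE(real) n)\<lparr>carrier := U\<rparr>)"

definition orth_projection :: "nat \<Rightarrow> real Matrix.vec set \<Rightarrow> real mat \<Rightarrow> bool" where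
  "orth_projection n U P \<longleftrightarrow> P \<in> carrier_mat n n \<and>
    (\<forall>x \<in> carrier_vec n. P *\<^sub>v x \<in> U \<and> (\<forall>u \<in> U. (x - P *\<^sub>v x) \<bullet> u = 0))"


section \<open>Conditions on matrices and vectors\<close>

definition symmetric_mat :: "nat \<Rightarrow> real mat \<Rightarrow> bool" where
  "symmetric_mat n A \<longleftrightarrow> A \<in> carrier_mat n n \<and> transpose_mat A = A"

text \<open>Eigenvalues are counted with multiplicity.\<close>

definition num_neg_eigenvalues :: "real mat \<Rightarrow> nat" where
  "num_neg_eigenvalues A =
    (\<Sum>ev | eigenvalue A ev \<and> ev < 0. Polynomial.order ev (char_poly A))"

definition rows_cols_l1_le :: "nat \<Rightarrow> real \<Rightarrow> real mat \<Rightarrow> bool" where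
  "rows_cols_l1_le n K A \<longleftrightarrow>
    (\<forall>i<n. (\<Sum>j<n. \<bar>A $$ (i, j)\<bar>) \<le> K) \<and> (\<forall>j<n. (\<Sum>i<n. \<bar>A $$ (i, j)\<bar>) \<le> K)"

definition supported_on :: "nat \<Rightarrow> nat set \<Rightarrow> real mat \<Rightarrow> bool" where
  "supported_on n Q A \<longleftrightarrow> (\<forall>i<n. \<forall>j<n. A $$ (i, j) \<noteq> 0 \<longrightarrow> i \<in> Q \<and> j \<in> Q)"

definition delocalized :: "nat \<Rightarrow> real \<Rightarrow> real Matrix.vec \<Rightarrow> bool" where
  "delocalized n C x \<longleftrightarrow> (\<forall>i<n. (x $ i)\<^sup>2 \<le> C / real n * (x \<bullet> x))"

end

(* The algorithm is deterministic. It keeps weights w_i in [0, 1] and works with A_w = D_w M' D_w, where M' is the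
   input and D_w = diag(w). In each round it computes the projection \<Pi> onto the eigenvectors of A_w below
   -\<upsilon>/8, of dimension d, and multiplies w_i by 1 - \<Pi>_ii/d, which removes total weight at most 1. If d > 2r then at
   least half of the negative directions are not explained by M, so they put a fraction \<Omega>(\<upsilon>/K) of the trace of \<Pi>
   on Q, and the round removes that much weight from Q. As Q has little weight, d \<le> 2r must hold eventually,
   and it then holds for all smaller weights. The number of rounds is limited to O(\<upsilon> n/(K C)), so that a
   delocalized y is hardly affected by the weights.

   For the final \<Pi>, the coordinates are damped by s_i = \<tau>/(\<tau> + \<Pi>_ii), and the output is the projection onto the
   eigenvectors of X = D_s \<Pi> D_s above \<Omega>(\<upsilon>/K), whose diagonal is O(K/\<upsilon>) times that of X.

   Eigenvectors are not computable by field operations. They are replaced by the exact rational vectors B^(2^n) e_i: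
   the one with the largest Rayleigh quotient is, up to an error exponentially small in n, a top eigenvector of the
   positive semidefinite B; projecting it away and repeating gives almost invariant subspaces. *)

theory Submission
  imports Defs "Jordan_Normal_Form.Schur_Decomposition" "HOL-Real_Asymp.Real_Asymp"
begin

section \<open>Finitely supported vectors\<close>

text \<open>The program knows none of \<open>K\<close>, \<open>r\<close>, \<open>Q\<close> and
  \<open>\<gamma>\<close>. The computed \<open>\<kappa>\<close>, which is \<open>\<upsilon>\<close>
  plus the largest row sum of the input, stands in for \<open>K\<close>. No test detects that few
  negative directions remain: the rounds are simply run, and a potential argument on the weight of
  \<open>Q\<close> shows that their number suffices. Thresholds are staggered so that errors of
  \<upsilon>/32 fit between them: rounds cut at -\<upsilon>/8, the good state means few directions
  below -3\<upsilon>/16, and the final projection cuts at -\<upsilon>/4. The good state persists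
  because smaller weights are a pullback of the quadratic form along a diagonal contraction, which
  creates no new directions below a negative threshold. The damping parameter \<open>\<tau>\<close>
  balances two demands: it bounds the diagonal of \<open>X\<close>, and the total damping, at most
  d/\<tau>, may cost a delocalized vector only a fraction of \<upsilon>. For a computed projection
  only three quantities are controlled: the form on its range, the form on its kernel, and the
  coupling between the two. All later estimates use just these.\<close>

typedef fvec = "{f :: nat \<Rightarrow> real. finite {i. f i \<noteq> 0}}" morphisms co FV
  by (rule exI[of _ "\<lambda>_. 0"]) simp

lemma finite_co: "finite {i. co x i \<noteq> 0}"
  using co[of x] by simp

lemma co_FV: "finite {i. f i \<noteq> 0} \<Longrightarrow> co (FV f) = f"
  by (rule FV_inverse) simp

lemma fvec_eqI: "(\<And>i. co x i = co y i) \<Longrightarrow> x = y"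
  using co_inject by blast

text \<open>The dimension \<open>n\<close> is a value and not a type here, so a single inner product
  space has to contain every R^n; its elements are the vectors whose coordinates vanish from
  \<open>n\<close> on. As \<open>inner\<close> sums over the support of its first argument only,
  symmetry and additivity are proved over a common finite index set.\<close>

instantiation fvec :: real_inner
begin

definition "0 = FV (\<lambda>_. 0)"
definition "x + y = FV (\<lambda>i. co x i + co y i)"
definition "x - y = FV (\<lambda>i. co x i - co y i)"
definition "- x = FV (\<lambda>i. - co x i)"
definition "c *\<^sub>R x = FV (\<lambda>i. c * co x i)"
definition "inner x y = (\<Sum>i | co x i \<noteq> 0. co x i * co y i)"
definition "norm (x :: fvec) = sqrt (inner x x)"
definition "dist (x :: fvec) y = norm (x - y)"
definition "sgn (x :: fvec) = inverse (norm x) *\<^sub>R x"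
definition "(uniformity :: (fvec \<times> fvec) filter) = (INF e\<in>{0<..}. principal {(x, y). dist x y < e})"
definition "open (U :: fvec set) \<longleftrightarrow> (\<forall>x\<in>U. eventually (\<lambda>(x', y). x' = x \<longrightarrow> y \<in> U) uniformity)"

lemma co_simps:
  "co 0 i = 0" "co (x + y) i = co x i + co y i" "co (x - y) i = co x i - co y i"
  "co (- x) i = - co x i" "co (c *\<^sub>R x) i = c * co x i"
proof -
  show "co 0 i = 0" by (simp add: zero_fvec_def co_FV)
  have "finite {i. co x i + co y i \<noteq> 0}"
    by (rule finite_subset[OF _ finite_UnI[OF finite_co[of x] finite_co[of y]]]) auto
  then show "co (x + y) i = co x i + co y i" by (simp add: plus_fvec_def co_FV)
  have "finite {i. co x i - co y i \<noteq> 0}"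
    by (rule finite_subset[OF _ finite_UnI[OF finite_co[of x] finite_co[of y]]]) auto
  then show "co (x - y) i = co x i - co y i" by (simp add: minus_fvec_def co_FV)
  have "finite {i. - co x i \<noteq> 0}" using finite_co[of x] by simp
  then show "co (- x) i = - co x i" by (simp add: uminus_fvec_def co_FV)
  have "finite {i. c * co x i \<noteq> 0}"
    by (rule finite_subset[OF _ finite_co[of x]]) auto
  then show "co (c *\<^sub>R x) i = c * co x i" by (simp add: scaleR_fvec_def co_FV)
qed

lemma inner_on:
  assumes "finite S" "{i. co x i \<noteq> 0} \<subseteq> S"
  shows "inner x y = (\<Sum>i\<in>S. co x i * co y i)"
  unfolding inner_fvec_def by (rule sum.mono_neutral_left) (use assms in auto)

instance
proof
  fix x y z :: fvec and a b :: real
  show "x + y + z = x + (y + z)" "x + y = y + x" "0 + x = x" "- x + x = 0" "x - y = x + - y"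
    "a *\<^sub>R (x + y) = a *\<^sub>R x + a *\<^sub>R y" "(a + b) *\<^sub>R x = a *\<^sub>R x + b *\<^sub>R x"
    "a *\<^sub>R b *\<^sub>R x = (a * b) *\<^sub>R x" "1 *\<^sub>R x = x"
    by (auto intro!: fvec_eqI simp: co_simps algebra_simps)
  show "dist x y = norm (x - y)" by (rule dist_fvec_def)
  show "sgn x = inverse (norm x) *\<^sub>R x" by (rule sgn_fvec_def)
  show "(uniformity :: (fvec \<times> fvec) filter) = (INF e\<in>{0<..}. principal {(x, y). dist x y < e})"
    by (rule uniformity_fvec_def)
  show "open (U :: fvec set) \<longleftrightarrow> (\<forall>x\<in>U. eventually (\<lambda>(x', y). x' = x \<longrightarrow> y \<in> U) uniformity)" for U
    by (rule open_fvec_def)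
  let ?S = "{i. co x i \<noteq> 0} \<union> {i. co y i \<noteq> 0} \<union> {i. co z i \<noteq> 0}"
  have fin: "finite ?S" by (simp add: finite_co)
  have *: "inner u v = (\<Sum>i\<in>?S. co u i * co v i)" if "{i. co u i \<noteq> 0} \<subseteq> ?S" for u v
    by (rule inner_on[OF fin that])
  have sub: "{i. co x i \<noteq> 0} \<subseteq> ?S" "{i. co y i \<noteq> 0} \<subseteq> ?S" "{i. co (x + y) i \<noteq> 0} \<subseteq> ?S"
    "{i. co (a *\<^sub>R x) i \<noteq> 0} \<subseteq> ?S"
    by (auto simp: co_simps)
  show "inner x y = inner y x"
    using sub by (simp add: * mult.commute)
  show "inner (x + y) z = inner x z + inner y z"
    using sub by (simp add: * co_simps distrib_right sum.distrib)
  show "inner (a *\<^sub>R x) y = a * inner x y"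
    using sub by (simp add: * co_simps sum_distrib_left mult.assoc)
  show "0 \<le> inner x x" unfolding inner_fvec_def by (rule sum_nonneg) simp
  show "inner x x = 0 \<longleftrightarrow> x = 0"
  proof
    assume "inner x x = 0"
    then have "\<forall>i\<in>{i. co x i \<noteq> 0}. co x i * co x i = 0"
      unfolding inner_fvec_def by (subst (asm) sum_nonneg_eq_0_iff) (auto simp: finite_co)
    then have "co x i = 0" for i by (cases "co x i = 0") auto
    then show "x = 0" by (intro fvec_eqI) (simp add: co_simps)
  qed (simp add: inner_fvec_def co_simps)
  show "norm x = sqrt (inner x x)" by (rule norm_fvec_def)
qed

end

definition bv :: "nat \<Rightarrow> fvec" where
  "bv i = FV (\<lambda>j. if j = i then 1 else 0)"

lemma co_bv: "co (bv i) j = (if j = i then 1 else 0)"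
  unfolding bv_def by (simp add: co_FV)

lemma inner_bv: "inner x (bv i) = co x i"
proof -
  have "inner x (bv i) = (\<Sum>j\<in>insert i {j. co x j \<noteq> 0}. co x j * co (bv i) j)"
    by (rule inner_on) (auto simp: finite_co)
  also have "\<dots> = (\<Sum>j\<in>insert i {j. co x j \<noteq> 0}. if j = i then co x i else 0)"
    by (rule sum.cong) (auto simp: co_bv)
  also have "\<dots> = co x i" by (simp add: finite_co)
  finally show ?thesis .
qed

lemma inner_bv_bv: "inner (bv i) (bv j) = (if i = j then 1 else 0)"
  by (simp add: inner_bv co_bv)

section \<open>The power method for positive semidefinite operators\<close>

definition selfadj :: "('a::real_inner \<Rightarrow> 'a) \<Rightarrow> bool" where
  "selfadj T \<longleftrightarrow> linear T \<and> (\<forall>x y. inner (T x) y = inner x (T y))"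

definition psd :: "('a::real_inner \<Rightarrow> 'a) \<Rightarrow> bool" where
  "psd T \<longleftrightarrow> selfadj T \<and> (\<forall>x. 0 \<le> inner (T x) x)"

definition projector :: "('a::real_inner \<Rightarrow> 'a) \<Rightarrow> bool" where
  "projector T \<longleftrightarrow> selfadj T \<and> (\<forall>x. T (T x) = T x)"

lemma selfadj_inner: "selfadj T \<Longrightarrow> inner (T x) y = inner x (T y)"
  by (simp add: selfadj_def)

lemma psd_selfadj: "psd T \<Longrightarrow> selfadj T"
  by (simp add: psd_def)

text \<open>The form of \<open>T\<close> is nonnegative along the line x + t y, and t = -b/c turns
  this into the discriminant inequality. For c = 0 the form is affine in t, which forces b =
  0.\<close>

lemma psd_cauchy_schwarz:
  assumes "psd T"
  shows "(inner (T x) y)\<^sup>2 \<le> inner (T x) x * inner (T y) y"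
proof -
  have lin: "linear T" and sym: "inner (T u) v = inner u (T v)" and pos: "0 \<le> inner (T u) u" for u v
    using assms by (auto simp: psd_def selfadj_def)
  define a b c where "a = inner (T x) x" and "b = inner (T x) y" and "c = inner (T y) y"
  have quad: "0 \<le> a + 2 * t * b + t\<^sup>2 * c" for t
  proof -
    have "inner (T (x + t *\<^sub>R y)) (x + t *\<^sub>R y) = a + 2 * t * b + t\<^sup>2 * c"
      using sym[of y x]
      by (simp add: a_def b_def c_def linear_add[OF lin] linear_scale[OF lin] inner_simps
          power2_eq_square algebra_simps inner_commute)
    with pos[of "x + t *\<^sub>R y"] show ?thesis by simp
  qed
  show ?thesis
  proof (cases "c = 0")
    case True
    have "b = 0"
    proof (rule ccontr)
      assume "b \<noteq> 0"
      \<comment> \<open>At this t the affine function takes the value -1.\<close>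
      then show False using quad[of "- (a + 1) / (2 * b)"] True by (simp add: field_simps)
    qed
    then show ?thesis using True by (simp add: b_def[symmetric] c_def[symmetric])
  next
    case False
    then have "c > 0" using pos[of y] by (simp add: c_def)
    then show ?thesis using quad[of "- b / c"]
      by (simp add: a_def[symmetric] b_def[symmetric] c_def[symmetric] field_simps power2_eq_square)
  qed
qed

text \<open>Spectrally this is t^2 \<le> L t on [0, L]. Without a spectral theorem: Cauchy-Schwarz
  for the form of \<open>T\<close> at \<open>x\<close> and \<open>T x\<close>, after which one
  factor |T x|^2 cancels.\<close>

lemma psd_norm_sq_bound:
  assumes "psd T" and L: "\<And>x. inner (T x) x \<le> L * inner x x"
  shows "inner (T x) (T x) \<le> L * inner (T x) x"
proof (cases "T x = 0")
  case True
  then show ?thesis by simp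
next
  case False
  then have p: "inner (T x) (T x) > 0" by simp
  have "(inner (T x) (T x))\<^sup>2 \<le> inner (T x) x * inner (T (T x)) (T x)"
    by (rule psd_cauchy_schwarz[OF assms(1)])
  also have "\<dots> \<le> inner (T x) x * (L * inner (T x) (T x))"
    using assms(1) L by (intro mult_left_mono) (auto simp: psd_def)
  finally show ?thesis using p by (simp add: power2_eq_square ac_simps)
qed

text \<open>Log-convexity makes the ratios of consecutive terms increase, hence also their geometric
  means (m k)^(1/k). Integer powers avoid roots and divisions, since \<open>m\<close> may
  vanish.\<close>

lemma log_convex_seq:
  fixes m :: "nat \<Rightarrow> real"
  assumes m0: "m 0 = 1" and nonneg: "\<And>j. 0 \<le> m j" and lc: "\<And>j. (m (Suc j))\<^sup>2 \<le> m j * m (Suc (Suc j))"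
  shows "m k ^ Suc k \<le> m (Suc k) ^ k" and "m 1 ^ k \<le> m k"
proof -
  have B: "m k ^ Suc k \<le> m (Suc k) ^ k" for k
  proof (induction k)
    case 0
    then show ?case by (simp add: m0)
  next
    case (Suc k)
    show ?case
    proof (cases "m (Suc k) = 0")
      case True
      then show ?thesis by (simp add: nonneg)
    next
      case False
      then have p: "m (Suc k) ^ k > 0" using nonneg[of "Suc k"] by simp
      have "m (Suc k) ^ k * m (Suc k) ^ Suc (Suc k) = ((m (Suc k))\<^sup>2) ^ Suc k"
        by (simp add: power_mult[symmetric] power_add[symmetric] mult_2 del: power_Suc)
      also have "\<dots> \<le> (m k * m (Suc (Suc k))) ^ Suc k"
        by (rule power_mono[OF lc]) simp
      also have "\<dots> = m k ^ Suc k * m (Suc (Suc k)) ^ Suc k"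
        by (rule power_mult_distrib)
      also have "\<dots> \<le> m (Suc k) ^ k * m (Suc (Suc k)) ^ Suc k"
        by (rule mult_right_mono[OF Suc]) (simp add: nonneg)
      finally show ?thesis using p by (simp del: power_Suc)
    qed
  qed
  then show "m k ^ Suc k \<le> m (Suc k) ^ k" .
  show "m 1 ^ k \<le> m k"
  proof (induction k)
    case 0
    then show ?case by (simp add: m0)
  next
    case (Suc k)
    show ?case
    proof (cases k)
      case 0
      then show ?thesis by simp
    next
      case (Suc l)
      have "(m 1 * m k) ^ k = m 1 ^ k * m k ^ k" by (rule power_mult_distrib)
      also have "\<dots> \<le> m k * m k ^ k"
        using Suc.IH nonneg by (intro mult_right_mono) auto
      also have "\<dots> \<le> m (Suc k) ^ k" using B[of k] by simp
      finally have "m 1 * m k \<le> m (Suc k)"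
        using Suc nonneg by (metis power_le_imp_le_base)
      moreover have "m 1 ^ Suc k \<le> m 1 * m k"
        using Suc.IH nonneg by (simp add: mult_left_mono)
      ultimately show ?thesis by linarith
    qed
  qed
qed

lemma selfadj_funpow: "selfadj T \<Longrightarrow> selfadj (T ^^ k)"
proof (induction k)
  case 0
  then show ?case by (simp add: selfadj_def linear_iff)
next
  case (Suc k)
  then have "linear (\<lambda>x. T ((T ^^ k) x))"
    using linear_compose[of "T ^^ k" T] by (auto simp: selfadj_def comp_def)
  with Suc show ?case
    by (simp add: selfadj_def funpow_swap1[symmetric])
qed

lemma inner_funpow:
  assumes "selfadj T"
  shows "inner ((T ^^ (j + k)) x) y = inner ((T ^^ j) x) ((T ^^ k) y)"
  using selfadj_inner[OF selfadj_funpow[OF assms, of k]]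
  by (metis add.commute comp_apply funpow_add)

text \<open>Even moments are squared norms of iterates, odd ones are values of the form of
  \<open>T\<close> at iterates. So log-convexity at even \<open>j\<close> is the ordinary
  Cauchy-Schwarz inequality, and at odd \<open>j\<close> the one for the form of
  \<open>T\<close>.\<close>

lemma moments:
  fixes T :: "'a::real_inner \<Rightarrow> 'a"
  assumes T: "psd T"
  defines "m \<equiv> \<lambda>x j. inner ((T ^^ j) x) x"
  shows "0 \<le> m x j" and "(m x (Suc j))\<^sup>2 \<le> m x j * m x (Suc (Suc j))"
proof -
  have sa: "selfadj T" and pos: "0 \<le> inner (T u) u" for u using T by (auto simp: psd_def)
  have e: "m x (i + i) = inner ((T ^^ i) x) ((T ^^ i) x)" for i
    unfolding m_def by (rule inner_funpow[OF sa])
  have o: "m x (Suc (i + i)) = inner (T ((T ^^ i) x)) ((T ^^ i) x)" for i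
    unfolding m_def using inner_funpow[OF sa, of "Suc i" i] by simp
  have e2: "m x (Suc (Suc (i + i))) = inner (T ((T ^^ i) x)) (T ((T ^^ i) x))" for i
    using e[of "Suc i"] by simp
  have e3: "m x (Suc (Suc (i + i))) = inner (T ((T ^^ i) x)) ((T ^^ Suc i) x)" for i
    using e[of "Suc i"] by simp
  have o2: "m x (Suc (Suc (Suc (i + i)))) = inner (T ((T ^^ Suc i) x)) ((T ^^ Suc i) x)" for i
    using o[of "Suc i"] by simp
  have par: "(\<exists>i. j = i + i) \<or> (\<exists>i. j = Suc (i + i))" by presburger
  then show "0 \<le> m x j" using e o pos by auto
  from par show "(m x (Suc j))\<^sup>2 \<le> m x j * m x (Suc (Suc j))"
  proof (elim disjE exE)
    fix i assume "j = i + i"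
    then show ?thesis using Cauchy_Schwarz_ineq[of "T ((T ^^ i) x)" "(T ^^ i) x"]
      by (simp add: e o e2 mult.commute)
  next
    fix i assume j: "j = Suc (i + i)"
    show ?thesis using psd_cauchy_schwarz[OF T, of "(T ^^ i) x" "(T ^^ Suc i) x"]
      unfolding j e3 o2 o .
  qed
qed

text \<open>Jensen's inequality for t^(2k) under the spectral measure of \<open>z\<close>, obtained
  from log-convexity of the normalized moments.\<close>

lemma psd_power_lower:
  assumes T: "psd T" and k: "k > 0"
  shows "inner (T z) z ^ (2 * k) \<le> inner ((T ^^ k) z) ((T ^^ k) z) * inner z z ^ (2 * k - 1)"
proof (cases "z = 0")
  case True
  then show ?thesis using k by (simp add: zero_power)
next
  case False
  then have z: "inner z z > 0" by auto
  have sa: "selfadj T" using T by (rule psd_selfadj)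
  define m where "m = (\<lambda>j. inner ((T ^^ j) z) z / inner z z)"
  have "m 1 ^ (2 * k) \<le> m (2 * k)"
  proof (rule log_convex_seq(2))
    show "m 0 = 1" using z by (simp add: m_def)
    show "0 \<le> m j" for j using moments(1)[OF T, of j z] z by (simp add: m_def)
    show "(m (Suc j))\<^sup>2 \<le> m j * m (Suc (Suc j))" for j
      using divide_right_mono[OF moments(2)[OF T, of j z], of "(inner z z)\<^sup>2"] z
      by (simp add: m_def power_divide power2_eq_square)
  qed
  then have "inner (T z) z ^ (2 * k) / inner z z ^ (2 * k) \<le> inner ((T ^^ (k + k)) z) z / inner z z"
    by (simp add: m_def power_divide mult_2)
  then have "inner (T z) z ^ (2 * k) \<le> inner ((T ^^ (k + k)) z) z / inner z z * inner z z ^ (2 * k)"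
    using z by (simp add: pos_divide_le_eq)
  also have "\<dots> = inner ((T ^^ k) z) ((T ^^ k) z) * inner z z ^ (2 * k - 1)"
    using z k by (simp add: inner_funpow[OF sa] power_eq_if[of _ "2 * k"])
  finally show ?thesis .
qed

text \<open>The Rayleigh quotient of \<open>h\<close> is the ratio of the moments 2k+1 and 2k; it is
  at least each of the 2k earlier ratios, whose product is the moment 2k, the squared norm of
  \<open>h\<close>. So an iterate with a small Rayleigh quotient must itself be short.\<close>

lemma psd_power_upper:
  assumes T: "psd T" and x: "inner x x = 1" and k: "k > 0"
  defines "h \<equiv> (T ^^ k) x"
  shows "inner h h \<le> (inner (T h) h / inner h h) ^ (2 * k)"
proof (cases "h = 0")
  case True
  then show ?thesis using k by simp
next
  case False
  then have h: "inner h h > 0" by simp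
  have sa: "selfadj T" using T by (rule psd_selfadj)
  define m where "m = (\<lambda>j. inner ((T ^^ j) x) x)"
  have 1: "m (k + k) = inner h h" unfolding m_def h_def by (rule inner_funpow[OF sa])
  have 2: "m (Suc (k + k)) = inner (T h) h" unfolding m_def h_def
    using inner_funpow[OF sa, of "Suc k" k] by simp
  have "m (k + k) ^ Suc (k + k) \<le> m (Suc (k + k)) ^ (k + k)"
    by (rule log_convex_seq(1)) (auto simp: m_def x moments[OF T] simp del: funpow.simps)
  then show ?thesis using h by (simp add: 1 2 power_divide mult_2 pos_le_divide_eq)
qed

definition supp_in :: "nat \<Rightarrow> ('a \<Rightarrow> fvec) \<Rightarrow> bool" where
  "supp_in n T \<longleftrightarrow> (\<forall>x. \<forall>i\<ge>n. co (T x) i = 0)"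

definition symop :: "nat \<Rightarrow> (fvec \<Rightarrow> fvec) \<Rightarrow> bool" where
  "symop n T \<longleftrightarrow> selfadj T \<and> supp_in n T"

lemma symopD: "symop n T \<Longrightarrow> selfadj T" "symop n T \<Longrightarrow> supp_in n T"
  by (auto simp: symop_def)

lemma inner_lt:
  assumes "\<And>i. i \<ge> n \<Longrightarrow> co x i = 0"
  shows "inner x y = (\<Sum>i<n. co x i * co y i)"
  by (rule inner_on) (use assms in \<open>auto simp: not_less[symmetric]\<close>)

lemma co_sum: "co (sum f A) i = (\<Sum>a\<in>A. co (f a) i)"
  by (induction A rule: infinite_finite_induct) (auto simp: co_simps)

text \<open>\<open>symop\<close> restricts only the range to coordinates below \<open>n\<close>;
  self-adjointness transfers the restriction to the argument, so \<open>T\<close> ignores all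
  coordinates from \<open>n\<close> on.\<close>

lemma symop_expand:
  assumes "symop n T"
  shows "T z = (\<Sum>i<n. co z i *\<^sub>R T (bv i))"
proof (rule fvec_eqI)
  fix j
  have sa: "selfadj T" and su: "supp_in n T" using assms by (auto simp: symop_def)
  have "co (T z) j = inner (T (bv j)) z"
    by (metis inner_bv inner_commute sa selfadj_inner)
  also have "\<dots> = (\<Sum>i<n. co (T (bv j)) i * co z i)"
    by (rule inner_lt) (use su in \<open>auto simp: supp_in_def\<close>)
  also have "\<dots> = (\<Sum>i<n. co z i * co (T (bv i)) j)"
    by (rule sum.cong) (auto, metis inner_bv inner_commute sa selfadj_inner)
  finally show "co (T z) j = co (\<Sum>i<n. co z i *\<^sub>R T (bv i)) j"
    by (simp add: co_sum co_simps)
qed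

lemma symop_funpow: "symop n T \<Longrightarrow> k > 0 \<Longrightarrow> symop n (T ^^ k)"
  by (cases k) (auto simp: symop_def supp_in_def intro: selfadj_funpow simp del: funpow.simps, simp)

lemma sum_co_sq_le: "(\<Sum>i<n. (co z i)\<^sup>2) \<le> inner z z"
proof -
  have "(\<Sum>i<n. (co z i)\<^sup>2) \<le> (\<Sum>i\<in>{..<n} \<union> {i. co z i \<noteq> 0}. (co z i)\<^sup>2)"
    by (rule sum_mono2) (auto simp: finite_co)
  also have "\<dots> = inner z z"
    by (subst inner_on[of "{..<n} \<union> {i. co z i \<noteq> 0}"]) (auto simp: finite_co power2_eq_square)
  finally show ?thesis .
qed

text \<open>All start vectors of the power method together see the top of the spectrum.\<close>

lemma power_method_bound:
  assumes T: "psd T" and su: "symop n T" and k: "k > 0"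
    and rho: "\<And>i. i < n \<Longrightarrow> inner (T ((T ^^ k) (bv i))) ((T ^^ k) (bv i)) /
      inner ((T ^^ k) (bv i)) ((T ^^ k) (bv i)) \<le> \<rho>"
    and rho0: "0 \<le> \<rho>"
  shows "inner (T z) z \<le> (1 + real n / real (2 * k)) * \<rho> * inner z z"
proof -
  let ?h = "\<lambda>i. (T ^^ k) (bv i)"
  \<comment> \<open>A common bound on the Rayleigh quotients bounds the iterates of all basis
    vectors, and expanding \<open>z\<close> in the basis then bounds
    \<open>(T ^^ k) z\<close>.\<close>
  have hb: "inner (?h i) (?h i) \<le> \<rho> ^ (2 * k)" if "i < n" for i
  proof -
    have "inner (?h i) (?h i) \<le> (inner (T (?h i)) (?h i) / inner (?h i) (?h i)) ^ (2 * k)"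
      by (rule psd_power_upper[OF T _ k]) (simp add: inner_bv_bv)
    also have "\<dots> \<le> \<rho> ^ (2 * k)"
      using T by (intro power_mono rho[OF that] divide_nonneg_nonneg) (auto simp: psd_def)
    finally show ?thesis .
  qed
  have nrm: "norm ((T ^^ k) z) \<le> sqrt (inner z z) * sqrt (n * \<rho> ^ (2 * k))"
  proof -
    have "norm ((T ^^ k) z) \<le> (\<Sum>i<n. \<bar>co z i\<bar> * norm (?h i))"
      by (subst symop_expand[OF symop_funpow[OF su k]]) (rule sum_norm_le, simp)
    also have "\<dots> \<le> sqrt (\<Sum>i<n. (\<bar>co z i\<bar>)\<^sup>2) * sqrt (\<Sum>i<n. (norm (?h i))\<^sup>2)"
      using L2_set_mult_ineq[of "\<lambda>i. \<bar>co z i\<bar>" "\<lambda>i. norm (?h i)" "{..<n}"] by (simp add: L2_set_def)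
    also have "\<dots> \<le> sqrt (inner z z) * sqrt (n * \<rho> ^ (2 * k))"
    proof (intro mult_mono real_sqrt_le_mono)
      show "(\<Sum>i<n. (\<bar>co z i\<bar>)\<^sup>2) \<le> inner z z" using sum_co_sq_le by simp
      have "(\<Sum>i<n. (norm (?h i))\<^sup>2) \<le> (\<Sum>i<n. \<rho> ^ (2 * k))"
        by (rule sum_mono) (use hb in \<open>simp add: power2_norm_eq_inner\<close>)
      then show "(\<Sum>i<n. (norm (?h i))\<^sup>2) \<le> n * \<rho> ^ (2 * k)" by simp
    qed (auto intro: sum_nonneg)
    finally show ?thesis .
  qed
  have "inner ((T ^^ k) z) ((T ^^ k) z) \<le> (sqrt (inner z z) * sqrt (n * \<rho> ^ (2 * k)))\<^sup>2"
    using power_mono[OF nrm, of 2] by (simp add: power2_norm_eq_inner)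
  also have "\<dots> = inner z z * (n * \<rho> ^ (2 * k))" using rho0 by (simp add: power_mult_distrib)
  finally have up: "inner ((T ^^ k) z) ((T ^^ k) z) \<le> inner z z * (n * \<rho> ^ (2 * k))" .
  have "inner (T z) z ^ (2 * k) \<le> inner ((T ^^ k) z) ((T ^^ k) z) * inner z z ^ (2 * k - 1)"
    by (rule psd_power_lower[OF T k])
  also have "\<dots> \<le> inner z z * (n * \<rho> ^ (2 * k)) * inner z z ^ (2 * k - 1)"
    by (rule mult_right_mono[OF up]) simp
  also have "\<dots> = n * (\<rho> * inner z z) ^ (2 * k)"
    using k by (simp add: power_eq_if[of _ "2 * k"] power_mult_distrib)
  also have "\<dots> \<le> (1 + real n / real (2 * k)) ^ (2 * k) * (\<rho> * inner z z) ^ (2 * k)"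
  proof (rule mult_right_mono)
    \<comment> \<open>The dimension factor moves into the base: by Bernoulli the 2k-th root of n is
      at most 1 + n/(2k). This is the origin of \<open>\<epsilon>\<close>.\<close>
    have "real n \<le> 1 + real (2 * k) * (real n / real (2 * k))" using k by simp
    also have "\<dots> \<le> (1 + real n / real (2 * k)) ^ (2 * k)"
      by (rule Bernoulli_inequality) (simp add: order_trans[of _ 0])
    finally show "real n \<le> (1 + real n / real (2 * k)) ^ (2 * k)" .
  qed (use rho0 in simp)
  also have "\<dots> = ((1 + real n / real (2 * k)) * (\<rho> * inner z z)) ^ (2 * k)"
    by (rule power_mult_distrib[symmetric])
  finally have "inner (T z) z \<le> (1 + real n / real (2 * k)) * (\<rho> * inner z z)"
    by (subst (asm) power_mono_iff) (use k rho0 T in \<open>auto simp: psd_def\<close>)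
  then show ?thesis by (simp add: mult.assoc)
qed

section \<open>Greedy spectral projections\<close>

text \<open>For a projection this is the dimension of its range. Counting dimensions by traces
  avoids bases and rank arguments on \<open>fvec\<close>.\<close>

definition trace_on :: "nat \<Rightarrow> (fvec \<Rightarrow> fvec) \<Rightarrow> real" where
  "trace_on n T = (\<Sum>i<n. co (T (bv i)) i)"

lemma projector_idem: "projector T \<Longrightarrow> T (T x) = T x"
  by (simp add: projector_def)

lemma projector_diff: "projector T \<Longrightarrow> T (x - y) = T x - T y"
  by (simp add: projector_def selfadj_def linear_diff)

lemma projector_add: "projector T \<Longrightarrow> T (x + y) = T x + T y"
  by (simp add: projector_def selfadj_def linear_add)

lemma projector_scale: "projector T \<Longrightarrow> T (c *\<^sub>R x) = c *\<^sub>R T x"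
  by (simp add: projector_def selfadj_def linear_scale)

lemma projector_inner: "projector T \<Longrightarrow> inner (T x) y = inner x (T y)"
  by (simp add: projector_def selfadj_def)

lemma projector_rank_one_add:
  assumes T: "projector T" and g: "T g = 0" "g \<noteq> 0"
  shows "projector (\<lambda>x. T x + (inner x g / inner g g) *\<^sub>R g)"
proof -
  have p: "inner g g \<noteq> 0" using g by simp
  have i0: "inner (T x) g = 0" for x using projector_inner[OF T, of x g] g by simp
  have "linear (\<lambda>x. T x + (inner x g / inner g g) *\<^sub>R g)"
    by (rule linearI)
      (simp_all add: projector_add[OF T] projector_scale[OF T] inner_simps add_divide_distrib
        scaleR_add_left scaleR_add_right)
  moreover have "inner (T x + (inner x g / inner g g) *\<^sub>R g) y =
      inner x (T y + (inner y g / inner g g) *\<^sub>R g)" for x y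
    using projector_inner[OF T, of x y] by (simp add: inner_simps inner_commute mult.commute)
  ultimately show ?thesis
    unfolding projector_def selfadj_def using p
    by (simp add: projector_add[OF T] projector_scale[OF T] projector_idem[OF T] g i0 inner_simps
        del: inner_eq_zero_iff)
qed

lemma projector_rank_one_diff:
  assumes T: "projector T" and g: "T g = g" "g \<noteq> 0"
  shows "projector (\<lambda>x. T x - (inner x g / inner g g) *\<^sub>R g)"
proof -
  have p: "inner g g \<noteq> 0" using g by simp
  have i0: "inner (T x) g = inner x g" for x using projector_inner[OF T, of x g] g by simp
  have "linear (\<lambda>x. T x - (inner x g / inner g g) *\<^sub>R g)"
    by (rule linearI)
      (simp_all add: projector_add[OF T] projector_scale[OF T] inner_simps add_divide_distrib
        scaleR_add_left scaleR_diff_right)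
  moreover have "inner (T x - (inner x g / inner g g) *\<^sub>R g) y =
      inner x (T y - (inner y g / inner g g) *\<^sub>R g)" for x y
    using projector_inner[OF T, of x y] by (simp add: inner_simps inner_commute mult.commute)
  ultimately show ?thesis
    unfolding projector_def selfadj_def using p
    by (simp add: projector_diff[OF T] projector_scale[OF T] projector_idem[OF T] g i0 inner_simps
        del: inner_eq_zero_iff)
qed

lemma trace_rank_one:
  assumes "\<And>i. i \<ge> n \<Longrightarrow> co g i = 0" "g \<noteq> 0"
  shows "(\<Sum>i<n. inner (bv i) g / inner g g * co g i) = 1"
proof -
  have "(\<Sum>i<n. inner (bv i) g / inner g g * co g i) = (\<Sum>i<n. co g i * co g i) / inner g g"
    unfolding sum_divide_distrib by (rule sum.cong) (auto simp: inner_bv inner_commute[of "bv _"])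
  also have "(\<Sum>i<n. co g i * co g i) = inner g g"
    by (rule inner_lt[symmetric]) (use assms in auto)
  finally show ?thesis using assms by simp
qed

text \<open>Each linear condition costs at most one dimension: within the range of \<open>S\<close>,
  orthogonality to \<open>g\<close> means orthogonality to \<open>S g\<close>, and the line through
  \<open>S g\<close> is removed if it is nonzero.\<close>

lemma projector_cut:
  assumes "projector T" "symop n T"
  shows "\<exists>S. projector S \<and> symop n S \<and> trace_on n S \<ge> trace_on n T - real (length gs) \<and>
    (\<forall>x. T (S x) = S x) \<and> (\<forall>x. \<forall>g\<in>set gs. inner (S x) g = 0)"
proof (induction gs)
  case Nil
  show ?case using assms by (intro exI[of _ T]) (auto simp: projector_idem)
next
  case (Cons g gs)
  then obtain S where S: "projector S" "symop n S" "trace_on n S \<ge> trace_on n T - real (length gs)"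
    and TS: "\<And>x. T (S x) = S x" and orth: "\<And>x g. g \<in> set gs \<Longrightarrow> inner (S x) g = 0" by auto
  define h where "h = S g"
  show ?case
  proof (cases "h = 0")
    case True
    then have "inner (S x) g = 0" for x using projector_inner[OF S(1), of x g] by (simp add: h_def)
    then show ?thesis using S TS orth by (intro exI[of _ S]) auto
  next
    case False
    have Sh: "S h = h" by (simp add: h_def projector_idem[OF S(1)])
    have hn: "co h i = 0" if "i \<ge> n" for i
      using symopD(2)[OF S(2)] that by (auto simp: supp_in_def h_def)
    define S' where "S' = (\<lambda>x. S x - (inner x h / inner h h) *\<^sub>R h)"
    have pr: "projector S'" unfolding S'_def by (rule projector_rank_one_diff[OF S(1) Sh False])
    have SS': "S (S' x) = S' x" for x
      by (simp add: S'_def projector_diff[OF S(1)] projector_scale[OF S(1)] projector_idem[OF S(1)] Sh)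
    have "supp_in n S'" using symopD(2)[OF S(2)] hn by (auto simp: supp_in_def S'_def co_simps)
    then have so: "symop n S'" using pr by (auto simp: symop_def projector_def)
    have "trace_on n S' = trace_on n S - (\<Sum>i<n. inner (bv i) h / inner h h * co h i)"
      by (simp add: trace_on_def S'_def co_simps sum_subtractf)
    then have tr: "trace_on n S' = trace_on n S - 1" using trace_rank_one[of n h] hn False by simp
    have S'h: "inner (S' x) h = 0" for x
      using projector_inner[OF S(1), of x h] Sh False
      by (simp add: S'_def inner_simps del: inner_eq_zero_iff) simp
    have "inner (S' x) g = 0" for x
      using projector_inner[OF S(1), of "S' x" g] SS'[of x] S'h[of x] by (simp add: h_def)
    moreover have "inner (S' x) g' = 0" if "g' \<in> set gs" for x g'
      using orth[OF that, of "S' x"] SS' by simp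
    moreover have "T (S' x) = S' x" for x using TS[of "S' x"] SS' by simp
    ultimately show ?thesis using pr so tr S(3) by (intro exI[of _ S']) auto
  qed
qed

text \<open>\<open>m\<close> counts rounds, while \<open>gs\<close> lists the vectors accepted so
  far, one per dimension. The coupling error grows linearly in \<open>m\<close> and the loss on the
  range quadratically. The last disjunct records that either every round accepted a vector or the
  complement is already certified.\<close>

definition greedy_inv ::
    "nat \<Rightarrow> (fvec \<Rightarrow> fvec) \<Rightarrow> real \<Rightarrow> real \<Rightarrow> real \<Rightarrow> nat \<Rightarrow> (fvec \<Rightarrow> fvec) \<Rightarrow> bool" where
  "greedy_inv n B \<beta> \<epsilon> \<eta> m T \<longleftrightarrow> symop n T \<and> projector T \<and>
    (\<forall>u z. T u = u \<longrightarrow> T z = 0 \<longrightarrow> \<bar>inner (B u) z\<bar> \<le> real m * \<eta> * norm u * norm z) \<and>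
    (\<forall>u. T u = u \<longrightarrow> (\<beta> - (real m)\<^sup>2 * \<eta>) * (norm u)\<^sup>2 \<le> inner (B u) u) \<and>
    (\<exists>gs. trace_on n T = real (length gs) \<and> (\<forall>x. T x = (\<Sum>g\<leftarrow>gs. (inner x g / inner g g) *\<^sub>R g)) \<and>
      (\<forall>g\<in>set gs. T g = g \<and> (\<forall>i\<ge>n. co g i = 0)) \<and>
      (length gs = m \<or> (\<forall>z. T z = 0 \<longrightarrow> inner (B z) z \<le> (1 + \<epsilon>) * \<beta> * (norm z)\<^sup>2)))"

lemma greedy_inv_0:
  assumes "linear B"
  shows "greedy_inv n B \<beta> \<epsilon> \<eta> 0 (\<lambda>x. 0)"
  unfolding greedy_inv_def
proof (intro conjI exI[of _ "[]"])
  show "symop n (\<lambda>x. 0)" "projector (\<lambda>x. 0)"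
    by (auto simp: symop_def supp_in_def projector_def selfadj_def linear_iff co_simps)
qed (use assms in \<open>auto simp: trace_on_def co_simps linear_0[OF assms]\<close>)

lemma greedy_inv_mono:
  assumes "greedy_inv n B \<beta> \<epsilon> \<eta> m T" "0 \<le> \<eta>"
    and "\<And>z. T z = 0 \<Longrightarrow> inner (B z) z \<le> (1 + \<epsilon>) * \<beta> * (norm z)\<^sup>2"
  shows "greedy_inv n B \<beta> \<epsilon> \<eta> (Suc m) T"
proof -
  have 1: "real m * \<eta> * norm u * norm z \<le> real (Suc m) * \<eta> * norm u * norm z" for u z :: fvec
    using assms(2) by (intro mult_right_mono) auto
  have 2: "(\<beta> - (real (Suc m))\<^sup>2 * \<eta>) * (norm u)\<^sup>2 \<le> (\<beta> - (real m)\<^sup>2 * \<eta>) * (norm u)\<^sup>2" for u :: fvec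
    using assms(2) by (intro mult_right_mono diff_left_mono power_mono) auto
  obtain gs where gs: "trace_on n T = real (length gs)"
      "\<forall>x. T x = (\<Sum>g\<leftarrow>gs. (inner x g / inner g g) *\<^sub>R g)" "\<forall>g\<in>set gs. T g = g \<and> (\<forall>i\<ge>n. co g i = 0)"
    using assms(1) unfolding greedy_inv_def by auto
  have T: "symop n T" "projector T"
    "\<And>u z. T u = u \<Longrightarrow> T z = 0 \<Longrightarrow> \<bar>inner (B u) z\<bar> \<le> real m * \<eta> * norm u * norm z"
    "\<And>u. T u = u \<Longrightarrow> (\<beta> - (real m)\<^sup>2 * \<eta>) * (norm u)\<^sup>2 \<le> inner (B u) u"
    using assms(1) unfolding greedy_inv_def by auto
  show ?thesis
    unfolding greedy_inv_def
  proof (intro conjI allI impI exI[of _ gs] disjI2)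
    show "\<bar>inner (B u) z\<bar> \<le> real (Suc m) * \<eta> * norm u * norm z" if "T u = u" "T z = 0" for u z
      using T(3)[OF that] 1[of u z] by linarith
    show "(\<beta> - (real (Suc m))\<^sup>2 * \<eta>) * (norm u)\<^sup>2 \<le> inner (B u) u" if "T u = u" for u
      using T(4)[OF that] 2[of u] by linarith
  qed (use T gs assms(3) in auto)
qed

text \<open>\<open>G\<close> is the compression of \<open>B\<close> to the complement of
  \<open>T\<close>. If the best Rayleigh quotient is at most \<open>\<beta>\<close>, the power
  method certifies the whole complement. Otherwise the best vector \<open>h b\<close> is almost an
  eigenvector of \<open>G\<close>, and it joins the range at the price of one more coupling error
  \<open>\<eta>\<close>.\<close>

lemma greedy_step:
  fixes B T :: "fvec \<Rightarrow> fvec"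
  assumes B: "psd B" "symop n B" and L: "\<And>x. inner (B x) x \<le> L * (norm x)\<^sup>2"
    and inv: "greedy_inv n B \<beta> \<epsilon> \<eta> m T" and b: "b < n" and beta: "\<beta> > 0" and k: "k > 0"
    and \<epsilon>_def: "\<epsilon> = real n / real (2 * k)" and \<eta>_def: "\<eta> = L * sqrt \<epsilon>"
    and G_def: "G = (\<lambda>x. B (x - T x) - T (B (x - T x)))"
    and h_def: "h = (\<lambda>i. (G ^^ k) (bv i))"
    and \<rho>_def: "\<rho> = (\<lambda>i. inner (G (h i)) (h i) / inner (h i) (h i))"
    and max: "\<And>i. i < n \<Longrightarrow> \<rho> i \<le> \<rho> b"
  shows "greedy_inv n B \<beta> \<epsilon> \<eta> (Suc m)
    (if \<rho> b > \<beta> then (\<lambda>x. T x + (inner x (h b) / inner (h b) (h b)) *\<^sub>R h b) else T)"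
proof -
  have so: "symop n T" and pr: "projector T"
    and g3: "\<And>u z. T u = u \<Longrightarrow> T z = 0 \<Longrightarrow> \<bar>inner (B u) z\<bar> \<le> real m * \<eta> * norm u * norm z"
    and g2: "\<And>u. T u = u \<Longrightarrow> (\<beta> - (real m)\<^sup>2 * \<eta>) * (norm u)\<^sup>2 \<le> inner (B u) u"
    and ex: "\<exists>gs. trace_on n T = real (length gs) \<and> (\<forall>x. T x = (\<Sum>g\<leftarrow>gs. (inner x g / inner g g) *\<^sub>R g)) \<and>
      (\<forall>g\<in>set gs. T g = g \<and> (\<forall>i\<ge>n. co g i = 0)) \<and>
      (length gs = m \<or> (\<forall>z. T z = 0 \<longrightarrow> inner (B z) z \<le> (1 + \<epsilon>) * \<beta> * (norm z)\<^sup>2))"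
    using inv unfolding greedy_inv_def by blast+
  have Bl: "linear B" and Bs: "inner (B x) y = inner x (B y)" and Bp: "0 \<le> inner (B x) x" for x y
    using B by (auto simp: psd_def selfadj_def)
  define P where "P = (\<lambda>x. x - T x)"
  have Pi: "inner (P x) y = inner x (P y)" for x y
    by (simp add: P_def inner_simps projector_inner[OF pr])
  have TP: "T (P x) = 0" for x by (simp add: P_def projector_diff[OF pr] projector_idem[OF pr])
  have P0: "T z = 0 \<Longrightarrow> P z = z" for z by (simp add: P_def)
  have Gd: "G x = P (B (P x))" for x by (simp add: G_def P_def)
  have Pl: "linear P" unfolding P_def
    by (rule linearI) (simp_all add: projector_add[OF pr] projector_scale[OF pr] algebra_simps)
  have GB: "inner (G x) y = inner (B (P x)) (P y)" for x y by (simp add: Gd Pi)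
  have GB0: "inner (G x) y = inner (B x) y" if "T x = 0" "T y = 0" for x y
    using that by (simp add: GB P0)
  have "linear (\<lambda>x. P (B (P x)))"
    using linear_compose[OF linear_compose[OF Pl Bl] Pl] by (simp add: comp_def)
  moreover have "0 \<le> inner (P (B (P x))) x" for x using Pi[of "B (P x)" x] Bp by simp
  ultimately have Gpsd: "psd G" unfolding psd_def selfadj_def Gd[abs_def]
    using Bp Pi Bs by auto
  have Gso: "symop n G" using Gpsd symopD(2)[OF B(2)] symopD(2)[OF so]
    by (auto simp: symop_def psd_def supp_in_def G_def co_simps)
  have Gk: "T ((G ^^ k) x) = 0" for x using k by (cases k) (auto simp: Gd TP)
  have L0: "0 \<le> L" using order_trans[OF Bp[of "bv 0"] L[of "bv 0"]] by (simp add: power2_norm_eq_inner inner_bv_bv)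
  have eta0: "0 \<le> \<eta>" and eps0: "0 \<le> \<epsilon>" using L0 by (auto simp: \<eta>_def \<epsilon>_def)
  have rho0: "0 \<le> \<rho> b" unfolding \<rho>_def using Gpsd by (intro divide_nonneg_nonneg) (auto simp: psd_def)
  have top: "inner (G z) z \<le> (1 + \<epsilon>) * \<rho> b * inner z z" for z
    unfolding \<epsilon>_def
    by (rule power_method_bound[OF Gpsd Gso k _ rho0]) (use max in \<open>simp add: \<rho>_def h_def\<close>)
  show ?thesis
  proof (cases "\<rho> b > \<beta>")
    case False
    have "greedy_inv n B \<beta> \<epsilon> \<eta> (Suc m) T"
    proof (rule greedy_inv_mono[OF inv eta0])
      fix z assume "T z = 0"
      then have "inner (B z) z = inner (G z) z" by (simp add: GB0)
      also have "\<dots> \<le> (1 + \<epsilon>) * \<rho> b * (norm z)\<^sup>2" using top by (simp add: power2_norm_eq_inner)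
      also have "\<dots> \<le> (1 + \<epsilon>) * \<beta> * (norm z)\<^sup>2"
        using False eps0 by (intro mult_right_mono mult_left_mono) auto
      finally show "inner (B z) z \<le> (1 + \<epsilon>) * \<beta> * (norm z)\<^sup>2" .
    qed
    then show ?thesis using False by simp
  next
    case True
    define g where "g = h b"
    have g0: "g \<noteq> 0" using True beta by (auto simp: \<rho>_def g_def)
    then have gg: "(norm g)\<^sup>2 > 0" by simp
    have Tg: "T g = 0" by (simp add: g_def h_def Gk)
    have Gg: "inner (G g) g = \<rho> b * (norm g)\<^sup>2"
      using gg by (simp add: \<rho>_def g_def power2_norm_eq_inner)
    have Bg: "inner (B g) g = \<rho> b * (norm g)\<^sup>2" using GB0[OF Tg Tg] Gg by simp
    have rL: "\<rho> b \<le> L" using L[of g] gg by (simp add: Bg)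
    \<comment> \<open>The residual of \<open>g\<close> as an eigenvector. Since \<rho> b is within
      the factor 1 + \<epsilon> of the top of \<open>G\<close>, expanding the square leaves at most
      \<epsilon> (\<rho> b)^2 |g|^2, and \<open>\<rho> b \<le> L\<close> yields
      \<open>\<eta>\<close>.\<close>
    define y where "y = G g - \<rho> b *\<^sub>R g"
    have y1: "(norm y)\<^sup>2 = inner (G g) (G g) - 2 * \<rho> b * inner (G g) g + (\<rho> b)\<^sup>2 * inner g g"
      unfolding y_def power2_norm_eq_inner inner_diff_left inner_diff_right inner_scaleR_left
        inner_scaleR_right inner_commute[of g "G g"] by (simp only: power2_eq_square algebra_simps)
    have y2: "inner (G g) (G g) \<le> (1 + \<epsilon>) * \<rho> b * inner (G g) g"
      by (rule psd_norm_sq_bound[OF Gpsd top])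
    have y3: "(1 + \<epsilon>) * \<rho> b * inner (G g) g - 2 * \<rho> b * inner (G g) g + (\<rho> b)\<^sup>2 * inner g g
        = \<epsilon> * (\<rho> b)\<^sup>2 * (norm g)\<^sup>2"
      unfolding Gg power2_norm_eq_inner[of g, symmetric] by (simp add: power2_eq_square algebra_simps)
    have y4: "\<epsilon> * (\<rho> b)\<^sup>2 * (norm g)\<^sup>2 \<le> \<epsilon> * L\<^sup>2 * (norm g)\<^sup>2"
      using rL rho0 eps0 by (intro mult_right_mono mult_left_mono power_mono) auto
    have y5: "\<epsilon> * L\<^sup>2 * (norm g)\<^sup>2 = (\<eta> * norm g)\<^sup>2"
      using eps0 by (simp add: \<eta>_def power_mult_distrib)
    have "(norm y)\<^sup>2 \<le> (\<eta> * norm g)\<^sup>2" using y1 y2 y3 y4 y5 by linarith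
    then have yn: "norm y \<le> \<eta> * norm g"
      using eta0 by (intro power2_le_imp_le[of "norm y"]) auto
    \<comment> \<open>Orthogonality to \<open>g\<close> kills the main term \<rho> b g, so only the
      residual couples \<open>g\<close> to the new complement.\<close>
    have coup: "\<bar>inner (B g) z\<bar> \<le> \<eta> * norm g * norm z" if "T z = 0" "inner z g = 0" for z
    proof -
      have "inner (B g) z = inner y z"
        using that GB0[OF Tg that(1)] by (simp add: y_def inner_simps inner_commute[of g z])
      also have "\<bar>\<dots>\<bar> \<le> norm y * norm z" by (rule Cauchy_Schwarz_ineq2)
      also have "\<dots> \<le> \<eta> * norm g * norm z" using yn by (rule mult_right_mono) simp
      finally show ?thesis .
    qed
    define T' where "T' = (\<lambda>x. T x + (inner x g / inner g g) *\<^sub>R g)"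
    have pr': "projector T'" unfolding T'_def by (rule projector_rank_one_add[OF pr Tg g0])
    have gn: "co g i = 0" if "i \<ge> n" for i
      using symopD(2)[OF symop_funpow[OF Gso k]] that by (auto simp: supp_in_def g_def h_def)
    have so': "symop n T'" using pr' symopD(2)[OF so] gn
      by (auto simp: symop_def projector_def supp_in_def T'_def co_simps)
    have z: "T z = 0" "inner z g = 0" if "T' z = 0" for z
    proof -
      have "T (T' z) = T z" by (simp add: T'_def projector_add[OF pr] projector_scale[OF pr] projector_idem[OF pr] Tg)
      moreover have "T 0 = 0" using projector_scale[OF pr, of 0 0] by simp
      ultimately show Tz: "T z = 0" using that by simp
      then have "(inner z g / inner g g) *\<^sub>R g = 0" using that by (simp add: T'_def)
      then show "inner z g = 0" using g0 by simp
    qed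
    have dec: "\<exists>v c. u = v + c *\<^sub>R g \<and> T v = v \<and> inner v g = 0 \<and> (norm u)\<^sup>2 = (norm v)\<^sup>2 + (\<bar>c\<bar> * norm g)\<^sup>2"
      if "T' u = u" for u
    proof -
      define c where "c = inner u g / inner g g"
      have 1: "u = T u + c *\<^sub>R g" using that[symmetric] unfolding T'_def c_def .
      have 2: "inner (T u) g = 0" using projector_inner[OF pr, of u g] Tg by simp
      have "inner (T u + c *\<^sub>R g) (T u + c *\<^sub>R g) = inner (T u) (T u) + c\<^sup>2 * inner g g"
        using 2 by (simp add: inner_add_left inner_add_right inner_commute[of g "T u"] power2_eq_square)
      then have "(norm u)\<^sup>2 = (norm (T u))\<^sup>2 + (\<bar>c\<bar> * norm g)\<^sup>2"
        unfolding power_mult_distrib power2_norm_eq_inner power2_abs 1[symmetric] .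
      then show ?thesis using 1 2 projector_idem[OF pr, of u] by blast
    qed
    have le: "norm v \<le> norm u" "\<bar>c\<bar> * norm g \<le> norm u"
      if "(norm u)\<^sup>2 = (norm v)\<^sup>2 + (\<bar>c\<bar> * norm g)\<^sup>2" for u v :: fvec and c
    proof -
      have "(norm v)\<^sup>2 \<le> (norm u)\<^sup>2" "(\<bar>c\<bar> * norm g)\<^sup>2 \<le> (norm u)\<^sup>2"
        unfolding that by simp_all
      then show "norm v \<le> norm u" "\<bar>c\<bar> * norm g \<le> norm u"
        by (blast intro: power2_le_imp_le norm_ge_zero)+
    qed
    have g3': "\<bar>inner (B u) z\<bar> \<le> real (Suc m) * \<eta> * norm u * norm z" if u: "T' u = u" and z': "T' z = 0" for u z
    proof -
      obtain v c where v: "u = v + c *\<^sub>R g" "T v = v" "inner v g = 0" "(norm u)\<^sup>2 = (norm v)\<^sup>2 + (\<bar>c\<bar> * norm g)\<^sup>2"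
        using dec[OF u] by blast
      have "\<bar>inner (B u) z\<bar> \<le> \<bar>inner (B v) z\<bar> + \<bar>c\<bar> * \<bar>inner (B g) z\<bar>"
        unfolding v(1) by (simp add: linear_add[OF Bl] linear_scale[OF Bl] inner_simps abs_mult[symmetric] abs_triangle_ineq)
      also have "\<dots> \<le> real m * \<eta> * norm v * norm z + \<bar>c\<bar> * (\<eta> * norm g * norm z)"
        using g3[OF v(2) z(1)[OF z']] coup[OF z[OF z']] by (intro add_mono mult_left_mono) auto
      also have "\<dots> = real m * \<eta> * norm v * norm z + 1 * \<eta> * (\<bar>c\<bar> * norm g) * norm z" by simp
      also have "\<dots> \<le> real m * \<eta> * norm u * norm z + 1 * \<eta> * norm u * norm z"
        using le[OF v(4)] eta0 by (intro add_mono mult_right_mono mult_left_mono) auto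
      also have "\<dots> = real (Suc m) * \<eta> * norm u * norm z" by (simp add: algebra_simps)
      finally show ?thesis .
    qed
    have g2': "(\<beta> - (real (Suc m))\<^sup>2 * \<eta>) * (norm u)\<^sup>2 \<le> inner (B u) u" if u: "T' u = u" for u
    proof -
      obtain v c where v: "u = v + c *\<^sub>R g" "T v = v" "inner v g = 0" "(norm u)\<^sup>2 = (norm v)\<^sup>2 + (\<bar>c\<bar> * norm g)\<^sup>2"
        using dec[OF u] by blast
      let ?a = "norm v" and ?b = "\<bar>c\<bar> * norm g"
      have "inner (B u) u = inner (B v) v + 2 * (c * inner (B v) g) + c\<^sup>2 * inner (B g) g"
        unfolding v(1) using Bs[of g v]
        by (simp add: linear_add[OF Bl] linear_scale[OF Bl] inner_simps power2_eq_square algebra_simps inner_commute)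
      moreover have "\<bar>c * inner (B v) g\<bar> \<le> real m * \<eta> * ?a * ?b"
      proof -
        have "\<bar>c * inner (B v) g\<bar> = \<bar>c\<bar> * \<bar>inner (B v) g\<bar>" by (rule abs_mult)
        also have "\<dots> \<le> \<bar>c\<bar> * (real m * \<eta> * norm v * norm g)" by (rule mult_left_mono[OF g3[OF v(2) Tg]]) simp
        finally show ?thesis by (simp add: ac_simps)
      qed
      moreover have "2 * (real m * \<eta> * ?a * ?b) \<le> real m * \<eta> * (?a\<^sup>2 + ?b\<^sup>2)"
      proof -
        have "real m * \<eta> * (2 * ?a * ?b) \<le> real m * \<eta> * (?a\<^sup>2 + ?b\<^sup>2)"
          using eta0 sum_squares_bound[of ?a ?b] by (intro mult_left_mono) auto
        then show ?thesis by (simp add: ac_simps)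
      qed
      moreover have "c\<^sup>2 * inner (B g) g \<ge> \<beta> * ?b\<^sup>2"
      proof -
        have "\<beta> * ?b\<^sup>2 \<le> \<rho> b * ?b\<^sup>2" using True by (intro mult_right_mono) auto
        then show ?thesis by (simp add: Bg power_mult_distrib ac_simps)
      qed
      moreover note g2[OF v(2)]
      moreover have "0 \<le> (real m + 1) * \<eta> * ?a\<^sup>2" "0 \<le> ((real m)\<^sup>2 + real m + 1) * \<eta> * ?b\<^sup>2"
        using eta0 by auto
      \<comment> \<open>The budget (m+1)^2 \<eta> covers the old loss m^2 \<eta> and the loss m
        \<eta> of the cross term, split by 2ab \<le> a^2 + b^2. The last two subtracted terms are
        what is left of it.\<close>
      moreover have "(\<beta> - (real (Suc m))\<^sup>2 * \<eta>) * (?a\<^sup>2 + ?b\<^sup>2) =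
          (\<beta> - (real m)\<^sup>2 * \<eta>) * ?a\<^sup>2 - real m * \<eta> * (?a\<^sup>2 + ?b\<^sup>2) + \<beta> * ?b\<^sup>2
          - (real m + 1) * \<eta> * ?a\<^sup>2 - ((real m)\<^sup>2 + real m + 1) * \<eta> * ?b\<^sup>2"
        by (simp add: algebra_simps power2_eq_square)
      ultimately show ?thesis unfolding v(4) by linarith
    qed
    obtain gs where gs: "trace_on n T = real (length gs)" "\<And>x. T x = (\<Sum>g\<leftarrow>gs. (inner x g / inner g g) *\<^sub>R g)"
      "\<forall>g\<in>set gs. T g = g \<and> (\<forall>i\<ge>n. co g i = 0)"
      "length gs = m \<or> (\<forall>z. T z = 0 \<longrightarrow> inner (B z) z \<le> (1 + \<epsilon>) * \<beta> * (norm z)\<^sup>2)"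
      using ex by auto
    have "trace_on n T' = trace_on n T + (\<Sum>i<n. inner (bv i) g / inner g g * co g i)"
      by (simp add: trace_on_def T'_def co_simps sum.distrib)
    then have tr: "trace_on n T' = trace_on n T + 1" using trace_rank_one[of n g] gn g0 by simp
    have "T' g = g" using g0 by (simp add: T'_def Tg)
    moreover have "T' g' = g'" if "g' \<in> set gs" for g'
    proof -
      have "T g' = g'" using gs(3) that by blast
      then have "inner g' g = 0" using projector_inner[OF pr, of g' g] Tg by simp
      with \<open>T g' = g'\<close> show ?thesis by (simp add: T'_def)
    qed
    ultimately have gfix: "\<forall>g'\<in>set (g # gs). T' g' = g' \<and> (\<forall>i\<ge>n. co g' i = 0)"
      using gs(3) gn by auto
    have "greedy_inv n B \<beta> \<epsilon> \<eta> (Suc m) T'"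
      unfolding greedy_inv_def
    proof (intro conjI allI impI exI[of _ "g # gs"])
      show "length (g # gs) = Suc m \<or> (\<forall>z. T' z = 0 \<longrightarrow> inner (B z) z \<le> (1 + \<epsilon>) * \<beta> * (norm z)\<^sup>2)"
        using gs(4) z by auto
      show "T' x = (\<Sum>g\<leftarrow>g # gs. (inner x g / inner g g) *\<^sub>R g)" for x
        unfolding T'_def gs(2) by simp
    qed (use so' pr' g3' g2' tr gs(1) gfix in auto)
    then show ?thesis using True by (simp add: T'_def g_def)
  qed
qed

text \<open>If all n rounds accepted a vector, the trace is n, so every |e_i - T e_i|^2 vanishes;
  then a vector killed by \<open>T\<close> has no coordinate below \<open>n\<close>, and
  \<open>B\<close> kills it as well.\<close>

lemma greedy_final:
  assumes B: "symop n B" and inv: "greedy_inv n B \<beta> \<epsilon> \<eta> n T" and "0 \<le> \<beta>" "0 \<le> \<epsilon>" and z: "T z = 0"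
  shows "inner (B z) z \<le> (1 + \<epsilon>) * \<beta> * (norm z)\<^sup>2"
proof -
  have so: "symop n T" and pr: "projector T" using inv by (auto simp: greedy_inv_def)
  obtain gs :: "fvec list" where gs: "trace_on n T = real (length gs)"
      "length gs = n \<or> (\<forall>z. T z = 0 \<longrightarrow> inner (B z) z \<le> (1 + \<epsilon>) * \<beta> * (norm z)\<^sup>2)"
    using inv unfolding greedy_inv_def by auto
  from gs(2) show ?thesis
  proof
    assume "length gs = n"
    then have tr: "(\<Sum>i<n. 1 - co (T (bv i)) i) = 0" using gs(1) by (simp add: trace_on_def sum_subtractf)
    have nn: "1 - co (T (bv i)) i = (norm (bv i - T (bv i)))\<^sup>2" for i
    proof -
      have "inner (T (bv i)) (T (bv i)) = co (T (bv i)) i"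
        using projector_inner[OF pr, of "T (bv i)" "bv i"] by (simp add: projector_idem[OF pr] inner_bv)
      then show ?thesis
        by (simp add: power2_norm_eq_inner inner_simps inner_bv inner_bv_bv inner_commute[of "bv i" "T (bv i)"]
          co_simps co_bv)
    qed
    have "bv i = T (bv i)" if "i < n" for i
      using tr that unfolding nn by (subst (asm) sum_nonneg_eq_0_iff) auto
    then have "co z i = 0" if "i < n" for i
      using projector_inner[OF pr, of z "bv i"] that z by (metis inner_bv inner_zero_left)
    then have "B z = 0" using symop_expand[OF B, of z] by simp
    then show ?thesis using assms by simp
  qed (use z in blast)
qed

section \<open>Structured programs with bounded loops\<close>

text \<open>The only loop runs exactly \<open>reg s 0\<close> times and there are no coin flips. So
  the meaning of a program is a total function on stores, and a polynomial time bound can be read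
  off the syntax.\<close>

datatype prog =
    PSkip
  | PN vname nexp
  | PR vname nexp nexp rexp
  | PSeq prog prog
  | PIf bexp prog prog
  | PFor vname prog

primrec compile :: "prog \<Rightarrow> cmd" where
  "compile PSkip = Skip"
| "compile (PN x a) = NAssign x a"
| "compile (PR x a b e) = RAssign x a b e"
| "compile (PSeq p q) = Seq (compile p) (compile q)"
| "compile (PIf b p q) = Cond b (compile p) (compile q)"
| "compile (PFor x p) = Seq (NAssign x (NConst 0))
    (While (NLess (NReg x) (NReg 0)) (Seq (compile p) (NAssign x (NAdd (NReg x) (NConst 1)))))"

primrec den :: "prog \<Rightarrow> store \<Rightarrow> store" where
  "den PSkip s = s"
| "den (PN x a) s = set_reg x (nval a s) s"
| "den (PR x a b e) s = set_arr x (nval a s) (nval b s) (rval e s) s"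
| "den (PSeq p q) s = den q (den p s)"
| "den (PIf b p q) s = (if bval b s then den p s else den q s)"
| "den (PFor x p) s =
    ((\<lambda>s. set_reg x (reg (den p s) x + 1) (den p s)) ^^ reg s 0) (set_reg x 0 s)"

primrec wreg :: "prog \<Rightarrow> vname set" where
  "wreg PSkip = {}"
| "wreg (PN x a) = {x}"
| "wreg (PR x a b e) = {}"
| "wreg (PSeq p q) = wreg p \<union> wreg q"
| "wreg (PIf b p q) = wreg p \<union> wreg q"
| "wreg (PFor x p) = insert x (wreg p)"

primrec warr :: "prog \<Rightarrow> vname set" where
  "warr PSkip = {}"
| "warr (PN x a) = {}"
| "warr (PR x a b e) = {x}"
| "warr (PSeq p q) = warr p \<union> warr q"
| "warr (PIf b p q) = warr p \<union> warr q"
| "warr (PFor x p) = warr p"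

primrec wf_prog :: "prog \<Rightarrow> bool" where
  "wf_prog PSkip = True"
| "wf_prog (PN x a) = True"
| "wf_prog (PR x a b e) = True"
| "wf_prog (PSeq p q) = (wf_prog p \<and> wf_prog q)"
| "wf_prog (PIf b p q) = (wf_prog p \<and> wf_prog q)"
| "wf_prog (PFor x p) = (wf_prog p \<and> x \<notin> wreg p)"

text \<open>Branches are added instead of maximized, so that the bound remains a polynomial in n. A
  loop pays three steps for its start and final test, and three per iteration besides its
  body.\<close>

primrec time :: "prog \<Rightarrow> nat \<Rightarrow> nat" where
  "time PSkip n = 1"
| "time (PN x a) n = 1"
| "time (PR x a b e) n = 1"
| "time (PSeq p q) n = 1 + time p n + time q n"
| "time (PIf b p q) n = 1 + time p n + time q n"
| "time (PFor x p) n = 3 + n * (3 + time p n)"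

lemma reg_set_reg [simp]: "reg (set_reg x v s) y = (if y = x then v else reg s y)"
  by (simp add: set_reg_def)

lemma arr_set_reg [simp]: "arr (set_reg x v s) = arr s"
  by (simp add: set_reg_def)

lemma reg_set_arr [simp]: "reg (set_arr x i j v s) = reg s"
  by (simp add: set_arr_def)

lemma arr_set_arr: "arr (set_arr x i j v s) y = (if y = x then (\<lambda>k l. if k = i \<and> l = j then v else arr s x k l) else arr s y)"
  by (auto simp: set_arr_def fun_eq_iff)

lemma den_frame:
  "x \<notin> wreg p \<Longrightarrow> reg (den p s) x = reg s x"
  "a \<notin> warr p \<Longrightarrow> arr (den p s) a = arr s a"
proof (induction p arbitrary: s)
  case (PFor y p)
  {
    case 1
    have "reg (((\<lambda>s. set_reg y (reg (den p s) y + 1) (den p s)) ^^ k) t) x = reg t x" for k t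
      by (induction k) (use 1 PFor in auto)
    then show ?case using 1 by simp
  next
    case 2
    have "arr (((\<lambda>s. set_reg y (reg (den p s) y + 1) (den p s)) ^^ k) t) a = arr t a" for k t
      by (induction k) (use 2 PFor in auto)
    then show ?case using 2 by simp
  }
qed (auto simp: arr_set_arr)

lemma for_inv:
  assumes x: "x \<noteq> 0" "x \<notin> wreg p" "0 \<notin> wreg p"
    and base: "I 0 (set_reg x 0 s)"
    and step: "\<And>m t. m < reg s 0 \<Longrightarrow> reg t 0 = reg s 0 \<Longrightarrow> reg t x = m \<Longrightarrow> I m t \<Longrightarrow>
      I (Suc m) (set_reg x (Suc m) (den p t))"
  shows "I (reg s 0) (den (PFor x p) s)"
proof -
  let ?f = "\<lambda>s. set_reg x (reg (den p s) x + 1) (den p s)"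
  have "I m ((?f ^^ m) (set_reg x 0 s)) \<and> reg ((?f ^^ m) (set_reg x 0 s)) 0 = reg s 0 \<and>
      reg ((?f ^^ m) (set_reg x 0 s)) x = m" if "m \<le> reg s 0" for m
    using that
  proof (induction m)
    case 0
    then show ?case using base x by simp
  next
    case (Suc m)
    then show ?case using x step[of m "(?f ^^ m) (set_reg x 0 s)"] by (simp add: den_frame)
  qed
  then show ?thesis by simp
qed

section \<open>Correctness of the compilation and running time\<close>

lemma steps_add: "steps (a + b) c = bind_pmf (steps a c) (steps b)"
proof (induction a arbitrary: c)
  case (Suc a)
  then have "steps (a + b) = (\<lambda>c. bind_pmf (steps a c) (steps b))" by blast
  then show ?case by (simp add: bind_assoc_pmf)
qed (simp add: bind_return_pmf)

lemma steps_trans: "steps a c = return_pmf c' \<Longrightarrow> steps (a + b) c = steps b c'"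
  by (simp add: steps_add bind_return_pmf)

lemma steps_Suc_det: "step c = return_pmf c' \<Longrightarrow> steps (Suc t) c = steps t c'"
  by (simp add: bind_return_pmf)

lemma steps_halted: "steps t ([], s) = return_pmf ([], s)"
  by (induction t) (simp_all add: bind_return_pmf)

text \<open>The arbitrary rest \<open>k\<close> of the stack lets runs be composed. The time is only
  bounded, since branches may differ in length.\<close>

definition exec :: "cmd \<Rightarrow> nat \<Rightarrow> store \<Rightarrow> store \<Rightarrow> bool" where
  "exec c N s s' \<longleftrightarrow> (\<exists>t\<le>N. \<forall>k. steps t (c # k, s) = return_pmf (k, s'))"

lemma exec_mono: "exec c N s s' \<Longrightarrow> N \<le> N' \<Longrightarrow> exec c N' s s'"
  unfolding exec_def by (meson order_trans)

lemma exec_one: "(\<And>k. step (c # k, s) = return_pmf (k, s')) \<Longrightarrow> exec c 1 s s'"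
  unfolding exec_def by (intro exI[of _ 1]) (simp add: bind_return_pmf)

lemma exec_Seq:
  assumes "exec c N s s'" "exec d N' s' s''"
  shows "exec (Seq c d) (1 + N + N') s s''"
proof -
  obtain t t' where t: "t \<le> N" "\<And>k. steps t (c # k, s) = return_pmf (k, s')"
    "t' \<le> N'" "\<And>k. steps t' (d # k, s') = return_pmf (k, s'')"
    using assms unfolding exec_def by blast
  have "steps (Suc (t + t')) (Seq c d # k, s) = return_pmf (k, s'')" for k
    by (subst steps_Suc_det[of _ "(c # d # k, s)"])
      (simp_all only: step.simps steps_trans[OF t(2)] t(4))
  moreover have "Suc (t + t') \<le> 1 + N + N'" using t by simp
  ultimately show ?thesis unfolding exec_def by blast
qed

lemma exec_step:
  assumes "\<And>k. step (c # k, s) = return_pmf (d @ k, s)" "d = [d']" "exec d' N s s'"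
  shows "exec c (1 + N) s s'"
proof -
  obtain t where t: "t \<le> N" "\<And>k. steps t (d' # k, s) = return_pmf (k, s')"
    using assms(3) unfolding exec_def by blast
  have "steps (Suc t) (c # k, s) = return_pmf (k, s')" for k
    by (subst steps_Suc_det[OF assms(1)]) (simp add: assms(2) t(2))
  then show ?thesis unfolding exec_def using t by (intro exI[of _ "Suc t"]) simp
qed

lemma exec_While_step:
  assumes "bval b s" "exec c N s s'" "exec (While b c) N' s' s''"
  shows "exec (While b c) (1 + N + N') s s''"
proof -
  obtain t t' where t: "t \<le> N" "\<And>k. steps t (c # k, s) = return_pmf (k, s')"
    "t' \<le> N'" "\<And>k. steps t' (While b c # k, s') = return_pmf (k, s'')"
    using assms unfolding exec_def by blast
  have "steps (Suc (t + t')) (While b c # k, s) = return_pmf (k, s'')" for k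
    by (subst steps_Suc_det[of _ "(c # While b c # k, s)"])
      (simp_all only: step.simps assms(1) if_True steps_trans[OF t(2)] t(4))
  moreover have "Suc (t + t') \<le> 1 + N + N'" using t by simp
  ultimately show ?thesis unfolding exec_def by blast
qed

lemma exec_compile:
  assumes "wf_prog p" "0 \<notin> wreg p"
  shows "exec (compile p) (time p (reg s 0)) s (den p s)"
  using assms
proof (induction p arbitrary: s)
  case (PSeq p q)
  then show ?case using exec_Seq[of "compile p" "time p (reg s 0)" s "den p s" "compile q" "time q (reg s 0)"]
    by (metis UnI1 UnI2 compile.simps(4) den.simps(4) den_frame(1) time.simps(4) wf_prog.simps(4) wreg.simps(4))
next
  case (PIf b p q)
  show ?case
  proof (cases "bval b s")
    case True
    have "exec (compile (PIf b p q)) (1 + time p (reg s 0)) s (den p s)"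
      by (rule exec_step[where d = "[compile p]" and d' = "compile p"]) (use True PIf in auto)
    then show ?thesis using True by (auto elim: exec_mono)
  next
    case False
    have "exec (compile (PIf b p q)) (1 + time q (reg s 0)) s (den q s)"
      by (rule exec_step[where d = "[compile q]" and d' = "compile q"]) (use False PIf in auto)
    then show ?thesis using False by (auto elim: exec_mono)
  qed
next
  case (PFor x p)
  have x: "x \<noteq> 0" "x \<notin> wreg p" "0 \<notin> wreg p" "wf_prog p" using PFor.prems by auto
  let ?f = "\<lambda>s. set_reg x (reg (den p s) x + 1) (den p s)"
  let ?c = "Seq (compile p) (NAssign x (NAdd (NReg x) (NConst 1)))"
  let ?n = "reg s 0"
  have body: "exec ?c (2 + time p (reg t 0)) t (?f t)" for t
    using exec_Seq[OF PFor.IH[OF x(4,3), of t] exec_one[of "NAssign x (NAdd (NReg x) (NConst 1))" "den p t" "?f t"]]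
    by (simp add: numeral_eq_Suc)
  \<comment> \<open>Induction over the number of iterations that remain.\<close>
  have loop: "exec (While (NLess (NReg x) (NReg 0)) ?c) (1 + m * (3 + time p ?n)) t ((?f ^^ m) t)"
    if "reg t 0 = ?n" "reg t x + m = ?n" for m t
    using that
  proof (induction m arbitrary: t)
    case 0
    then show ?case by (auto intro!: exec_mono[OF exec_one])
  next
    case (Suc m)
    have t': "reg (?f t) 0 = ?n" "reg (?f t) x + m = ?n" using Suc.prems x by (auto simp: den_frame)
    have "bval (NLess (NReg x) (NReg 0)) t" using Suc.prems by simp
    from exec_While_step[OF this body Suc.IH[OF t']]
    have "exec (While (NLess (NReg x) (NReg 0)) ?c) (1 + (2 + time p (reg t 0)) + (1 + m * (3 + time p ?n)))
        t ((?f ^^ m) (?f t))" .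
    moreover have "(?f ^^ Suc m) t = (?f ^^ m) (?f t)" by (simp only: funpow_Suc_right comp_apply)
    ultimately show ?case using Suc.prems(1) by (auto elim!: exec_mono simp del: funpow.simps)
  qed
  have a: "exec (NAssign x (NConst 0)) 1 s (set_reg x 0 s)" by (rule exec_one) simp
  have "exec (compile (PFor x p)) (1 + 1 + (1 + ?n * (3 + time p ?n))) s ((?f ^^ ?n) (set_reg x 0 s))"
    unfolding compile.simps by (rule exec_Seq[OF a loop]) (use x in auto)
  then show ?case by (simp add: numeral_eq_Suc)
qed (auto intro!: exec_one[unfolded One_nat_def])

lemma time_poly: "\<exists>q. \<forall>n. time p n = poly q n"
proof (induction p)
  case (PSeq p q)
  then obtain f g where "\<forall>n. time p n = poly f n" "\<forall>n. time q n = poly g n" by blast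
  then show ?case by (intro exI[of _ "1 + f + g"]) simp
next
  case (PIf b p q)
  then obtain f g where "\<forall>n. time p n = poly f n" "\<forall>n. time q n = poly g n" by blast
  then show ?case by (intro exI[of _ "1 + f + g"]) simp
next
  case (PFor x p)
  then obtain f where "\<forall>n. time p n = poly f n" by blast
  then show ?case by (intro exI[of _ "[:3:] + [:0, 1:] * ([:3:] + f)"]) simp
qed (auto intro: exI[of _ 1])

text \<open>A halted configuration is a fixed point of \<open>step\<close>, so the surplus of the
  time budget over the actual time is harmless and the distribution is a point mass.\<close>

lemma run_compile:
  assumes "wf_prog p" "0 \<notin> wreg p" "\<forall>n. time p n = poly q n"
  shows "run (compile p) (poly q n) n A C \<upsilon> = return_pmf ([], den p (input_store n A C \<upsilon>))"
proof -
  let ?s = "input_store n A C \<upsilon>"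
  have "reg ?s 0 = n" by (simp add: input_store_def)
  then obtain t where t: "t \<le> poly q n" "\<And>k. steps t (compile p # k, ?s) = return_pmf (k, den p ?s)"
    using exec_compile[OF assms(1,2), of ?s] assms(3) by (auto simp: exec_def)
  then have "steps (t + (poly q n - t)) ([compile p], ?s) = steps (poly q n - t) ([], den p ?s)"
    by (intro steps_trans) auto
  then show ?thesis using t(1) by (simp add: run_def steps_halted)
qed

section \<open>Programs that fill arrays entry by entry\<close>

primrec nregs :: "nexp \<Rightarrow> vname set" where
  "nregs (NConst k) = {}"
| "nregs (NReg x) = {x}"
| "nregs (NAdd a b) = nregs a \<union> nregs b"
| "nregs (NSub a b) = nregs a \<union> nregs b"

primrec rregs :: "rexp \<Rightarrow> vname set" where
  "rregs (RNat a) = nregs a"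
| "rregs (RElem x a b) = nregs a \<union> nregs b"
| "rregs (RAdd e f) = rregs e \<union> rregs f"
| "rregs (RSub e f) = rregs e \<union> rregs f"
| "rregs (RMul e f) = rregs e \<union> rregs f"
| "rregs (RDiv e f) = rregs e \<union> rregs f"

primrec rarrs :: "rexp \<Rightarrow> vname set" where
  "rarrs (RNat a) = {}"
| "rarrs (RElem x a b) = {x}"
| "rarrs (RAdd e f) = rarrs e \<union> rarrs f"
| "rarrs (RSub e f) = rarrs e \<union> rarrs f"
| "rarrs (RMul e f) = rarrs e \<union> rarrs f"
| "rarrs (RDiv e f) = rarrs e \<union> rarrs f"

lemma nval_cong: "(\<And>x. x \<in> nregs a \<Longrightarrow> reg s x = reg t x) \<Longrightarrow> nval a s = nval a t"
  by (induction a) auto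

lemma rval_cong:
  "(\<And>x. x \<in> rregs e \<Longrightarrow> reg s x = reg t x) \<Longrightarrow> (\<And>x. x \<in> rarrs e \<Longrightarrow> arr s x = arr t x) \<Longrightarrow>
    rval e s = rval e t"
  by (induction e) (auto cong: nval_cong)

lemma rval_indep:
  "a \<notin> rarrs e \<Longrightarrow> (\<And>x. x \<noteq> a \<Longrightarrow> arr s x = arr t x) \<Longrightarrow> (\<And>x. reg s x = reg t x) \<Longrightarrow>
    rval e s = rval e t"
  by (rule rval_cong) metis+

lemma rval_indep_reg:
  assumes "a \<notin> rarrs e" "b \<notin> rarrs e" "\<And>x. x \<noteq> a \<Longrightarrow> x \<noteq> b \<Longrightarrow> arr s x = arr t x"
    and "\<And>x. x \<noteq> r \<Longrightarrow> reg s x = reg t x"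
  shows "rval e (set_reg r l s) = rval e (set_reg r l t)"
proof (rule rval_cong)
  fix x
  show "reg (set_reg r l s) x = reg (set_reg r l t) x" using assms(4) by simp
  assume "x \<in> rarrs e"
  then have "x \<noteq> a" "x \<noteq> b" using assms by auto
  then show "arr (set_reg r l s) x = arr (set_reg r l t) x" using assms(3) by simp
qed

text \<open>The body \<open>p\<close> computes one entry of array \<open>a\<close>, whose indices are in registers 1 and 2.\<close>

definition fill :: "prog \<Rightarrow> prog" where
  "fill p = PFor 1 (PFor 2 p)"

text \<open>Entries are computed one after the other while the store changes. The assumption
  \<open>indep\<close> says that \<open>F\<close> ignores everything the body writes, so each entry
  gets the value determined by the initial store. The invariant \<open>I\<close> describes finished
  rows, \<open>J\<close> in addition a partial row.\<close>

lemma arr_fill: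
  assumes w: "0 \<notin> wreg p" "1 \<notin> wreg p" "2 \<notin> wreg p"
    and body: "\<And>s. arr (den p s) a = (\<lambda>k l. if k = reg s 1 \<and> l = reg s 2 then F s else arr s a k l)"
    and indep: "\<And>s t. (\<And>x. x \<notin> warr p \<Longrightarrow> arr s x = arr t x) \<Longrightarrow> (\<And>x. x \<notin> wreg p \<Longrightarrow> reg s x = reg t x) \<Longrightarrow> F s = F t"
    and ij: "i < reg s 0" "j < reg s 0"
  shows "arr (den (fill p) s) a i j = F (set_reg 2 j (set_reg 1 i s))"
proof -
  let ?n = "reg s 0"
  let ?F = "\<lambda>k l. F (set_reg 2 l (set_reg 1 k s))"
  define I where "I = (\<lambda>m (t :: store). (\<forall>k l. arr t a k l = (if k < m \<and> l < ?n then ?F k l else arr s a k l)) \<and>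
    (\<forall>x. x \<notin> warr p \<longrightarrow> arr t x = arr s x) \<and> (\<forall>x. x \<notin> wreg p \<longrightarrow> x \<noteq> 1 \<longrightarrow> x \<noteq> 2 \<longrightarrow> reg t x = reg s x))"
  have "I ?n (den (PFor 1 (PFor 2 p)) s)"
  proof (rule for_inv)
    show "I 0 (set_reg 1 0 s)" by (auto simp: I_def)
    fix m t
    assume m: "m < ?n" "reg t 0 = ?n" "reg t 1 = m" "I m t"
    define J where "J = (\<lambda>m' (u :: store). (\<forall>k l. arr u a k l = (if k < m \<and> l < ?n \<or> k = m \<and> l < m' then ?F k l else arr s a k l)) \<and>
      (\<forall>x. x \<notin> warr p \<longrightarrow> arr u x = arr s x) \<and> reg u 1 = m \<and> (\<forall>x. x \<notin> wreg p \<longrightarrow> x \<noteq> 1 \<longrightarrow> x \<noteq> 2 \<longrightarrow> reg u x = reg s x))"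
    have "J (reg t 0) (den (PFor 2 p) t)"
    proof (rule for_inv)
      show "J 0 (set_reg 2 0 t)" using m by (auto simp: I_def J_def)
      fix m' u
      assume u: "m' < reg t 0" "reg u 0 = reg t 0" "reg u 2 = m'" "J m' u"
      have eq: "F u = ?F m m'"
        by (rule indep) (use u m in \<open>auto simp: J_def\<close>)
      show "J (Suc m') (set_reg 2 (Suc m') (den p u))"
        unfolding J_def
      proof (intro conjI allI impI)
        fix k l
        show "arr (set_reg 2 (Suc m') (den p u)) a k l =
            (if k < m \<and> l < ?n \<or> k = m \<and> l < Suc m' then ?F k l else arr s a k l)"
          using u eq by (auto simp: body J_def less_Suc_eq)
      qed (use u w in \<open>auto simp: J_def den_frame\<close>)
    qed (use w in auto)
    then show "I (Suc m) (set_reg 1 (Suc m) (den (PFor 2 p) t))"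
      using m unfolding I_def J_def by (auto simp: less_Suc_eq simp del: den.simps)
  qed (use w in auto)
  then show ?thesis using ij by (simp add: I_def fill_def del: den.simps)
qed

definition fill_exp :: "vname \<Rightarrow> rexp \<Rightarrow> prog" where
  "fill_exp a e = fill (PR a (NReg 1) (NReg 2) e)"

lemma fill_exp_simps [simp]:
  "wreg (fill_exp a e) = {1, 2}" "warr (fill_exp a e) = {a}" "wf_prog (fill_exp a e)"
  by (auto simp: fill_exp_def fill_def)

lemma arr_fill_exp:
  assumes "a \<notin> rarrs e" "i < reg s 0" "j < reg s 0"
  shows "arr (den (fill_exp a e) s) a i j = rval e (set_reg 2 j (set_reg 1 i s))"
  unfolding fill_exp_def
  by (rule arr_fill) (use assms in \<open>auto simp: arr_set_arr intro!: rval_indep\<close>)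

definition fill_abs :: "vname \<Rightarrow> rexp \<Rightarrow> prog" where
  "fill_abs a e = fill (PIf (RLess e (RNat (NConst 0)))
    (PR a (NReg 1) (NReg 2) (RSub (RNat (NConst 0)) e)) (PR a (NReg 1) (NReg 2) e))"

lemma fill_abs_simps [simp]:
  "wreg (fill_abs a e) = {1, 2}" "warr (fill_abs a e) = {a}" "wf_prog (fill_abs a e)"
  by (auto simp: fill_abs_def fill_def)

lemma arr_fill_abs:
  assumes "a \<notin> rarrs e" "i < reg s 0" "j < reg s 0"
  shows "arr (den (fill_abs a e) s) a i j = \<bar>rval e (set_reg 2 j (set_reg 1 i s))\<bar>"
  unfolding fill_abs_def
  by (rule arr_fill[where F = "\<lambda>s. \<bar>rval e s\<bar>"])
    (use assms in \<open>auto simp: arr_set_arr fun_eq_iff intro!: arg_cong[where f = abs] rval_indep\<close>)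

text \<open>Array 3 is the accumulator of sums; register 3 is the summation index.\<close>

definition sum_exp :: "rexp \<Rightarrow> prog" where
  "sum_exp e = PSeq (PR 3 (NConst 0) (NConst 0) (RNat (NConst 0)))
    (PFor 3 (PR 3 (NConst 0) (NConst 0) (RAdd (RElem 3 (NConst 0) (NConst 0)) e)))"

lemma arr_sum_exp:
  assumes "3 \<notin> rarrs e"
  shows "arr (den (sum_exp e) s) 3 0 0 = (\<Sum>l<reg s 0. rval e (set_reg 3 l s))"
proof -
  let ?p = "PR 3 (NConst 0) (NConst 0) (RAdd (RElem 3 (NConst 0) (NConst 0)) e)"
  let ?s = "set_arr 3 0 0 0 s"
  define I where "I = (\<lambda>m (t :: store). arr t 3 0 0 = (\<Sum>l<m. rval e (set_reg 3 l s)) \<and>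
    (\<forall>x. x \<noteq> 3 \<longrightarrow> arr t x = arr s x) \<and> (\<forall>x. x \<noteq> 3 \<longrightarrow> reg t x = reg s x))"
  have "I (reg ?s 0) (den (PFor 3 ?p) ?s)"
  proof (rule for_inv)
    show "I 0 (set_reg 3 0 ?s)" by (auto simp: I_def arr_set_arr)
    fix m t
    assume t: "m < reg ?s 0" "reg t 0 = reg ?s 0" "reg t 3 = m" "I m t"
    have "rval e t = rval e (set_reg 3 m s)"
      using t assms unfolding I_def by (intro rval_cong) (auto, metis)
    then show "I (Suc m) (set_reg 3 (Suc m) (den ?p t))"
      using t by (auto simp: I_def arr_set_arr)
  qed auto
  then show ?thesis by (simp add: sum_exp_def I_def)
qed

definition fill_sum :: "vname \<Rightarrow> rexp \<Rightarrow> prog" where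
  "fill_sum a e = fill (PSeq (sum_exp e) (PR a (NReg 1) (NReg 2) (RElem 3 (NConst 0) (NConst 0))))"

lemma sum_exp_simps [simp]:
  "wreg (sum_exp e) = {3}" "warr (sum_exp e) = {3}" "wf_prog (sum_exp e)"
  by (auto simp: sum_exp_def)

lemma fill_sum_simps [simp]:
  "wreg (fill_sum a e) = {1, 2, 3}" "warr (fill_sum a e) = {3, a}" "wf_prog (fill_sum a e)"
  by (auto simp: fill_sum_def fill_def)

lemma arr_fill_sum:
  assumes "a \<notin> rarrs e" "3 \<notin> rarrs e" "a \<noteq> 3" "i < reg s 0" "j < reg s 0"
  shows "arr (den (fill_sum a e) s) a i j = (\<Sum>l<reg s 0. rval e (set_reg 3 l (set_reg 2 j (set_reg 1 i s))))"
  unfolding fill_sum_def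
  by (subst arr_fill[where F = "\<lambda>s. \<Sum>l<reg s 0. rval e (set_reg 3 l s)"])
    (use assms in \<open>auto simp: arr_set_arr fun_eq_iff arr_sum_exp den_frame
      intro!: sum.cong rval_indep_reg[of a e 3 _ _ 3]\<close>)

definition argmax :: "vname \<Rightarrow> vname \<Rightarrow> prog" where
  "argmax b v = PSeq (PN b (NConst 0)) (PFor 1
    (PIf (RLess (RElem v (NReg b) (NConst 0)) (RElem v (NReg 1) (NConst 0))) (PN b (NReg 1)) PSkip))"

lemma argmax_simps [simp]:
  "wreg (argmax b v) = {b, 1}" "warr (argmax b v) = {}" "b \<noteq> 1 \<Longrightarrow> wf_prog (argmax b v)"
  by (auto simp: argmax_def)

lemma argmax:
  assumes "b \<noteq> 0" "b \<noteq> 1" "reg s 0 > 0"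
  shows "reg (den (argmax b v) s) b < reg s 0"
    and "i < reg s 0 \<Longrightarrow> arr s v i 0 \<le> arr s v (reg (den (argmax b v) s) b) 0"
proof -
  let ?p = "PIf (RLess (RElem v (NReg b) (NConst 0)) (RElem v (NReg 1) (NConst 0))) (PN b (NReg 1)) PSkip"
  let ?s = "set_reg b 0 s"
  define I where "I = (\<lambda>m (t :: store). reg t b < reg s 0 \<and> (\<forall>i<m. arr s v i 0 \<le> arr s v (reg t b) 0) \<and> arr t = arr s)"
  have "I (reg ?s 0) (den (PFor 1 ?p) ?s)"
  proof (rule for_inv)
    show "I 0 (set_reg 1 0 ?s)" using assms by (auto simp: I_def)
    fix m t
    assume t: "m < reg ?s 0" "reg t 0 = reg ?s 0" "reg t 1 = m" "I m t"
    then show "I (Suc m) (set_reg 1 (Suc m) (den ?p t))"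
      using assms by (auto simp: I_def less_Suc_eq)
  qed (use assms in auto)
  then show "reg (den (argmax b v) s) b < reg s 0"
    and "i < reg s 0 \<Longrightarrow> arr s v i 0 \<le> arr s v (reg (den (argmax b v) s) b) 0"
    using assms by (auto simp: I_def argmax_def)
qed

section \<open>The program for greedy spectral projections\<close>

definition op :: "nat \<Rightarrow> (nat \<Rightarrow> nat \<Rightarrow> real) \<Rightarrow> fvec \<Rightarrow> fvec" where
  "op n F x = (\<Sum>i<n. (\<Sum>j<n. F i j * co x j) *\<^sub>R bv i)"

lemma co_op: "co (op n F x) i = (if i < n then \<Sum>j<n. F i j * co x j else 0)"
  by (simp add: op_def co_sum co_simps co_bv if_distrib[of "(*) _"] cong: if_cong)

lemma op_cong: "(\<And>i j. i < n \<Longrightarrow> j < n \<Longrightarrow> F i j = G i j) \<Longrightarrow> op n F = op n G"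
  by (rule ext, rule fvec_eqI) (auto simp: co_op intro!: sum.cong)

lemma co_op_bv: "i < n \<Longrightarrow> j < n \<Longrightarrow> co (op n F (bv j)) i = F i j"
  by (simp add: co_op co_bv if_distrib[of "(*) _"] cong: if_cong)

lemma linear_op: "linear (op n F)"
proof (rule linearI; rule fvec_eqI)
  show "co (op n F (x + y)) i = co (op n F x + op n F y) i" for x y i
    by (simp add: co_op co_simps sum.distrib distrib_left)
  show "co (op n F (c *\<^sub>R x)) i = co (c *\<^sub>R op n F x) i" for x c i
    by (simp add: co_op co_simps sum_distrib_left mult.left_commute)
qed

lemma supp_in_op: "supp_in n (op n F)"
  by (simp add: supp_in_def co_op)

lemma inner_op: "inner (op n F x) y = (\<Sum>i<n. \<Sum>j<n. F i j * co x j * co y i)"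
  by (subst inner_lt[of n]) (auto simp: co_op sum_distrib_right)

lemma symop_op:
  assumes "\<And>i j. i < n \<Longrightarrow> j < n \<Longrightarrow> F i j = F j i"
  shows "symop n (op n F)"
proof -
  have "inner (op n F x) y = inner x (op n F y)" for x y
  proof -
    have "inner (op n F x) y = (\<Sum>i<n. \<Sum>j<n. F j i * co x j * co y i)"
      unfolding inner_op by (intro sum.cong refl) (simp add: assms)
    also have "\<dots> = (\<Sum>j<n. \<Sum>i<n. F j i * co y i * co x j)"
      by (subst sum.swap) (simp add: ac_simps)
    also have "\<dots> = inner x (op n F y)" by (simp only: inner_commute[of x] inner_op)
    finally show ?thesis .
  qed
  then show ?thesis by (simp add: symop_def selfadj_def linear_op supp_in_op)
qed

lemma op_mult:
  assumes "\<And>i j. i < n \<Longrightarrow> j < n \<Longrightarrow> H i j = (\<Sum>l<n. F i l * G l j)"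
  shows "op n H = op n F \<circ> op n G"
proof (rule ext, rule fvec_eqI)
  fix x i
  show "co (op n H x) i = co ((op n F \<circ> op n G) x) i"
  proof (cases "i < n")
    case True
    have "co (op n H x) i = (\<Sum>j<n. \<Sum>l<n. F i l * (G l j * co x j))"
      using True by (simp add: co_op assms sum_distrib_right mult.assoc)
    also have "\<dots> = (\<Sum>l<n. \<Sum>j<n. F i l * (G l j * co x j))" by (rule sum.swap)
    also have "\<dots> = co ((op n F \<circ> op n G) x) i" using True by (simp add: co_op sum_distrib_left)
    finally show ?thesis .
  qed (simp add: co_op)
qed

lemma trace_op: "trace_on n (op n F) = (\<Sum>i<n. F i i)"
  by (simp add: trace_on_def co_op_bv)

lemma op_sub: "op n (\<lambda>i j. F i j - G i j) x = op n F x - op n G x"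
  by (rule fvec_eqI) (simp add: co_op co_simps left_diff_distrib sum_subtractf)

abbreviation delta :: "nat \<Rightarrow> nat \<Rightarrow> real" where
  "delta i j \<equiv> if i = j then 1 else 0"

text \<open>On \<open>fvec\<close> the identity matrix acts as truncation to the first
  \<open>n\<close> coordinates, not as the identity map. This is why the truncation appears in all
  shifts below.\<close>

lemma co_op_delta: "co (op n delta x) i = (if i < n then co x i else 0)"
  by (simp add: co_op if_distrib[of "\<lambda>u. u * _"] cong: if_cong)

lemma op_op_delta: "op n F (op n delta x) = op n F x"
  by (rule fvec_eqI) (auto simp: co_op[of n F] co_op_delta intro!: sum.cong)

lemma op_delta_op: "op n delta (op n F x) = op n F x"
  by (rule fvec_eqI) (auto simp: co_op_delta co_op)

primrec seqs :: "prog list \<Rightarrow> prog" where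
  "seqs [] = PSkip"
| "seqs (p # ps) = PSeq p (seqs ps)"

abbreviation el :: "vname \<Rightarrow> vname \<Rightarrow> vname \<Rightarrow> rexp" where
  "el x a b \<equiv> RElem x (NReg a) (NReg b)"

abbreviation el0 :: "vname \<Rightarrow> rexp" where
  "el0 x \<equiv> RElem x (NConst 0) (NConst 0)"

text \<open>Truncated subtraction of naturals expresses the Kronecker delta: (i - j) + (j - i) is 0
  exactly for i = j.\<close>

abbreviation delta_exp :: rexp where
  "delta_exp \<equiv> RNat (NSub (NConst 1) (NAdd (NSub (NReg 1) (NReg 2)) (NSub (NReg 2) (NReg 1))))"

abbreviation mat_mult :: "vname \<Rightarrow> vname \<Rightarrow> vname \<Rightarrow> prog" where
  "mat_mult c a b \<equiv> fill_sum c (RMul (el a 1 3) (el b 3 2))"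

lemma op_mat_mult:
  assumes "reg s 0 = n" "c \<noteq> a" "c \<noteq> b" "c \<noteq> 3" "a \<noteq> 3" "b \<noteq> 3"
  shows "op n (arr (den (mat_mult c a b) s) c) = op n (arr s a) \<circ> op n (arr s b)"
  by (rule op_mult) (use assms in \<open>simp add: arr_fill_sum\<close>)

text \<open>The product goes to array 11 first, because filling array 10 directly would destroy
  entries that are still to be read.\<close>

definition square_prog :: prog where
  "square_prog = seqs [mat_mult 11 10 10, fill_exp 10 (el 11 1 2)]"

text \<open>Input: the matrix in array 4 and the threshold in array 5. Output: the projection in array 6.\<close>

definition greedy_body :: prog where
  "greedy_body = seqs [
    fill_exp 7 (RSub delta_exp (el 6 1 2)),
    mat_mult 8 7 4,
    mat_mult 9 8 7,
    fill_exp 10 (el 9 1 2),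
    PFor 5 square_prog,
    mat_mult 12 9 10,
    fill_sum 13 (RMul (el 12 3 1) (el 10 3 1)),
    fill_sum 14 (RMul (el 10 3 1) (el 10 3 1)),
    fill_exp 15 (RDiv (el 13 1 2) (el 14 1 2)),
    argmax 6 15,
    PIf (RLess (el0 5) (RElem 15 (NReg 6) (NConst 0)))
      (seqs [fill_exp 16 (RAdd (el 6 1 2) (RDiv (RMul (el 10 1 6) (el 10 2 6)) (RElem 14 (NReg 6) (NConst 0)))),
        fill_exp 6 (el 16 1 2)])
      PSkip]"

definition greedy_prog :: prog where
  "greedy_prog = PSeq (fill_exp 6 (RNat (NConst 0))) (PFor 4 greedy_body)"

lemma square_prog_simps [simp]:
  "wreg square_prog = {1, 2, 3}" "warr square_prog = {3, 10, 11}" "wf_prog square_prog"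
  by (auto simp: square_prog_def)

lemma greedy_body_simps [simp]:
  "wreg greedy_body = {1, 2, 3, 5, 6}" "warr greedy_body = {3, 6, 7, 8, 9, 10, 11, 12, 13, 14, 15, 16}"
  "wf_prog greedy_body"
  by (auto simp: greedy_body_def)

lemma greedy_prog_simps [simp]:
  "wreg greedy_prog = {1, 2, 3, 4, 5, 6}" "warr greedy_prog = {3, 6, 7, 8, 9, 10, 11, 12, 13, 14, 15, 16}"
  "wf_prog greedy_prog"
  by (auto simp: greedy_prog_def)

text \<open>One squaring per iteration reaches the exponent 2^n after n iterations, which makes the
  error of the power method exponentially small at polynomial cost.\<close>

lemma square_loop:
  assumes n: "reg s 0 = n"
  shows "op n (arr (den (PFor 5 square_prog) s) 10) = op n (arr s 10) ^^ (2 ^ n)"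
proof -
  define I where "I = (\<lambda>m (t :: store). op n (arr t 10) = op n (arr s 10) ^^ (2 ^ m))"
  have "I (reg s 0) (den (PFor 5 square_prog) s)"
  proof (rule for_inv)
    show "I 0 (set_reg 5 0 s)" by (simp add: I_def)
    fix m t
    assume t: "m < reg s 0" "reg t 0 = reg s 0" "reg t 5 = m" "I m t"
    have "op n (arr (den square_prog t) 10) = op n (arr (den (mat_mult 11 10 10) t) 11)"
      by (rule op_cong) (use t n in \<open>simp add: square_prog_def arr_fill_exp den_frame\<close>)
    also have "\<dots> = op n (arr t 10) \<circ> op n (arr t 10)"
      by (rule op_mat_mult) (use t n in auto)
    also have "\<dots> = op n (arr s 10) ^^ (2 ^ Suc m)"
      using t by (simp add: I_def funpow_add mult_2)
    finally show "I (Suc m) (set_reg 5 (Suc m) (den square_prog t))" by (simp add: I_def)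
  qed auto
  then show ?thesis by (simp add: I_def n)
qed

text \<open>Array 7 is the complementary projection P, array 9 the compression P B P, and array 10
  its power with exponent 2^n, whose columns are the vectors \<open>h i\<close>. Arrays 13 and 14
  hold numerators and denominators of their Rayleigh quotients, which array 15 collects. Thus the
  loop body performs \<open>greedy_step\<close> with exponent 2^n.\<close>

lemma greedy_body_correct:
  assumes n: "reg t 0 = n" "n > 0"
    and B: "psd (op n (arr t 4))" "symop n (op n (arr t 4))"
    and L: "\<And>x. inner (op n (arr t 4) x) x \<le> L * (norm x)\<^sup>2"
    and beta: "\<beta> = arr t 5 0 0" "\<beta> > 0"
    and eps: "\<epsilon> = real n / real (2 * 2 ^ n)" "\<eta> = L * sqrt \<epsilon>"
    and inv: "greedy_inv n (op n (arr t 4)) \<beta> \<epsilon> \<eta> m (op n (arr t 6))"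
  shows "greedy_inv n (op n (arr t 4)) \<beta> \<epsilon> \<eta> (Suc m) (op n (arr (den greedy_body t) 6))"
proof -
  let ?B = "op n (arr t 4)" and ?T = "op n (arr t 6)"
  define s1 where "s1 = den (fill_exp 7 (RSub delta_exp (el 6 1 2))) t"
  define s2 where "s2 = den (mat_mult 8 7 4) s1"
  define s3 where "s3 = den (mat_mult 9 8 7) s2"
  define s4 where "s4 = den (fill_exp 10 (el 9 1 2)) s3"
  define s5 where "s5 = den (PFor 5 square_prog) s4"
  define s6 where "s6 = den (mat_mult 12 9 10) s5"
  define s7 where "s7 = den (fill_sum 13 (RMul (el 12 3 1) (el 10 3 1))) s6"
  define s8 where "s8 = den (fill_sum 14 (RMul (el 10 3 1) (el 10 3 1))) s7"
  define s9 where "s9 = den (fill_exp 15 (RDiv (el 13 1 2) (el 14 1 2))) s8"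
  define s10 where "s10 = den (argmax 6 15) s9"
  define b where "b = reg s10 6"
  note frame = den_frame
  have r: "reg s1 0 = n" "reg s2 0 = n" "reg s3 0 = n" "reg s4 0 = n" "reg s5 0 = n" "reg s6 0 = n"
    "reg s7 0 = n" "reg s8 0 = n" "reg s9 0 = n" "reg s10 0 = n"
    using n by (simp_all add: s1_def s2_def s3_def s4_def s5_def s6_def s7_def s8_def s9_def s10_def frame del: den.simps)
  have keep: "arr s1 x = arr t x" "arr s2 x = arr t x" "arr s5 x = arr t x" "arr s10 x = arr t x"
    if "x \<in> {4, 5, 6}" for x
    using that by (auto simp: s1_def s2_def s3_def s4_def s5_def s6_def s7_def s8_def s9_def s10_def frame simp del: den.simps)
  have k2: "arr s2 7 = arr s1 7" by (simp add: s2_def frame)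
  have k59: "arr s5 9 = arr s3 9" by (simp add: s5_def s4_def frame del: den.simps)
  have k6: "arr s6 10 = arr s5 10" "arr s6 9 = arr s5 9" by (simp_all add: s6_def frame)
  have k7: "arr s7 10 = arr s5 10" by (simp add: s7_def k6 frame)
  have k8: "arr s8 10 = arr s5 10" "arr s8 13 = arr s7 13" by (simp_all add: s8_def k7 frame)
  have k10: "arr s10 10 = arr s5 10" "arr s10 14 = arr s8 14" "arr s10 15 = arr s9 15"
    by (simp_all add: s9_def s10_def k8 frame)
  define P where "P = op n (arr s1 7)"
  have P: "P x = op n delta x - ?T x" for x
  proof -
    have "P = op n (\<lambda>i j. delta i j - arr t 6 i j)"
      unfolding P_def by (rule op_cong) (use n in \<open>simp add: s1_def arr_fill_exp\<close>)
    then show ?thesis by (simp add: op_sub)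
  qed
  have 8: "op n (arr s2 8) = P \<circ> ?B"
    unfolding s2_def P_def by (subst op_mat_mult) (use r keep[of 4] in auto)
  have 9: "op n (arr s3 9) = P \<circ> ?B \<circ> P"
    unfolding s3_def by (subst op_mat_mult) (use r 8 k2 in \<open>auto simp: P_def\<close>)
  define G where "G = (\<lambda>x. ?B (x - ?T x) - ?T (?B (x - ?T x)))"
  have G: "op n (arr s3 9) = G"
    unfolding 9 G_def by (rule ext)
      (simp add: P linear_diff[OF linear_op] op_op_delta op_delta_op)
  have "op n (arr s4 10) = G"
    unfolding G[symmetric] by (rule op_cong) (use r in \<open>simp add: s4_def arr_fill_exp\<close>)
  then have H: "op n (arr s5 10) = G ^^ (2 ^ n)"
    unfolding s5_def using square_loop[OF r(4)] by (simp del: den.simps)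
  have GH: "op n (arr s6 12) = G \<circ> G ^^ (2 ^ n)"
    unfolding s6_def by (subst op_mat_mult) (use r H G k59 in auto)
  define h where "h = (\<lambda>i. (G ^^ (2 ^ n)) (bv i))"
  have hc: "co (h i) j = (if j < n then arr s5 10 j i else 0)" if "i < n" for i j
    using that co_op_bv[of j n i "arr s5 10"] by (auto simp: h_def H[symmetric] co_op)
  have Ghc: "co (G (h i)) j = arr s6 12 j i" if "i < n" "j < n" for i j
    using that co_op_bv[of j n i "arr s6 12"] by (simp add: h_def GH)
  have 13: "arr s7 13 i j = inner (G (h i)) (h i)" if "i < n" "j < n" for i j
  proof -
    have "arr s7 13 i j = (\<Sum>l<n. arr s6 12 l i * arr s6 10 l i)"
      using that r by (simp add: s7_def arr_fill_sum)
    also have "\<dots> = (\<Sum>l<n. co (h i) l * co (G (h i)) l)"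
      by (rule sum.cong) (use that in \<open>simp_all add: hc Ghc k6\<close>)
    also have "\<dots> = inner (h i) (G (h i))" by (rule inner_lt[symmetric]) (use that in \<open>simp add: hc\<close>)
    finally show ?thesis by (simp add: inner_commute)
  qed
  have 14: "arr s8 14 i j = inner (h i) (h i)" if "i < n" "j < n" for i j
  proof -
    have "arr s8 14 i j = (\<Sum>l<n. arr s7 10 l i * arr s7 10 l i)"
      using that r by (simp add: s8_def arr_fill_sum)
    also have "\<dots> = (\<Sum>l<n. co (h i) l * co (h i) l)"
      by (rule sum.cong) (use that in \<open>simp_all add: hc k7\<close>)
    also have "\<dots> = inner (h i) (h i)" by (rule inner_lt[symmetric]) (use that in \<open>simp add: hc\<close>)
    finally show ?thesis .
  qed
  define \<rho> where "\<rho> = (\<lambda>i. inner (G (h i)) (h i) / inner (h i) (h i))"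
  have 15: "arr s9 15 i j = \<rho> i" if "i < n" "j < n" for i j
    using that r by (simp add: s9_def arr_fill_exp 13 14 k8 \<rho>_def del: inner_eq_zero_iff)
  have b: "b < n" using argmax(1)[of 6 s9 15] r n by (simp add: b_def s10_def)
  have max: "\<rho> i \<le> \<rho> b" if "i < n" for i
    using argmax(2)[of 6 s9 i 15] r n that b by (simp add: b_def[unfolded s10_def, symmetric] 15)
  have step: "greedy_inv n ?B \<beta> \<epsilon> \<eta> (Suc m)
    (if \<rho> b > \<beta> then (\<lambda>x. ?T x + (inner x (h b) / inner (h b) (h b)) *\<^sub>R h b) else ?T)"
    by (rule greedy_step[OF B L inv b beta(2) _ eps G_def h_def \<rho>_def max]) auto
  have den: "den greedy_body t = den (PIf (RLess (el0 5) (RElem 15 (NReg 6) (NConst 0)))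
      (seqs [fill_exp 16 (RAdd (el 6 1 2) (RDiv (RMul (el 10 1 6) (el 10 2 6)) (RElem 14 (NReg 6) (NConst 0)))),
        fill_exp 6 (el 16 1 2)])
      PSkip) s10"
    unfolding greedy_body_def seqs.simps s1_def s2_def s3_def s4_def s5_def s6_def s7_def s8_def s9_def s10_def
    by (simp only: den.simps)
  have test: "bval (RLess (el0 5) (RElem 15 (NReg 6) (NConst 0))) s10 \<longleftrightarrow> \<rho> b > \<beta>"
    using keep(4)[of 5] b n by (simp add: k10 b_def[symmetric] 15 beta)
  show ?thesis
  proof (cases "\<rho> b > \<beta>")
    case False
    then have "den greedy_body t = s10" using test by (simp add: den)
    then show ?thesis using step False keep(4)[of 6] by simp
  next
    case True
    define s11 where "s11 = den (fill_exp 16 (RAdd (el 6 1 2)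
      (RDiv (RMul (el 10 1 6) (el 10 2 6)) (RElem 14 (NReg 6) (NConst 0))))) s10"
    have "den greedy_body t = den (fill_exp 6 (el 16 1 2)) s11" using test True by (simp add: den s11_def)
    then have "arr (den greedy_body t) 6 i j = arr t 6 i j + co (h b) i * co (h b) j / inner (h b) (h b)"
      if "i < n" "j < n" for i j
      using that r b n keep(4)[of 6]
      by (simp add: arr_fill_exp s11_def frame b_def[symmetric] k10 14 hc[OF b] del: inner_eq_zero_iff)
    then have "op n (arr (den greedy_body t) 6) =
        op n (\<lambda>i j. arr t 6 i j + co (h b) i * co (h b) j / inner (h b) (h b))"
      by (rule op_cong)
    also have "\<dots> = (\<lambda>x. ?T x + (inner x (h b) / inner (h b) (h b)) *\<^sub>R h b)"
    proof (rule ext, rule fvec_eqI)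
      fix x i
      have "inner x (h b) = (\<Sum>j<n. co (h b) j * co x j)"
        by (subst inner_commute, rule inner_lt) (simp add: hc[OF b])
      moreover have "(\<Sum>j<n. (arr t 6 i j + co (h b) i * co (h b) j / N) * co x j) =
          (\<Sum>j<n. arr t 6 i j * co x j) + (\<Sum>j<n. co (h b) j * co x j) / N * co (h b) i" for N
        unfolding sum_distrib_right sum_divide_distrib sum.distrib[symmetric]
        by (rule sum.cong) (auto simp: distrib_right)
      ultimately show "co (op n (\<lambda>i j. arr t 6 i j + co (h b) i * co (h b) j / inner (h b) (h b)) x) i =
          co (?T x + (inner x (h b) / inner (h b) (h b)) *\<^sub>R h b) i"
        using hc[OF b, of i] by (simp only: co_op co_simps) auto
    qed
    finally show ?thesis using step True by simp
  qed
qed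

lemma greedy_prog_correct:
  assumes n: "reg s 0 = n" "n > 0"
    and B: "psd (op n (arr s 4))" "symop n (op n (arr s 4))"
    and L: "\<And>x. inner (op n (arr s 4) x) x \<le> L * (norm x)\<^sup>2"
    and beta: "arr s 5 0 0 > 0"
    and eps: "\<epsilon> = real n / real (2 * 2 ^ n)" "\<eta> = L * sqrt \<epsilon>"
  shows "greedy_inv n (op n (arr s 4)) (arr s 5 0 0) \<epsilon> \<eta> n (op n (arr (den greedy_prog s) 6))"
proof -
  let ?s = "den (fill_exp 6 (RNat (NConst 0))) s"
  define I where "I = (\<lambda>m (t :: store). arr t 4 = arr s 4 \<and> arr t 5 = arr s 5 \<and>
    greedy_inv n (op n (arr s 4)) (arr s 5 0 0) \<epsilon> \<eta> m (op n (arr t 6)))"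
  have r: "reg ?s 0 = n" using n by (simp add: den_frame)
  have "I (reg ?s 0) (den (PFor 4 greedy_body) ?s)"
  proof (rule for_inv)
    have "op n (arr ?s 6) = op n (\<lambda>i j. 0)"
      by (rule op_cong) (use n in \<open>simp add: arr_fill_exp\<close>)
    also have "\<dots> = (\<lambda>x. 0)" by (simp add: op_def fun_eq_iff)
    finally show "I 0 (set_reg 4 0 ?s)"
      using greedy_inv_0[OF linear_op] by (simp add: I_def den_frame)
    fix m t
    assume t: "m < reg ?s 0" "reg t 0 = reg ?s 0" "reg t 4 = m" "I m t"
    then have t4: "arr t 4 = arr s 4" "arr t 5 = arr s 5" by (auto simp: I_def)
    have "greedy_inv n (op n (arr t 4)) (arr t 5 0 0) \<epsilon> \<eta> (Suc m) (op n (arr (den greedy_body t) 6))"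
      by (rule greedy_body_correct[where L = L]) (use t r n B L beta eps in \<open>auto simp: I_def\<close>)
    then show "I (Suc m) (set_reg 4 (Suc m) (den greedy_body t))"
      using t4 by (simp add: I_def den_frame)
  qed auto
  then show ?thesis by (simp add: I_def r greedy_prog_def del: den.simps(6))
qed

section \<open>Symmetric matrices with few negative eigenvalues\<close>

text \<open>The characteristic polynomial has a complex root \<open>a\<close> with eigenvector
  \<open>w\<close>. The sum \<open>S\<close>, the Hermitian form at \<open>w\<close>, equals
  \<open>a\<close> times |w|^2 and is its own conjugate by symmetry, so \<open>a\<close> is real and
  hence a root of the real characteristic polynomial.\<close>

lemma symmetric_real_eigenvector:
  assumes M: "symmetric_mat n M" and n: "n > 0"
  shows "\<exists>e v. v \<in> carrier_vec n \<and> v \<noteq> 0\<^sub>v n \<and> M *\<^sub>v v = e \<cdot>\<^sub>v v"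
proof -
  have Mc: "M \<in> carrier_mat n n" and tr: "transpose_mat M = M" using M by (auto simp: symmetric_mat_def)
  have sym: "M $$ (i, j) = M $$ (j, i)" if "i < n" "j < n" for i j
    using arg_cong[OF tr, of "\<lambda>A. A $$ (i, j)"] that Mc by simp
  define A where "A = map_mat complex_of_real M"
  have A: "A \<in> carrier_mat n n" using Mc by (simp add: A_def)
  obtain as where as: "char_poly A = (\<Prod>a\<leftarrow>as. [:- a, 1:])" "length as = n"
    using char_poly_factorized[OF A] by blast
  then obtain a where a: "poly (char_poly A) a = 0"
    using n by (cases as) auto
  then have "eigenvalue A a" using eigenvalue_root_char_poly[OF A] by simp
  then obtain w where w: "w \<in> carrier_vec n" "w \<noteq> 0\<^sub>v n" "A *\<^sub>v w = a \<cdot>\<^sub>v w"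
    using A by (auto simp: eigenvalue_def eigenvector_def)
  have comp: "(\<Sum>j<n. of_real (M $$ (i, j)) * w $ j) = a * w $ i" if "i < n" for i
    using arg_cong[OF w(3), of "\<lambda>v. v $ i"] that w(1) Mc
    by (simp add: A_def scalar_prod_def row_def lessThan_atLeast0)
  define N where "N = (\<Sum>i<n. (cmod (w $ i))\<^sup>2)"
  define S where "S = (\<Sum>i<n. \<Sum>j<n. of_real (M $$ (i, j)) * (cnj (w $ i) * w $ j))"
  have "S = (\<Sum>i<n. cnj (w $ i) * (\<Sum>j<n. of_real (M $$ (i, j)) * w $ j))"
    by (simp add: S_def sum_distrib_left ac_simps)
  also have "\<dots> = (\<Sum>i<n. a * of_real ((cmod (w $ i))\<^sup>2))"
  proof (intro sum.cong refl)
    fix i assume "i \<in> {..<n}"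
    then show "cnj (w $ i) * (\<Sum>j<n. of_real (M $$ (i, j)) * w $ j) = a * of_real ((cmod (w $ i))\<^sup>2)"
      by (simp only: comp lessThan_iff complex_norm_square) (simp add: ac_simps)
  qed
  also have "\<dots> = a * of_real N" by (simp add: N_def sum_distrib_left)
  finally have S: "S = a * of_real N" .
  have "cnj S = (\<Sum>i<n. \<Sum>j<n. of_real (M $$ (i, j)) * (w $ i * cnj (w $ j)))"
    by (simp add: S_def)
  also have "\<dots> = (\<Sum>j<n. \<Sum>i<n. of_real (M $$ (i, j)) * (w $ i * cnj (w $ j)))" by (rule sum.swap)
  also have "\<dots> = S" unfolding S_def by (intro sum.cong refl) (auto simp: sym ac_simps)
  finally have "cnj S = S" .
  moreover have "N > 0"
  proof -
    obtain i where "i < n" "w $ i \<noteq> 0"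
      using w(1,2) by (metis carrier_vecD eq_vecI index_zero_vec(1) index_zero_vec(2))
    then have "(cmod (w $ i))\<^sup>2 > 0" "(cmod (w $ i))\<^sup>2 \<le> N"
      unfolding N_def by (auto intro!: member_le_sum)
    then show ?thesis by linarith
  qed
  ultimately have "cnj a = a" by (simp add: S)
  then have "a = of_real (Re a)" by (simp add: complex_eq_iff)
  then have "poly (map_poly of_real (char_poly M)) (complex_of_real (Re a)) = 0"
    using a of_real_hom.char_poly_hom[OF Mc, where 'a = complex] by (simp add: A_def)
  then have "poly (char_poly M) (Re a) = 0"
    by simp
  then have "eigenvalue M (Re a)" using eigenvalue_root_char_poly[OF Mc] by simp
  then show ?thesis using Mc by (auto simp: eigenvalue_def eigenvector_def)
qed

text \<open>Gram-Schmidt on a basis that starts with \<open>v\<close> keeps \<open>v\<close> as its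
  first vector. Its result is only orthogonal, so the columns are normalized by
  \<open>d\<close>.\<close>

lemma orthonormal_completion:
  fixes v :: "real Matrix.vec"
  assumes v: "v \<in> carrier_vec n" "v \<noteq> 0\<^sub>v n" and n: "n > 0"
  shows "\<exists>W c. W \<in> carrier_mat n n \<and> transpose_mat W * W = 1\<^sub>m n \<and> W * transpose_mat W = 1\<^sub>m n \<and>
    col W 0 = c \<cdot>\<^sub>v v"
proof -
  interpret cof_vec_space n "TYPE(real)" .
  define bs where "bs = basis_completion v"
  define ws where "ws = gram_schmidt n bs"
  note bc = basis_completion[OF v, folded bs_def]
  have ws: "set ws \<subseteq> carrier_vec n" "corthogonal ws" "length ws = n"
    using gram_schmidt_result[OF bc(2,4,5) refl, folded ws_def] bc(6) by auto
  have "bs \<noteq> []" using bc(6) n by auto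
  then have "hd ws = v" using bc(7) gram_schmidt_hd[OF v(1), of "tl bs"] by (simp add: ws_def) (metis list.collapse)
  then have ws0: "ws ! 0 = v" using ws(3) n by (metis hd_conv_nth length_0_conv less_numeral_extra(3))
  have wc: "ws ! i \<in> carrier_vec n" if "i < n" for i using ws that by auto
  have orth: "ws ! i \<bullet> ws ! j = 0 \<longleftrightarrow> i \<noteq> j" if "i < n" "j < n" for i j
    using corthogonalD[OF ws(2)] that ws(3) by simp
  have pos: "ws ! i \<bullet> ws ! i > 0" if "i < n" for i
    using orth[OF that that] conjugate_square_ge_0_vec[of "ws ! i"] by simp
  define d where "d = (\<lambda>i. 1 / sqrt (ws ! i \<bullet> ws ! i))"
  define W where "W = mat_of_cols n (map (\<lambda>i. d i \<cdot>\<^sub>v ws ! i) [0..<n])"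
  have W: "W \<in> carrier_mat n n" by (simp add: W_def mat_of_cols_def)
  have col: "col W i = d i \<cdot>\<^sub>v ws ! i" if "i < n" for i
    using that wc[OF that] by (simp add: W_def)
  have "transpose_mat W * W = 1\<^sub>m n"
  proof (rule eq_matI)
    fix i j assume ij: "i < dim_row (1\<^sub>m n :: real mat)" "j < dim_col (1\<^sub>m n :: real mat)"
    then have ij: "i < n" "j < n" by auto
    have "(transpose_mat W * W) $$ (i, j) = col W i \<bullet> col W j" using ij W by simp
    also have "\<dots> = d i * d j * (ws ! i \<bullet> ws ! j)"
      using ij wc[OF ij(1)] wc[OF ij(2)] by (simp add: col)
    also have "\<dots> = 1\<^sub>m n $$ (i, j)"
      using orth[OF ij] pos[OF ij(1)] ij by (auto simp: d_def)
    finally show "(transpose_mat W * W) $$ (i, j) = 1\<^sub>m n $$ (i, j)" .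
  qed (use W in auto)
  moreover from this have "W * transpose_mat W = 1\<^sub>m n"
    using mat_mult_left_right_inverse[of "transpose_mat W" n W] W by simp
  moreover have "col W 0 = d 0 \<cdot>\<^sub>v v" using col[OF n] ws0 by simp
  ultimately show ?thesis using W by blast
qed

lemma quadratic_form_Suc:
  fixes B C :: "real mat"
  assumes B: "B \<in> carrier_mat (Suc m) (Suc m)" and z: "z \<in> carrier_vec (Suc m)"
    and B0: "B $$ (0, 0) = e" "\<And>i. i < m \<Longrightarrow> B $$ (0, Suc i) = 0" "\<And>i. i < m \<Longrightarrow> B $$ (Suc i, 0) = 0"
    and C: "C \<in> carrier_mat m m" "\<And>i j. i < m \<Longrightarrow> j < m \<Longrightarrow> C $$ (i, j) = B $$ (Suc i, Suc j)"
  shows "z \<bullet> (B *\<^sub>v z) = e * (z $ 0)\<^sup>2 + vec m (\<lambda>i. z $ Suc i) \<bullet> (C *\<^sub>v vec m (\<lambda>i. z $ Suc i))"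
proof -
  have "z \<bullet> (B *\<^sub>v z) = (\<Sum>i<Suc m. z $ i * (\<Sum>j<Suc m. B $$ (i, j) * z $ j))"
    using B z by (simp add: scalar_prod_def row_def lessThan_atLeast0 del: sum.atLeast0_lessThan_Suc sum.lessThan_Suc)
  also have "\<dots> = z $ 0 * (e * z $ 0) + (\<Sum>i<m. z $ Suc i * (\<Sum>j<m. C $$ (i, j) * z $ Suc j))"
    by (simp add: sum.lessThan_Suc_shift B0 C(2) del: sum.lessThan_Suc)
  also have "\<dots> = e * (z $ 0)\<^sup>2 + vec m (\<lambda>i. z $ Suc i) \<bullet> (C *\<^sub>v vec m (\<lambda>i. z $ Suc i))"
    using C(1) by (simp add: scalar_prod_def row_def lessThan_atLeast0 power2_eq_square)
  finally show ?thesis .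
qed

text \<open>A symmetric deflation by an orthonormal basis that starts with an eigenvector.\<close>

lemma symmetric_psd_complement:
  assumes "symmetric_mat n M"
  shows "\<exists>es vs. char_poly M = (\<Prod>e\<leftarrow>es. [:- e, 1:]) \<and> set vs \<subseteq> carrier_vec n \<and>
    length vs = length (filter (\<lambda>e. e < 0) es) \<and>
    (\<forall>x\<in>carrier_vec n. (\<forall>v\<in>set vs. x \<bullet> v = 0) \<longrightarrow> 0 \<le> x \<bullet> (M *\<^sub>v x))"
  using assms
proof (induction n arbitrary: M)
  case 0
  then have "M \<in> carrier_mat 0 0" by (simp add: symmetric_mat_def)
  then have "degree (char_poly M) = 0 \<and> coeff (char_poly M) 0 = 1"
    using degree_monic_char_poly[of M 0] by auto
  then have "char_poly M = 1" by (metis degree_0_id one_pCons)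
  then show ?case using \<open>M \<in> carrier_mat 0 0\<close>
    by (intro exI[of _ "[]"]) (auto simp: scalar_prod_def)
next
  case (Suc m)
  have M: "M \<in> carrier_mat (Suc m) (Suc m)" and tr: "transpose_mat M = M"
    using Suc.prems by (auto simp: symmetric_mat_def)
  obtain e v where v: "v \<in> carrier_vec (Suc m)" "v \<noteq> 0\<^sub>v (Suc m)" "M *\<^sub>v v = e \<cdot>\<^sub>v v"
    using symmetric_real_eigenvector[OF Suc.prems] by auto
  obtain W c where W: "W \<in> carrier_mat (Suc m) (Suc m)" "transpose_mat W * W = 1\<^sub>m (Suc m)"
    "W * transpose_mat W = 1\<^sub>m (Suc m)" "col W 0 = c \<cdot>\<^sub>v v"
    using orthonormal_completion[OF v(1,2)] by auto
  let ?Wt = "transpose_mat W"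
  have Wt: "?Wt \<in> carrier_mat (Suc m) (Suc m)" using W(1) by simp
  define B where "B = ?Wt * M * W"
  have B: "B \<in> carrier_mat (Suc m) (Suc m)" using W(1) M by (auto simp: B_def)
  have MB: "M = W * B * ?Wt"
  proof -
    have "W * B * ?Wt = W * (?Wt * M * W) * ?Wt" by (simp add: B_def)
    also have "\<dots> = (W * ?Wt) * M * (W * ?Wt)"
      using W(1) Wt M by (simp add: assoc_mult_mat[of _ "Suc m" "Suc m" _ "Suc m" _ "Suc m"])
    also have "\<dots> = M" using M W(3) by simp
    finally show ?thesis by simp
  qed
  have Bt: "transpose_mat B = B"
    using W(1) Wt M tr by (simp add: B_def transpose_mult[of _ "Suc m" "Suc m" _ "Suc m"]
        assoc_mult_mat[of _ "Suc m" "Suc m" _ "Suc m" _ "Suc m"])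
  have Bsym: "B $$ (i, j) = B $$ (j, i)" if "i < Suc m" "j < Suc m" for i j
    using arg_cong[OF Bt, of "\<lambda>A. A $$ (i, j)"] that B by simp
  have MW0: "M *\<^sub>v col W 0 = e \<cdot>\<^sub>v col W 0"
    using v M W(4) by (simp add: mult_mat_vec[of _ "Suc m" "Suc m"] smult_smult_assoc mult.commute)
  \<comment> \<open>Column 0 of \<open>W\<close> is an eigenvector and the columns are orthonormal,
    so the first column of \<open>B\<close> is e times the first unit vector; by symmetry the first
    row follows.\<close>
  have Bcol: "B $$ (i, 0) = (if i = 0 then e else 0)" if "i < Suc m" for i
  proof -
    have "B $$ (i, 0) = (?Wt * (M * W)) $$ (i, 0)"
      using W(1) Wt M by (simp add: B_def assoc_mult_mat[of _ "Suc m" "Suc m" _ "Suc m" _ "Suc m"])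
    also have "\<dots> = col W i \<bullet> (M *\<^sub>v col W 0)"
    proof -
      have "col (M * W) 0 = M *\<^sub>v col W 0" by (rule col_mult2[OF M W(1)]) simp
      then show ?thesis using that W(1) M by (subst index_mult_mat) auto
    qed
    also have "\<dots> = e * (col W i \<bullet> col W 0)" unfolding MW0 using that W(1) by simp
    also have "col W i \<bullet> col W 0 = (?Wt * W) $$ (i, 0)" using that W(1) by simp
    also have "\<dots> = (if i = 0 then 1 else 0)" unfolding W(2) using that by simp
    finally show ?thesis by simp
  qed
  define C where "C = mat m m (\<lambda>(i, j). B $$ (Suc i, Suc j))"
  have C: "C \<in> carrier_mat m m" by (simp add: C_def)
  have "symmetric_mat m C"
    unfolding symmetric_mat_def using C by (auto simp: C_def Bsym intro!: eq_matI)
  from Suc.IH[OF this] obtain es us where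
    es: "char_poly C = (\<Prod>e\<leftarrow>es. [:- e, 1:])" and us: "set us \<subseteq> carrier_vec m"
    "length us = length (filter (\<lambda>e. e < 0) es)"
    "\<And>x. x \<in> carrier_vec m \<Longrightarrow> (\<forall>v\<in>set us. x \<bullet> v = 0) \<Longrightarrow> 0 \<le> x \<bullet> (C *\<^sub>v x)" by blast
  have Bblock: "B = four_block_mat (mat 1 1 (\<lambda>_. e)) (0\<^sub>m 1 m) (0\<^sub>m m 1) C"
  proof (rule eq_matI)
    fix i j
    assume "i < dim_row (four_block_mat (mat 1 1 (\<lambda>_. e)) (0\<^sub>m 1 m) (0\<^sub>m m 1) C)"
      "j < dim_col (four_block_mat (mat 1 1 (\<lambda>_. e)) (0\<^sub>m 1 m) (0\<^sub>m m 1) C)"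
    then have ij: "i < Suc m" "j < Suc m" using C by auto
    show "B $$ (i, j) = four_block_mat (mat 1 1 (\<lambda>_. e)) (0\<^sub>m 1 m) (0\<^sub>m m 1) C $$ (i, j)"
      using ij Bcol[of i] Bcol[of j] Bsym[of i j] C by (auto simp: C_def)
  qed (use B C in auto)
  have "similar_mat M B"
    by (rule similar_matI[of _ _ W ?Wt "Suc m"]) (use M B W Wt MB in auto)
  then have "char_poly M = char_poly B" by (rule char_poly_similar)
  also have "\<dots> = char_poly (mat 1 1 (\<lambda>_. e)) * char_poly C"
    unfolding Bblock by (rule char_poly_four_block_zeros_col) (use C in auto)
  also have "char_poly (mat 1 1 (\<lambda>_. e)) = [:- e, 1:]"
    by (simp add: char_poly_defs det_def sign_def)
  finally have cp: "char_poly M = (\<Prod>e\<leftarrow>e # es. [:- e, 1:])" by (simp add: es)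
  \<comment> \<open>The vectors found for the smaller block are padded with a leading 0 and rotated
    back by \<open>W\<close>. The eigenvector itself is added exactly when e < 0, so the number of
    vectors keeps matching the number of negative roots.\<close>
  define lift where "lift = (\<lambda>u :: real Matrix.vec. W *\<^sub>v vec (Suc m) (\<lambda>i. if i = 0 then 0 else u $ (i - 1)))"
  define vs where "vs = (if e < 0 then [col W 0] else []) @ map lift us"
  have W0: "col W 0 \<in> carrier_vec (Suc m)" using W(1) by (metis carrier_matD(1) col_dim)
  then have "set vs \<subseteq> carrier_vec (Suc m)" using W(1) by (auto simp: vs_def lift_def)
  moreover have "length vs = length (filter (\<lambda>e. e < 0) (e # es))" by (simp add: vs_def us)
  moreover have "0 \<le> x \<bullet> (M *\<^sub>v x)" if x: "x \<in> carrier_vec (Suc m)" and orth: "\<forall>v\<in>set vs. x \<bullet> v = 0" for x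
  proof -
    define z where "z = ?Wt *\<^sub>v x"
    have z: "z \<in> carrier_vec (Suc m)" using W(1) x by (simp add: z_def)
    have adj: "x \<bullet> (W *\<^sub>v y) = z \<bullet> y" if "y \<in> carrier_vec (Suc m)" for y
      unfolding z_def by (rule transpose_vec_mult_scalar[OF W(1) that x, symmetric])
    have "M *\<^sub>v x = W *\<^sub>v (B *\<^sub>v z)"
      unfolding z_def using W(1) Wt B x
      by (subst MB) (simp add: assoc_mult_mat_vec[of _ "Suc m" "Suc m" _ "Suc m"])
    then have "x \<bullet> (M *\<^sub>v x) = z \<bullet> (B *\<^sub>v z)" using adj B z by simp
    also have "\<dots> = e * (z $ 0)\<^sup>2 + vec m (\<lambda>i. z $ Suc i) \<bullet> (C *\<^sub>v vec m (\<lambda>i. z $ Suc i))"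
      by (rule quadratic_form_Suc[OF B z]) (use Bcol Bsym[of 0] C in \<open>auto simp: C_def\<close>)
    also have "\<dots> \<ge> 0"
    proof (intro add_nonneg_nonneg)
      show "0 \<le> e * (z $ 0)\<^sup>2"
      proof (cases "e < 0")
        case True
        then have "x \<bullet> col W 0 = 0" using orth by (simp add: vs_def)
        moreover have "z $ 0 = col W 0 \<bullet> x" using W(1) x by (simp add: z_def)
        moreover have "col W 0 \<bullet> x = x \<bullet> col W 0" by (rule comm_scalar_prod[OF W0 x])
        ultimately show ?thesis by simp
      qed simp
      show "0 \<le> vec m (\<lambda>i. z $ Suc i) \<bullet> (C *\<^sub>v vec m (\<lambda>i. z $ Suc i))"
      proof (rule us(3))
        show "\<forall>u\<in>set us. vec m (\<lambda>i. z $ Suc i) \<bullet> u = 0"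
        proof
          fix u assume u: "u \<in> set us"
          then have uc: "u \<in> carrier_vec m" using us(1) by auto
          have "x \<bullet> lift u = 0" using orth u by (simp add: vs_def)
          then have "z \<bullet> vec (Suc m) (\<lambda>i. if i = 0 then 0 else u $ (i - 1)) = 0"
            by (simp add: lift_def adj)
          moreover have "z \<bullet> vec (Suc m) (\<lambda>i. if i = 0 then 0 else u $ (i - 1)) = (\<Sum>i<m. z $ Suc i * u $ i)"
            by (simp add: scalar_prod_def lessThan_atLeast0[symmetric] sum.lessThan_Suc_shift del: sum.lessThan_Suc)
          moreover have "vec m (\<lambda>i. z $ Suc i) \<bullet> u = (\<Sum>i<m. z $ Suc i * u $ i)"
            using uc by (simp add: scalar_prod_def lessThan_atLeast0)
          ultimately show "vec m (\<lambda>i. z $ Suc i) \<bullet> u = 0" by simp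
        qed
      qed simp
    qed
    finally show ?thesis .
  qed
  ultimately show ?case using cp by blast
qed

text \<open>Multiplicities are orders of roots, and for a product of linear factors the order of
  \<open>a\<close> is the number of occurrences of \<open>a\<close> in the list.\<close>

lemma num_neg_eigenvalues_eq:
  assumes M: "M \<in> carrier_mat n n" and cp: "char_poly M = (\<Prod>e\<leftarrow>es. [:- e, 1:])"
  shows "num_neg_eigenvalues M = length (filter (\<lambda>e. e < 0) es)"
proof -
  have ord: "Polynomial.order a (\<Prod>e\<leftarrow>es. [:- e, 1:]) = count_list es a" for a
  proof (induction es)
    case (Cons e es)
    have "(\<Prod>e\<leftarrow>es. [:- e, 1:]) \<noteq> 0" by (auto simp: prod_list_zero_iff)
    then have "Polynomial.order a ([:- e, 1:] * (\<Prod>e\<leftarrow>es. [:- e, 1:])) =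
        Polynomial.order a [:- e, 1:] + Polynomial.order a (\<Prod>e\<leftarrow>es. [:- e, 1:])"
      by (intro order_mult) (metis mult_eq_0_iff one_neq_zero pCons_eq_0_iff)
    moreover have "Polynomial.order a [:- e, 1:] = (if e = a then 1 else 0)"
      by (cases "e = a") (auto simp: order_linear' order_root intro!: order_0I)
    ultimately show ?case using Cons by simp
  qed simp
  have root: "eigenvalue M a \<longleftrightarrow> a \<in> set es" for a
    unfolding eigenvalue_root_char_poly[OF M] cp by (induction es) auto
  have "num_neg_eigenvalues M = (\<Sum>a | a \<in> set es \<and> a < 0. count_list es a)"
    unfolding num_neg_eigenvalues_def root cp ord ..
  also have "\<dots> = (\<Sum>a\<in>set (filter (\<lambda>e. e < 0) es). count_list (filter (\<lambda>e. e < 0) es) a)"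
  proof (rule sum.cong)
    fix a assume "a \<in> set (filter (\<lambda>e. e < 0) es)"
    then have "a < 0" by simp
    then show "count_list es a = count_list (filter (\<lambda>e. e < 0) es) a" by (induction es) auto
  qed auto
  also have "\<dots> = length (filter (\<lambda>e. e < 0) es)" by (rule sum_count_set) auto
  finally show ?thesis .
qed

lemma psd_on_complement:
  assumes "symmetric_mat n M"
  shows "\<exists>vs. set vs \<subseteq> carrier_vec n \<and> length vs = num_neg_eigenvalues M \<and>
    (\<forall>x\<in>carrier_vec n. (\<forall>v\<in>set vs. x \<bullet> v = 0) \<longrightarrow> 0 \<le> x \<bullet> (M *\<^sub>v x))"
proof -
  obtain es vs where *: "char_poly M = (\<Prod>e\<leftarrow>es. [:- e, 1:])" "set vs \<subseteq> carrier_vec n"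
    "length vs = length (filter (\<lambda>e. e < 0) es)"
    "\<forall>x\<in>carrier_vec n. (\<forall>v\<in>set vs. x \<bullet> v = 0) \<longrightarrow> 0 \<le> x \<bullet> (M *\<^sub>v x)"
    using symmetric_psd_complement[OF assms] by blast
  then show ?thesis
    using num_neg_eigenvalues_eq[of M n es] assms by (intro exI[of _ vs]) (auto simp: symmetric_mat_def)
qed

section \<open>From matrices to operators\<close>

definition fv :: "nat \<Rightarrow> real Matrix.vec \<Rightarrow> fvec" where
  "fv n v = (\<Sum>i<n. (v $ i) *\<^sub>R bv i)"

definition vf :: "nat \<Rightarrow> fvec \<Rightarrow> real Matrix.vec" where
  "vf n x = Matrix.vec n (co x)"

lemma co_fv: "co (fv n v) i = (if i < n then v $ i else 0)"
  by (simp add: fv_def co_sum co_simps co_bv if_distrib[of "(*) _"] cong: if_cong)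

lemma vf_carrier [simp]: "vf n x \<in> carrier_vec n"
  by (simp add: vf_def)

lemma fv_vf: "(\<And>i. i \<ge> n \<Longrightarrow> co x i = 0) \<Longrightarrow> fv n (vf n x) = x"
  by (rule fvec_eqI) (auto simp: co_fv vf_def)

lemma vf_fv: "v \<in> carrier_vec n \<Longrightarrow> vf n (fv n v) = v"
  by (rule eq_vecI) (auto simp: co_fv vf_def)

lemma inner_fv: "w \<in> carrier_vec n \<Longrightarrow> inner (fv n v) (fv n w) = v \<bullet> w"
  by (subst inner_lt[of n]) (auto simp: co_fv scalar_prod_def lessThan_atLeast0)

lemma inner_fv_right: "v \<in> carrier_vec n \<Longrightarrow> inner x (fv n v) = vf n x \<bullet> v"
  by (subst inner_commute, subst inner_lt[of n])
    (auto simp: co_fv vf_def scalar_prod_def lessThan_atLeast0 mult.commute)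

lemma op_fv:
  assumes "A \<in> carrier_mat n n" "v \<in> carrier_vec n"
  shows "op n (\<lambda>i j. A $$ (i, j)) (fv n v) = fv n (A *\<^sub>v v)"
  by (rule fvec_eqI) (use assms in \<open>auto simp: co_op co_fv scalar_prod_def lessThan_atLeast0\<close>)

lemma op_restrict: "op n F x = op n F (fv n (vf n x))"
  by (rule fvec_eqI) (auto simp: co_op co_fv vf_def)

lemma psd_on_complement_fvec:
  assumes "symmetric_mat n M"
  shows "\<exists>gs. length gs = num_neg_eigenvalues M \<and>
    (\<forall>x. (\<forall>g\<in>set gs. inner x g = 0) \<longrightarrow> 0 \<le> inner (op n (\<lambda>i j. M $$ (i, j)) x) x)"
proof -
  have M: "M \<in> carrier_mat n n" using assms by (simp add: symmetric_mat_def)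
  obtain vs where vs: "set vs \<subseteq> carrier_vec n" "length vs = num_neg_eigenvalues M"
    "\<And>x. x \<in> carrier_vec n \<Longrightarrow> (\<forall>v\<in>set vs. x \<bullet> v = 0) \<Longrightarrow> 0 \<le> x \<bullet> (M *\<^sub>v x)"
    using psd_on_complement[OF assms] by blast
  show ?thesis
  proof (intro exI[of _ "map (fv n) vs"] conjI allI impI)
    fix x assume orth: "\<forall>g\<in>set (map (fv n) vs). inner x g = 0"
    let ?v = "vf n x"
    have "0 \<le> ?v \<bullet> (M *\<^sub>v ?v)"
      by (rule vs(3)) (use orth vs(1) in \<open>auto simp: inner_fv_right[symmetric] subset_iff\<close>)
    also have "\<dots> = inner x (fv n (M *\<^sub>v ?v))" using M by (simp add: inner_fv_right)
    also have "\<dots> = inner (op n (\<lambda>i j. M $$ (i, j)) x) x"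
      using M by (subst op_restrict) (simp add: op_fv inner_commute)
    finally show "0 \<le> inner (op n (\<lambda>i j. M $$ (i, j)) x) x" .
  qed (simp add: vs)
qed

text \<open>Translates an analyzed operator into the notions of the theorem. The output space is the
  column space of \<open>A\<close>, which is the range of \<open>T\<close>; the vectors of
  \<open>gs\<close> lie in it and generate it, so their number bounds the dimension.\<close>

lemma subspace_of_projector:
  assumes F: "op n F = T" and T: "projector T"
    and gs: "\<And>x. T x = (\<Sum>g\<leftarrow>gs. (inner x g / inner g g) *\<^sub>R g)"
    and gs2: "\<And>g. g \<in> set gs \<Longrightarrow> T g = g" "\<And>g i. g \<in> set gs \<Longrightarrow> i \<ge> n \<Longrightarrow> co g i = 0"
  defines "A \<equiv> mat n n (\<lambda>(i, j). F i j)"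
  defines "U \<equiv> span_vecs n (set (cols A))"
  shows "orth_projection n U A" and "subspace_dim n U \<le> length gs"
    and "y \<in> carrier_vec n \<Longrightarrow> y \<bullet> (A *\<^sub>v y) = (norm (T (fv n y)))\<^sup>2"
proof -
  interpret vec_space "TYPE(real)" n .
  have A: "A \<in> carrier_mat n n" by (simp add: A_def)
  have opA: "op n (\<lambda>i j. A $$ (i, j)) = T"
    unfolding F[symmetric] by (rule op_cong) (simp add: A_def)
  have fvA: "fv n (A *\<^sub>v v) = T (fv n v)" if "v \<in> carrier_vec n" for v
    using op_fv[OF A that] opA by simp
  have Av: "A *\<^sub>v v = vf n (T (fv n v))" if "v \<in> carrier_vec n" for v
    using fvA[OF that] A that by (metis mult_mat_vec_carrier vf_fv)
  have U: "U = {u \<in> carrier_vec n. \<exists>x\<in>carrier_vec n. A *\<^sub>v x = u}"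
    unfolding U_def span_vecs_def using col_space_eq[OF A] A by (simp add: col_space_def)
  show "orth_projection n U A"
    unfolding orth_projection_def
  proof (intro conjI ballI)
    fix x :: "real Matrix.vec" assume x: "x \<in> carrier_vec n"
    show "A *\<^sub>v x \<in> U" using x A by (auto simp: U)
    fix u assume "u \<in> U"
    then obtain v where v: "v \<in> carrier_vec n" "u = A *\<^sub>v v" by (auto simp: U)
    have "(x - A *\<^sub>v x) \<bullet> u = inner (fv n (x - A *\<^sub>v x)) (fv n u)"
      using v A by (simp add: inner_fv)
    also have "fv n (x - A *\<^sub>v x) = fv n x - T (fv n x)"
      unfolding fvA[OF x, symmetric] by (rule fvec_eqI) (use x A in \<open>auto simp: co_fv co_simps\<close>)
    also have "fv n u = T (fv n v)" using v fvA by simp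
    also have "inner (fv n x - T (fv n x)) (T (fv n v)) = inner (T (fv n x - T (fv n x))) (fv n v)"
      by (rule projector_inner[OF T, symmetric])
    also have "\<dots> = 0" by (simp add: projector_diff[OF T] projector_idem[OF T])
    finally show "(x - A *\<^sub>v x) \<bullet> u = 0" .
  qed (rule A)
  let ?G = "set (map (vf n) gs)"
  have G: "?G \<subseteq> carrier_vec n" by auto
  have "span ?G = U"
  proof
    show "span ?G \<subseteq> U"
    proof -
      have "?G \<subseteq> U"
      proof
        fix u assume "u \<in> ?G"
        then obtain g where g: "g \<in> set gs" "u = vf n g" by auto
        then have "A *\<^sub>v vf n g = vf n g" using Av[of "vf n g"] gs2 by (simp add: fv_vf)
        then show "u \<in> U" using g by (auto simp: U)
      qed
      moreover have "set (cols A) \<subseteq> carrier_vec n" using A cols_dim by blast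
      ultimately show ?thesis unfolding U_def span_vecs_def
        by (intro span_is_subset span_is_submodule) auto
    qed
    show "U \<subseteq> span ?G"
    proof
      fix u assume "u \<in> U"
      then obtain v where v: "v \<in> carrier_vec n" "u = A *\<^sub>v v" by (auto simp: U)
      let ?c = "\<lambda>k. inner (fv n v) (gs ! k) / inner (gs ! k) (gs ! k)"
      have "u = mat_of_cols n (map (vf n) gs) *\<^sub>v Matrix.vec (length gs) ?c"
      proof (rule eq_vecI)
        fix i assume "i < dim_vec (mat_of_cols n (map (vf n) gs) *\<^sub>v Matrix.vec (length gs) ?c)"
        then have i: "i < n" by simp
        have "u $ i = co (T (fv n v)) i" using Av[OF v(1)] v i by (simp add: vf_def)
        also have "\<dots> = (\<Sum>k<length gs. ?c k * co (gs ! k) i)"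
          by (simp add: gs sum_list_sum_nth co_sum co_simps lessThan_atLeast0)
        also have "\<dots> = (mat_of_cols n (map (vf n) gs) *\<^sub>v Matrix.vec (length gs) ?c) $ i"
          using i by (simp add: scalar_prod_def mat_of_cols_def vf_def lessThan_atLeast0 mult.commute
              del: inner_eq_zero_iff)
        finally show "u $ i = (mat_of_cols n (map (vf n) gs) *\<^sub>v Matrix.vec (length gs) ?c) $ i" .
      qed (use v A in simp)
      also have "\<dots> = lincomb_list ?c (map (vf n) gs)"
        using lincomb_list_as_mat_mult[of "map (vf n) gs" ?c] by (simp add: vf_def)
      finally have "u \<in> span_list (map (vf n) gs)" unfolding span_list_def by blast
      then show "u \<in> span ?G" using span_list_as_span[OF G] by simp
    qed
  qed
  have vsG: "vectorspace class_ring (vs (span ?G))"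
    using span_is_subspace[OF G[unfolded carrier_vec_def[symmetric]]] subspace_is_vs by auto
  have "?G \<subseteq> span ?G" using in_own_span[of ?G] G by auto
  moreover have "LinearCombinations.module.span class_ring (vs (span ?G)) ?G = carrier (vs (span ?G))"
    using span_li_not_depend(1)[OF \<open>?G \<subseteq> span ?G\<close> span_is_submodule] G by auto
  ultimately have "vectorspace.dim class_ring (vs (span ?G)) \<le> card ?G"
    using vectorspace.gen_ge_dim[OF vsG, of ?G] by simp
  also have "\<dots> \<le> length gs" by (metis card_length length_map)
  finally show "subspace_dim n U \<le> length gs"
    unfolding \<open>span ?G = U\<close> subspace_dim_def .
  show "y \<bullet> (A *\<^sub>v y) = (norm (T (fv n y)))\<^sup>2" if y: "y \<in> carrier_vec n"
  proof -
    have "y \<bullet> (A *\<^sub>v y) = inner (fv n y) (fv n (A *\<^sub>v y))" using y A by (simp add: inner_fv)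
    also have "\<dots> = inner (T (fv n y)) (T (fv n y))"
      unfolding fvA[OF y] using projector_inner[OF T, of "fv n y" "T (fv n y)"]
      by (simp only: projector_idem[OF T] inner_commute)
    finally show ?thesis by (simp add: power2_norm_eq_inner)
  qed
qed

section \<open>Quadratic forms and projections\<close>

text \<open>Schur's test: 2 |x_i x_j| \<le> x_i^2 + x_j^2 in every entry, and symmetry merges the
  two resulting sums into one over rows. This is how l1 norms of rows control quadratic
  forms.\<close>

lemma quad_bound:
  assumes sym: "\<And>i j. i < n \<Longrightarrow> j < n \<Longrightarrow> F i j = F j i"
  shows "\<bar>inner (op n F x) x\<bar> \<le> (\<Sum>i<n. (\<Sum>j<n. \<bar>F i j\<bar>) * (co x i)\<^sup>2)"
proof -
  have "\<bar>inner (op n F x) x\<bar> \<le> (\<Sum>i<n. \<Sum>j<n. \<bar>F i j * co x j * co x i\<bar>)"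
    unfolding inner_op by (rule order_trans[OF sum_abs sum_mono]) (rule sum_abs)
  also have "\<dots> \<le> (\<Sum>i<n. \<Sum>j<n. \<bar>F i j\<bar> * ((co x i)\<^sup>2 / 2) + \<bar>F i j\<bar> * ((co x j)\<^sup>2 / 2))"
  proof (intro sum_mono)
    fix i j
    have "\<bar>F i j * co x j * co x i\<bar> = \<bar>F i j\<bar> * (\<bar>co x i\<bar> * \<bar>co x j\<bar>)" by (simp add: abs_mult)
    also have "\<dots> \<le> \<bar>F i j\<bar> * ((co x i)\<^sup>2 / 2 + (co x j)\<^sup>2 / 2)"
      using sum_squares_bound[of "\<bar>co x i\<bar>" "\<bar>co x j\<bar>"] by (intro mult_left_mono) auto
    finally show "\<bar>F i j * co x j * co x i\<bar> \<le> \<bar>F i j\<bar> * ((co x i)\<^sup>2 / 2) + \<bar>F i j\<bar> * ((co x j)\<^sup>2 / 2)"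
      by (simp add: distrib_left)
  qed
  also have "\<dots> = (\<Sum>i<n. \<Sum>j<n. \<bar>F i j\<bar> * ((co x i)\<^sup>2 / 2)) + (\<Sum>j<n. \<Sum>i<n. \<bar>F i j\<bar> * ((co x j)\<^sup>2 / 2))"
    by (simp only: sum.distrib) (subst (3) sum.swap, rule refl)
  also have "(\<Sum>j<n. \<Sum>i<n. \<bar>F i j\<bar> * ((co x j)\<^sup>2 / 2)) = (\<Sum>i<n. \<Sum>j<n. \<bar>F i j\<bar> * ((co x i)\<^sup>2 / 2))"
    by (intro sum.cong refl) (simp add: sym)
  finally show ?thesis by (simp add: sum_distrib_right sum_divide_distrib[symmetric])
qed

definition dia :: "nat \<Rightarrow> (nat \<Rightarrow> real) \<Rightarrow> fvec \<Rightarrow> fvec" where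
  "dia n w = op n (\<lambda>i j. if i = j then w i else 0)"

lemma co_dia: "co (dia n w x) i = (if i < n then w i * co x i else 0)"
  by (simp add: dia_def co_op if_distrib[of "\<lambda>u. u * _"] cong: if_cong)

lemma symop_dia: "symop n (dia n w)"
  unfolding dia_def by (rule symop_op) auto

lemma inner_dia: "inner (dia n w x) y = inner x (dia n w y)"
  by (rule selfadj_inner[OF symopD(1)[OF symop_dia]])

lemma op_weighted: "op n (\<lambda>i j. w i * F i j * w j) x = dia n w (op n F (dia n w x))"
  by (rule fvec_eqI) (auto simp: co_op co_dia sum_distrib_left mult.assoc intro!: sum.cong)

lemma inner_op_weighted: "inner (op n (\<lambda>i j. w i * F i j * w j) x) y = inner (op n F (dia n w x)) (dia n w y)"
  by (simp add: op_weighted inner_dia)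

lemma norm_dia_le:
  assumes "\<And>i. i < n \<Longrightarrow> \<bar>w i\<bar> \<le> 1"
  shows "(norm (dia n w x))\<^sup>2 \<le> (norm x)\<^sup>2"
proof -
  have "(norm (dia n w x))\<^sup>2 = (\<Sum>i<n. (w i * co x i)\<^sup>2)"
    unfolding power2_norm_eq_inner by (subst inner_lt[of n]) (auto simp: co_dia power2_eq_square)
  also have "\<dots> \<le> (\<Sum>i<n. (co x i)\<^sup>2)"
  proof (intro sum_mono)
    fix i assume "i \<in> {..<n}"
    then have "(w i)\<^sup>2 \<le> 1" using assms[of i] by (simp add: abs_square_le_1)
    then show "(w i * co x i)\<^sup>2 \<le> (co x i)\<^sup>2"
      unfolding power_mult_distrib by (intro mult_left_le_one_le) auto
  qed
  also have "\<dots> \<le> (norm x)\<^sup>2" unfolding power2_norm_eq_inner by (rule sum_co_sq_le)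
  finally show ?thesis .
qed

lemma dia_dia: "dia n v (dia n w x) = dia n (\<lambda>i. v i * w i) x"
  by (rule fvec_eqI) (simp add: co_dia)

lemma symop_delta: "symop n T \<Longrightarrow> T (op n delta z) = T z"
  by (simp add: symop_expand[of n T "op n delta z"] symop_expand[of n T z] co_op_delta)

lemma op_scaled_delta: "op n (\<lambda>i j. k * delta i j - F i j) x = k *\<^sub>R op n delta x - op n F x"
  by (rule fvec_eqI)
    (simp add: co_op co_simps co_op_delta left_diff_distrib sum_subtractf if_distrib[of "\<lambda>u. u * _"]
      if_distrib[of "(*) _"] cong: if_cong)

lemma norm_delta_le: "(norm (op n delta x))\<^sup>2 \<le> (norm x)\<^sup>2"
  using norm_dia_le[of n "\<lambda>_. 1" x] by (simp add: dia_def)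

text \<open>Shifting by \<kappa> turns the part of the spectrum of \<open>F\<close> below -\<theta>
  into the part of \<kappa> - F above \<kappa> + \<theta>, which is what the greedy procedure finds.
  All errors are collected in \<open>\<sigma>\<close>.\<close>

lemma greedy_spectral:
  assumes sym: "\<And>i j. i < n \<Longrightarrow> j < n \<Longrightarrow> F i j = F j i"
    and inv: "greedy_inv n (op n (\<lambda>i j. \<kappa> * delta i j - F i j)) (\<kappa> + \<theta>) \<epsilon> \<eta> n T"
    and pos: "0 \<le> \<kappa> + \<theta>" "0 \<le> \<epsilon>"
    and small: "\<epsilon> * (\<kappa> + \<theta>) \<le> \<sigma>" "(real n)\<^sup>2 * \<eta> \<le> \<sigma>" "real n * \<eta> \<le> \<sigma>"
    and theta: "0 \<le> \<theta>" "0 \<le> \<sigma>"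
  shows "T u = u \<Longrightarrow> inner (op n F u) u \<le> - (\<theta> - \<sigma>) * (norm u)\<^sup>2"
    and "T z = 0 \<Longrightarrow> inner (op n F z) z \<ge> - (\<theta> + \<sigma>) * (norm z)\<^sup>2"
    and "T u = u \<Longrightarrow> T z = 0 \<Longrightarrow> \<bar>inner (op n F u) z\<bar> \<le> \<sigma> * norm u * norm z"
proof -
  let ?B = "op n (\<lambda>i j. \<kappa> * delta i j - F i j)" and ?R = "op n delta"
  have so: "symop n T" and pr: "projector T"
    and g3: "\<And>u z. T u = u \<Longrightarrow> T z = 0 \<Longrightarrow> \<bar>inner (?B u) z\<bar> \<le> real n * \<eta> * norm u * norm z"
    and g2: "\<And>u. T u = u \<Longrightarrow> (\<kappa> + \<theta> - (real n)\<^sup>2 * \<eta>) * (norm u)\<^sup>2 \<le> inner (?B u) u"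
    using inv unfolding greedy_inv_def by blast+
  have B: "?B x = \<kappa> *\<^sub>R ?R x - op n F x" for x by (rule op_scaled_delta)
  have symB: "symop n ?B" by (rule symop_op) (simp add: sym)
  have Ru: "?R u = u" if "T u = u" for u
    using symopD(2)[OF so] that by (intro fvec_eqI) (metis co_op_delta leI supp_in_def)
  show "inner (op n F u) u \<le> - (\<theta> - \<sigma>) * (norm u)\<^sup>2" if u: "T u = u"
  proof -
    have "inner (?B u) u = \<kappa> * (norm u)\<^sup>2 - inner (op n F u) u"
      by (simp add: B Ru[OF u] inner_simps power2_norm_eq_inner)
    then have "inner (op n F u) u \<le> - (\<theta> - (real n)\<^sup>2 * \<eta>) * (norm u)\<^sup>2"
      using g2[OF u] by (simp add: algebra_simps)
    also have "\<dots> \<le> - (\<theta> - \<sigma>) * (norm u)\<^sup>2" using small by (intro mult_right_mono) auto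
    finally show ?thesis .
  qed
  show "inner (op n F z) z \<ge> - (\<theta> + \<sigma>) * (norm z)\<^sup>2" if z: "T z = 0"
  proof -
    \<comment> \<open>Coordinates from \<open>n\<close> on are invisible to \<open>F\<close> and
      \<open>T\<close>; after truncation the shift by \<kappa> is a true multiple of the
      identity.\<close>
    let ?z = "?R z"
    have "T ?z = 0" using z symop_delta[OF so] by simp
    then have "inner (?B ?z) ?z \<le> (1 + \<epsilon>) * (\<kappa> + \<theta>) * (norm ?z)\<^sup>2"
      by (rule greedy_final[OF symB inv pos])
    moreover have RR: "?R ?z = ?z" by (rule op_delta_op)
    moreover have "inner (?B ?z) ?z = \<kappa> * (norm ?z)\<^sup>2 - inner (op n F ?z) ?z"
      unfolding B RR by (simp add: inner_simps power2_norm_eq_inner)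
    moreover have "inner (op n F ?z) ?z = inner (op n F z) z"
    proof -
      have "inner (op n F ?z) ?z = inner (op n F z) ?z" by (simp add: op_op_delta)
      also have "\<dots> = inner (?R (op n F z)) z"
        by (rule selfadj_inner[symmetric], rule symopD(1), rule symop_op) auto
      finally show ?thesis by (simp add: op_delta_op)
    qed
    ultimately have "inner (op n F z) z \<ge> - (\<theta> + \<epsilon> * (\<kappa> + \<theta>)) * (norm ?z)\<^sup>2"
      by (simp add: algebra_simps)
    moreover have "(\<theta> + \<epsilon> * (\<kappa> + \<theta>)) * (norm ?z)\<^sup>2 \<le> (\<theta> + \<sigma>) * (norm z)\<^sup>2"
      using small theta pos by (intro mult_mono norm_delta_le) auto
    ultimately show ?thesis unfolding mult_minus_left by linarith
  qed
  show "\<bar>inner (op n F u) z\<bar> \<le> \<sigma> * norm u * norm z" if u: "T u = u" and z: "T z = 0"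
  proof -
    have "inner u z = inner (T u) z" using u by simp
    also have "\<dots> = 0" using projector_inner[OF pr, of u z] z by simp
    finally have "inner (?B u) z = - inner (op n F u) z" by (simp add: B Ru[OF u] inner_simps)
    then have "\<bar>inner (op n F u) z\<bar> \<le> real n * \<eta> * norm u * norm z" using g3[OF u z] by simp
    also have "\<dots> \<le> \<sigma> * norm u * norm z" using small by (intro mult_right_mono) auto
    finally show ?thesis .
  qed
qed

text \<open>By the min-max principle this says that at most \<open>R\<close> eigenvalues lie below
  -\<theta>. In this form no eigenvalues are needed, and diagonal rescaling is easy.
  \<open>R\<close> is real so that it can be compared with traces.\<close>

definition few_negative :: "nat \<Rightarrow> (nat \<Rightarrow> nat \<Rightarrow> real) \<Rightarrow> real \<Rightarrow> real \<Rightarrow> bool" where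
  "few_negative n F \<theta> R \<longleftrightarrow> (\<exists>gs :: fvec list. real (length gs) \<le> R \<and>
    (\<forall>x. (\<forall>g\<in>set gs. inner x g = 0) \<longrightarrow> - \<theta> * (norm x)\<^sup>2 \<le> inner (op n F x) x))"

text \<open>Substitute \<open>dia n \<mu> x\<close> for \<open>x\<close>: the excluded vectors are
  pulled back through the diagonal, and the norm can only decrease, which is harmless because the
  lower bound is nonpositive.\<close>

lemma few_negative_scale:
  assumes "few_negative n (\<lambda>i j. w i * F i j * w j) \<theta> R" "0 \<le> \<theta>"
    and mu: "\<And>i. i < n \<Longrightarrow> \<bar>\<mu> i\<bar> \<le> 1" and w': "\<And>i. i < n \<Longrightarrow> w' i = w i * \<mu> i"
  shows "few_negative n (\<lambda>i j. w' i * F i j * w' j) \<theta> R"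
proof -
  obtain gs :: "fvec list" where gs: "real (length gs) \<le> R"
    "\<And>x. (\<forall>g\<in>set gs. inner x g = 0) \<Longrightarrow> - \<theta> * (norm x)\<^sup>2 \<le> inner (op n (\<lambda>i j. w i * F i j * w j) x) x"
    using assms(1) unfolding few_negative_def by blast
  have eq: "dia n w' x = dia n w (dia n \<mu> x)" for x
    by (rule fvec_eqI) (simp add: co_dia w')
  show ?thesis
    unfolding few_negative_def
  proof (intro exI[of _ "map (dia n \<mu>) gs"] conjI allI impI)
    fix x assume x: "\<forall>g\<in>set (map (dia n \<mu>) gs). inner x g = 0"
    have "\<theta> * (norm (dia n \<mu> x))\<^sup>2 \<le> \<theta> * (norm x)\<^sup>2"
      by (rule mult_left_mono[OF norm_dia_le[OF mu] assms(2)])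
    moreover have "- \<theta> * (norm (dia n \<mu> x))\<^sup>2 \<le> inner (op n (\<lambda>i j. w i * F i j * w j) (dia n \<mu> x)) (dia n \<mu> x)"
      by (rule gs(2)) (use x in \<open>simp add: inner_dia\<close>)
    ultimately show "- \<theta> * (norm x)\<^sup>2 \<le> inner (op n (\<lambda>i j. w' i * F i j * w' j) x) x"
      unfolding inner_op_weighted eq by simp
  qed (use gs in simp)
qed

lemma projector_diag:
  assumes "projector T"
  shows "co (T (bv i)) i = (norm (T (bv i)))\<^sup>2"
  using projector_inner[OF assms, of "T (bv i)" "bv i"]
  by (simp add: projector_idem[OF assms] inner_bv power2_norm_eq_inner)

lemma projector_norm_le: "projector T \<Longrightarrow> norm (T x) \<le> norm x"
proof -
  assume T: "projector T"
  have "(norm (T x))\<^sup>2 = inner x (T x)"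
    using projector_inner[OF T, of x "T x"] by (simp add: projector_idem[OF T] power2_norm_eq_inner)
  also have "\<dots> \<le> norm x * norm (T x)" by (rule norm_cauchy_schwarz)
  finally show ?thesis by (cases "norm (T x) = 0") (auto simp: power2_eq_square)
qed

lemma norm_bv: "norm (bv i) = 1"
  by (simp add: norm_eq_sqrt_inner inner_bv_bv)

lemma projector_trace: "projector T \<Longrightarrow> trace_on n T = (\<Sum>i<n. (norm (T (bv i)))\<^sup>2)"
  by (simp add: trace_on_def projector_diag)

text \<open>With more dimensions than conditions, the range contains a nonzero vector that satisfies
  all conditions. There the form would be at least -\<theta> |x|^2 and at most -c |x|^2.\<close>

lemma trace_le_of_few_negative:
  assumes T: "projector T" "symop n T" and few: "few_negative n F \<theta> R"
    and neg: "\<And>u. T u = u \<Longrightarrow> inner (op n F u) u \<le> - c * (norm u)\<^sup>2" and "c > \<theta>"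
  shows "trace_on n T \<le> R"
proof (rule ccontr)
  assume "\<not> trace_on n T \<le> R"
  obtain gs :: "fvec list" where gs: "real (length gs) \<le> R"
    "\<And>x. (\<forall>g\<in>set gs. inner x g = 0) \<Longrightarrow> - \<theta> * (norm x)\<^sup>2 \<le> inner (op n F x) x"
    using few unfolding few_negative_def by blast
  obtain S where S: "projector S" "trace_on n S \<ge> trace_on n T - real (length gs)"
    "\<And>x. T (S x) = S x" "\<And>x g. g \<in> set gs \<Longrightarrow> inner (S x) g = 0"
    using projector_cut[OF T, of gs] by blast
  then have "(\<Sum>i<n. (norm (S (bv i)))\<^sup>2) > 0"
    using \<open>\<not> trace_on n T \<le> R\<close> gs(1) by (simp add: projector_trace[symmetric])
  then obtain i where "norm (S (bv i)) \<noteq> 0"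
    by (metis (mono_tags, lifting) order_less_irrefl power_zero_numeral sum.neutral)
  then have p: "(norm (S (bv i)))\<^sup>2 > 0" by simp
  have "- \<theta> * (norm (S (bv i)))\<^sup>2 \<le> inner (op n F (S (bv i))) (S (bv i))"
    by (rule gs(2)) (use S in auto)
  also have "\<dots> \<le> - c * (norm (S (bv i)))\<^sup>2" by (rule neg) (rule S(3))
  finally show False using p \<open>c > \<theta>\<close> by (simp add: mult_le_cancel_right)
qed

lemma few_negative_of_complement:
  fixes gs :: "fvec list"
  assumes T: "\<And>x. T x = (\<Sum>g\<leftarrow>gs. (inner x g / inner g g) *\<^sub>R g)" and "real (length gs) \<le> R"
    and z: "\<And>z. T z = 0 \<Longrightarrow> inner (op n F z) z \<ge> - \<theta> * (norm z)\<^sup>2"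
  shows "few_negative n F \<theta> R"
  unfolding few_negative_def
proof (intro exI[of _ gs] conjI allI impI)
  fix x assume "\<forall>g\<in>set gs. inner x g = 0"
  then have "(\<Sum>g\<leftarrow>gs. (inner x g / inner g g) *\<^sub>R g) = 0" by (induction gs) auto
  then have "T x = 0" unfolding T .
  then show "- \<theta> * (norm x)\<^sup>2 \<le> inner (op n F x) x" using z by simp
qed (use assms in simp)

lemma supported_quad_bound:
  assumes Dsym: "\<And>i j. i < n \<Longrightarrow> j < n \<Longrightarrow> D i j = D j i"
    and Dsupp: "\<And>i j. i < n \<Longrightarrow> j < n \<Longrightarrow> D i j \<noteq> 0 \<Longrightarrow> i \<in> Q"
    and Drow: "\<And>i. i < n \<Longrightarrow> (\<Sum>j<n. \<bar>D i j\<bar>) \<le> K" and Q: "Q \<subseteq> {..<n}"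
  shows "\<bar>inner (op n D y) y\<bar> \<le> K * (\<Sum>q\<in>Q. (co y q)\<^sup>2)"
proof -
  have D0: "D i j = 0" if "i \<notin> Q" "i < n" "j < n" for i j using Dsupp that by blast
  have "\<bar>inner (op n D y) y\<bar> \<le> (\<Sum>i<n. (\<Sum>j<n. \<bar>D i j\<bar>) * (co y i)\<^sup>2)" by (rule quad_bound[OF Dsym])
  also have "\<dots> = (\<Sum>i\<in>Q. (\<Sum>j<n. \<bar>D i j\<bar>) * (co y i)\<^sup>2)"
    by (rule sum.mono_neutral_right) (use Q in \<open>auto simp: D0 intro!: sum.neutral\<close>)
  also have "\<dots> \<le> (\<Sum>i\<in>Q. K * (co y i)\<^sup>2)"
    by (intro sum_mono mult_right_mono Drow) (use Q in auto)
  finally show ?thesis by (simp add: sum_distrib_left[symmetric])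
qed

text \<open>Since \<open>M\<close> contributes only few negative directions, the trace of the projection is supported on
  \<open>Q\<close> to a constant fraction.\<close>

lemma corrupted_mass:
  assumes T: "projector T" "symop n T"
    and w: "\<And>i. i < n \<Longrightarrow> 0 \<le> w i \<and> w i \<le> 1"
    and neg: "\<And>u. T u = u \<Longrightarrow> inner (op n (\<lambda>i j. w i * (M i j + D i j) * w j) u) u \<le> - c * (norm u)\<^sup>2"
    and c: "c \<ge> 0"
    and M: "\<And>x. (\<forall>g\<in>set vs. inner x g = 0) \<Longrightarrow> 0 \<le> inner (op n M x) x"
    and few: "trace_on n T \<ge> 2 * real (length vs)"
    and Dsym: "\<And>i j. i < n \<Longrightarrow> j < n \<Longrightarrow> D i j = D j i"
    and Dsupp: "\<And>i j. i < n \<Longrightarrow> j < n \<Longrightarrow> D i j \<noteq> 0 \<Longrightarrow> i \<in> Q"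
    and Drow: "\<And>i. i < n \<Longrightarrow> (\<Sum>j<n. \<bar>D i j\<bar>) \<le> K" and Q: "Q \<subseteq> {..<n}"
  shows "c * trace_on n T / 2 \<le> K * (\<Sum>q\<in>Q. w q * co (T (bv q)) q)"
proof -
  \<comment> \<open>At least half of the trace survives, because it is at least twice the number of
    vectors in \<open>vs\<close>. These are pulled back through \<open>dia n w\<close>, so that
    \<open>dia n w u\<close> is orthogonal to \<open>vs\<close> for \<open>u\<close> in the range of
    \<open>S\<close>.\<close>
  obtain S where S: "projector S" "symop n S"
    "trace_on n S \<ge> trace_on n T - real (length (map (dia n w) vs))"
    "\<And>x. T (S x) = S x" "\<And>x g. g \<in> set (map (dia n w) vs) \<Longrightarrow> inner (S x) g = 0"
    using projector_cut[OF T, of "map (dia n w) vs"] by blast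
  have K0: "K \<ge> 0" if "q \<in> Q" for q
    using order_trans[OF sum_nonneg Drow[of q]] Q that by auto
  let ?d = "\<lambda>u. dia n w u"
  have row: "inner (op n D y) y \<ge> - K * (\<Sum>q\<in>Q. (co y q)\<^sup>2)" for y
  proof -
    have "\<bar>inner (op n D y) y\<bar> \<le> K * (\<Sum>q\<in>Q. (co y q)\<^sup>2)"
      by (rule supported_quad_bound[OF Dsym _ Drow Q]) (use Dsupp in blast)+
    then show ?thesis by simp
  qed
  \<comment> \<open>On this subspace \<open>M\<close> contributes nothing negative, so
    \<open>D\<close>, and with it the mass on \<open>Q\<close>, must account for all of c
    |u|^2.\<close>
  have low: "c * (norm u)\<^sup>2 \<le> K * (\<Sum>q\<in>Q. (w q * co u q)\<^sup>2)" if u: "S u = u" for u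
  proof -
    have "T u = u" using S(4)[of u] u by simp
    then have "inner (op n (\<lambda>i j. M i j + D i j) (?d u)) (?d u) \<le> - c * (norm u)\<^sup>2"
      using neg by (simp add: inner_op_weighted)
    moreover have "op n (\<lambda>i j. M i j + D i j) (?d u) = op n M (?d u) + op n D (?d u)"
      by (rule fvec_eqI) (simp add: co_op co_simps distrib_right sum.distrib)
    moreover have "0 \<le> inner (op n M (?d u)) (?d u)"
      by (rule M) (use S(5)[of _ u] u in \<open>auto simp: inner_dia\<close>)
    moreover have "(\<Sum>q\<in>Q. (co (?d u) q)\<^sup>2) = (\<Sum>q\<in>Q. (w q * co u q)\<^sup>2)"
      by (rule sum.cong) (use Q in \<open>auto simp: co_dia\<close>)
    ultimately show ?thesis using row[of "?d u"] by (simp add: inner_add_left)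
  qed
  have "c * trace_on n T / 2 \<le> c * trace_on n S"
    using S(3) few c mult_left_mono[of "trace_on n T / 2" "trace_on n S" c] by simp
  also have "\<dots> = (\<Sum>i<n. c * (norm (S (bv i)))\<^sup>2)"
    by (simp add: projector_trace[OF S(1)] sum_distrib_left)
  also have "\<dots> \<le> (\<Sum>i<n. K * (\<Sum>q\<in>Q. (w q * co (S (bv i)) q)\<^sup>2))"
    by (intro sum_mono low) (rule projector_idem[OF S(1)])
  also have "\<dots> = K * (\<Sum>q\<in>Q. (w q)\<^sup>2 * (\<Sum>i<n. (co (S (bv i)) q)\<^sup>2))"
    by (simp only: sum_distrib_left[symmetric] power_mult_distrib)
      (subst sum.swap, simp only: sum_distrib_left)
  also have "\<dots> \<le> K * (\<Sum>q\<in>Q. w q * co (T (bv q)) q)"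
  proof (cases "Q = {}")
    case False
    then have K: "K \<ge> 0" using K0 by blast
    show ?thesis
    proof (intro mult_left_mono[OF _ K] sum_mono)
      fix q assume "q \<in> Q"
      then have q: "q < n" using Q by auto
      have "co (S (bv i)) q = co (S (bv q)) i" for i
        using projector_inner[OF S(1), of "bv i" "bv q"] by (metis inner_bv inner_commute)
      then have "(\<Sum>i<n. (co (S (bv i)) q)\<^sup>2) = (\<Sum>i<n. (co (S (bv q)) i)\<^sup>2)" by simp
      also have "\<dots> \<le> (norm (S (bv q)))\<^sup>2" unfolding power2_norm_eq_inner by (rule sum_co_sq_le)
      also have "\<dots> \<le> (norm (T (bv q)))\<^sup>2"
      proof -
        \<comment> \<open>The range of \<open>S\<close> lies in that of \<open>T\<close>, so S = S T
          by taking adjoints, and the diagonal of \<open>S\<close> is at most that of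
          \<open>T\<close>.\<close>
        have "inner (S (bv q)) x = inner (S (T (bv q))) x" for x
          using projector_inner[OF S(1)] projector_inner[OF T(1)] S(4) by simp
        then have "S (bv q) = S (T (bv q))" by (metis vector_eq_rdot)
        then have "norm (S (bv q)) \<le> norm (T (bv q))" using projector_norm_le[OF S(1), of "T (bv q)"] by simp
        then show ?thesis by (rule power_mono) simp
      qed
      finally have le: "(\<Sum>i<n. (co (S (bv i)) q)\<^sup>2) \<le> co (T (bv q)) q" by (simp add: projector_diag[OF T(1)])
      \<comment> \<open>One power of the weight is given away; the remaining product is, up to
        division by the trace, the weight that a round removes at \<open>q\<close>.\<close>
      have "(w q)\<^sup>2 \<le> w q" using w[OF q] by (simp add: power2_eq_square mult_left_le)
      then show "(w q)\<^sup>2 * (\<Sum>i<n. (co (S (bv i)) q)\<^sup>2) \<le> w q * co (T (bv q)) q"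
        using w[OF q] by (intro mult_mono le) (auto intro: sum_nonneg)
    qed
  qed simp
  finally show ?thesis .
qed

text \<open>Entrywise 1 - v_i v_j \<le> (1 - v_i) + (1 - v_j), and delocalization bounds |y_i y_j|
  by \<open>c\<close>. The row sums then turn total removed weight into a bound on the change of the
  form.\<close>

lemma delocalized_weight_change:
  assumes sym: "\<And>i j. i < n \<Longrightarrow> j < n \<Longrightarrow> F i j = F j i"
    and row: "\<And>i. i < n \<Longrightarrow> (\<Sum>j<n. \<bar>F i j\<bar>) \<le> k"
    and y: "\<And>i. i < n \<Longrightarrow> (co y i)\<^sup>2 \<le> c" and c: "0 \<le> c"
    and v: "\<And>i. i < n \<Longrightarrow> 0 \<le> v i \<and> v i \<le> 1"
  shows "\<bar>inner (op n F y) y - inner (op n F (dia n v y)) (dia n v y)\<bar> \<le> 2 * c * k * (\<Sum>i<n. 1 - v i)"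
proof -
  have "inner (op n F y) y - inner (op n F (dia n v y)) (dia n v y) =
      (\<Sum>i<n. \<Sum>j<n. F i j * (co y j * co y i) * (1 - v i * v j))"
    unfolding inner_op sum_subtractf[symmetric]
    by (intro sum.cong refl) (simp add: co_dia algebra_simps)
  also have "\<bar>\<dots>\<bar> \<le> (\<Sum>i<n. \<Sum>j<n. \<bar>F i j * (co y j * co y i) * (1 - v i * v j)\<bar>)"
    by (rule order_trans[OF sum_abs sum_mono]) (rule sum_abs)
  also have "\<dots> \<le> (\<Sum>i<n. \<Sum>j<n. \<bar>F i j\<bar> * c * (1 - v i) + \<bar>F i j\<bar> * c * (1 - v j))"
  proof (intro sum_mono)
    fix i j assume "i \<in> {..<n}" "j \<in> {..<n}"
    then have ij: "i < n" "j < n" by auto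
    have "\<bar>co y j\<bar> \<le> sqrt c" "\<bar>co y i\<bar> \<le> sqrt c" using y ij by (auto intro: real_le_rsqrt)
    then have "\<bar>co y j\<bar> * \<bar>co y i\<bar> \<le> sqrt c * sqrt c" using c by (intro mult_mono) auto
    then have 1: "\<bar>co y j * co y i\<bar> \<le> c" using c by (simp add: abs_mult)
    have "(1 - v i) * (1 - v j) \<ge> 0" "v i * v j \<le> 1" using v[OF ij(1)] v[OF ij(2)] by (auto intro: mult_le_one)
    then have 2: "\<bar>1 - v i * v j\<bar> \<le> (1 - v i) + (1 - v j)" by (simp add: algebra_simps)
    have "\<bar>F i j * (co y j * co y i) * (1 - v i * v j)\<bar> = \<bar>F i j\<bar> * \<bar>co y j * co y i\<bar> * \<bar>1 - v i * v j\<bar>"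
      by (simp only: abs_mult)
    also have "\<dots> \<le> \<bar>F i j\<bar> * c * ((1 - v i) + (1 - v j))"
      using 1 2 c by (intro mult_mono) auto
    finally show "\<bar>F i j * (co y j * co y i) * (1 - v i * v j)\<bar> \<le> \<bar>F i j\<bar> * c * (1 - v i) + \<bar>F i j\<bar> * c * (1 - v j)"
      unfolding distrib_left .
  qed
  also have "\<dots> = (\<Sum>i<n. \<Sum>j<n. \<bar>F i j\<bar> * c * (1 - v i)) + (\<Sum>j<n. \<Sum>i<n. \<bar>F i j\<bar> * c * (1 - v j))"
    by (simp only: sum.distrib) (subst (3) sum.swap, rule refl)
  also have "(\<Sum>j<n. \<Sum>i<n. \<bar>F i j\<bar> * c * (1 - v j)) = (\<Sum>i<n. \<Sum>j<n. \<bar>F i j\<bar> * c * (1 - v i))"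
    by (intro sum.cong refl) (simp add: sym)
  also have "(\<Sum>i<n. \<Sum>j<n. \<bar>F i j\<bar> * c * (1 - v i)) = (\<Sum>i<n. (\<Sum>j<n. \<bar>F i j\<bar>) * (c * (1 - v i)))"
    by (simp add: sum_distrib_right mult.assoc)
  also have "\<dots> \<le> (\<Sum>i<n. k * (c * (1 - v i)))"
    by (intro sum_mono mult_right_mono row) (use v c in auto)
  also have "(\<Sum>i<n. k * (c * (1 - v i))) = c * k * (\<Sum>i<n. 1 - v i)"
    by (simp add: sum_distrib_left ac_simps)
  finally show ?thesis by simp
qed

text \<open>Both sides are squared Frobenius norms of a matrix and its transpose.\<close>

lemma frobenius_adjoint:
  assumes adj: "\<And>x y. inner (F x) y = inner x (G y)" and "supp_in n F" "supp_in n G"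
  shows "(\<Sum>i<n. (norm (F (bv i)))\<^sup>2) = (\<Sum>i<n. (norm (G (bv i)))\<^sup>2)"
proof -
  have e: "(norm (H (bv i)))\<^sup>2 = (\<Sum>j<n. (co (H (bv i)) j)\<^sup>2)" if "supp_in n H" for H :: "fvec \<Rightarrow> fvec" and i
    unfolding power2_norm_eq_inner
    by (subst inner_lt[of n]) (use that in \<open>auto simp: supp_in_def power2_eq_square\<close>)
  have "(\<Sum>i<n. (norm (F (bv i)))\<^sup>2) = (\<Sum>i<n. \<Sum>j<n. (co (F (bv i)) j)\<^sup>2)" by (simp add: e assms)
  also have "\<dots> = (\<Sum>j<n. \<Sum>i<n. (co (F (bv i)) j)\<^sup>2)" by (rule sum.swap)
  also have "\<dots> = (\<Sum>j<n. \<Sum>i<n. (co (G (bv j)) i)\<^sup>2)"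
  proof (intro sum.cong refl)
    fix i j
    have "co (F (bv i)) j = co (G (bv j)) i" using adj[of "bv i" "bv j"] by (metis inner_bv inner_commute)
    then show "(co (F (bv i)) j)\<^sup>2 = (co (G (bv j)) i)\<^sup>2" by simp
  qed
  also have "\<dots> = (\<Sum>i<n. (norm (G (bv i)))\<^sup>2)" by (simp add: e assms)
  finally show ?thesis .
qed

section \<open>Analysis of the algorithm\<close>

lemma norm_sq_add_orthogonal:
  fixes a b :: "'a::real_inner"
  assumes "inner a b = 0"
  shows "(norm (a + b))\<^sup>2 = (norm a)\<^sup>2 + (norm b)\<^sup>2"
  using assms by (simp add: power2_norm_eq_inner inner_add_left inner_add_right inner_commute)

text \<open>\<open>\<kappa>\<close> exceeds the row sums of the input by the margin \<upsilon>;
  \<open>vs\<close> are the directions outside of which \<open>M\<close> is positive semidefinite;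
  \<open>\<epsilon>\<close> is the power method error for the exponent 2^n. Of the three conditions
  \<open>large\<close>, the first keeps spectral errors below \<upsilon>/32, the second keeps the
  coupling error of the last projection below \<tau>, and the third makes the cost of one surplus
  round at most \<upsilon>/16.\<close>

locale corrupted =
  fixes n :: nat and M D :: "nat \<Rightarrow> nat \<Rightarrow> real" and Q :: "nat set" and K \<upsilon> C \<kappa> \<epsilon> :: real
    and r :: nat and vs :: "fvec list"
  assumes n: "n > 0"
    and Msym: "\<And>i j. i < n \<Longrightarrow> j < n \<Longrightarrow> M i j = M j i"
    and Dsym: "\<And>i j. i < n \<Longrightarrow> j < n \<Longrightarrow> D i j = D j i"
    and Q: "Q \<subseteq> {..<n}"
    and Dsupp: "\<And>i j. i < n \<Longrightarrow> j < n \<Longrightarrow> D i j \<noteq> 0 \<Longrightarrow> i \<in> Q"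
    and Mrow: "\<And>i. i < n \<Longrightarrow> (\<Sum>j<n. \<bar>M i j\<bar>) \<le> K"
    and Drow: "\<And>i. i < n \<Longrightarrow> (\<Sum>j<n. \<bar>D i j\<bar>) \<le> K"
    and vs: "length vs \<le> r"
    and Mpsd: "\<And>x. (\<forall>g\<in>set vs. inner x g = 0) \<Longrightarrow> 0 \<le> inner (op n M x) x"
    and pos: "\<upsilon> > 0" "C > 0" "K > 0"
    and Frow: "\<And>i. i < n \<Longrightarrow> (\<Sum>j<n. \<bar>M i j + D i j\<bar>) \<le> \<kappa> - \<upsilon>"
    and kappa_le: "\<kappa> \<le> 2 * K + \<upsilon>"
    and eps: "\<epsilon> = real n / real (2 * 2 ^ n)"
    and large: "(real n)\<^sup>2 * sqrt \<epsilon> \<le> \<upsilon> / (64 * \<kappa>)" "(real n)\<^sup>2 * sqrt \<epsilon> \<le> 8 * C\<^sup>2" "32 * C * \<kappa> / \<upsilon> \<le> real n"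
begin

section \<open>The weighted matrices and their approximate spectral projections\<close>

abbreviation F :: "nat \<Rightarrow> nat \<Rightarrow> real" where
  "F i j \<equiv> M i j + D i j"

abbreviation A :: "(nat \<Rightarrow> real) \<Rightarrow> nat \<Rightarrow> nat \<Rightarrow> real" where
  "A w i j \<equiv> w i * F i j * w j"

abbreviation shifted :: "(nat \<Rightarrow> real) \<Rightarrow> nat \<Rightarrow> nat \<Rightarrow> real" where
  "shifted w i j \<equiv> \<kappa> * delta i j - A w i j"

definition weights :: "(nat \<Rightarrow> real) \<Rightarrow> bool" where
  "weights w \<longleftrightarrow> (\<forall>i<n. 0 \<le> w i \<and> w i \<le> 1)"

lemma Asym: "i < n \<Longrightarrow> j < n \<Longrightarrow> A w i j = A w j i"
  using Msym[of i j] Dsym[of i j] by simp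

lemma kappa_ge: "\<upsilon> \<le> \<kappa>"
  using Frow[OF n] order_trans[OF sum_nonneg Frow[OF n]] by auto

lemma kappa_pos: "\<kappa> > 0"
  using kappa_ge pos by linarith

lemma eps_small: "0 \<le> \<epsilon>" "\<epsilon> \<le> 1 / 64" "\<epsilon> * (\<kappa> + \<upsilon> / 4) \<le> \<upsilon> / 32"
  "real n * sqrt \<epsilon> \<le> (real n)\<^sup>2 * sqrt \<epsilon>"
proof -
  show e0: "0 \<le> \<epsilon>" by (simp add: eps)
  have n1: "1 \<le> real n" using n by simp
  show "real n * sqrt \<epsilon> \<le> (real n)\<^sup>2 * sqrt \<epsilon>"
    using n1 e0 by (intro mult_right_mono self_le_power) auto
  have "1 * sqrt \<epsilon> \<le> (real n)\<^sup>2 * sqrt \<epsilon>" using n1 e0 by (intro mult_right_mono) auto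
  then have s: "sqrt \<epsilon> \<le> \<upsilon> / (64 * \<kappa>)" using large(1) by simp
  have "\<upsilon> / (64 * \<kappa>) \<le> 1 / 64" using kappa_ge kappa_pos by (simp add: field_simps)
  then have s1: "sqrt \<epsilon> \<le> 1 / 64" using s by linarith
  have "\<epsilon> = sqrt \<epsilon> * sqrt \<epsilon>" using e0 by simp
  also have "\<dots> \<le> sqrt \<epsilon> * 1"
  proof (rule mult_left_mono)
    show "sqrt \<epsilon> \<le> 1" using s1 by linarith
  qed (use e0 in simp)
  finally have le: "\<epsilon> \<le> sqrt \<epsilon>" by simp
  then show "\<epsilon> \<le> 1 / 64" using s1 by linarith
  have "\<epsilon> * (\<kappa> + \<upsilon> / 4) \<le> \<upsilon> / (64 * \<kappa>) * (2 * \<kappa>)"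
    using le s e0 kappa_ge kappa_pos pos by (intro mult_mono) auto
  also have "\<dots> = \<upsilon> / 32" using kappa_pos by simp
  finally show "\<epsilon> * (\<kappa> + \<upsilon> / 4) \<le> \<upsilon> / 32" .
qed

lemma quad_F: "\<bar>inner (op n F x) x\<bar> \<le> (\<kappa> - \<upsilon>) * (norm x)\<^sup>2"
proof -
  have "\<bar>inner (op n F x) x\<bar> \<le> (\<Sum>i<n. (\<Sum>j<n. \<bar>F i j\<bar>) * (co x i)\<^sup>2)"
    by (rule quad_bound) (use Msym Dsym in auto)
  also have "\<dots> \<le> (\<Sum>i<n. (\<kappa> - \<upsilon>) * (co x i)\<^sup>2)" by (intro sum_mono mult_right_mono Frow) auto
  also have "\<dots> = (\<kappa> - \<upsilon>) * (\<Sum>i<n. (co x i)\<^sup>2)" by (simp add: sum_distrib_left)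
  also have "\<dots> \<le> (\<kappa> - \<upsilon>) * (norm x)\<^sup>2"
    using kappa_ge sum_co_sq_le[where n = n and z = x] by (intro mult_left_mono) (auto simp: power2_norm_eq_inner)
  finally show ?thesis .
qed

lemma quad_A:
  assumes "weights w"
  shows "\<bar>inner (op n (A w) x) x\<bar> \<le> (\<kappa> - \<upsilon>) * (norm x)\<^sup>2"
proof -
  have "\<bar>inner (op n (A w) x) x\<bar> \<le> (\<kappa> - \<upsilon>) * (norm (dia n w x))\<^sup>2"
    unfolding inner_op_weighted by (rule quad_F)
  also have "\<dots> \<le> (\<kappa> - \<upsilon>) * (norm x)\<^sup>2"
    using assms kappa_ge by (intro mult_left_mono norm_dia_le) (auto simp: weights_def)
  finally show ?thesis .
qed

lemma symop_shifted: "symop n (op n (shifted w))"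
  by (rule symop_op) (simp add: Msym Dsym)

text \<open>Row sums bound the form of \<open>A w\<close> by \<kappa> - \<upsilon>, and weights in
  [0, 1] do not enlarge it. The upper bound makes 2 \<kappa> the value of \<open>L\<close> in the
  greedy procedure.\<close>

lemma shifted_bounds:
  assumes w: "weights w"
  shows "psd (op n (shifted w))" and "inner (op n (shifted w) x) x \<le> 2 * \<kappa> * (norm x)\<^sup>2"
proof -
  have e: "inner (op n (shifted w) x) x = \<kappa> * (norm (op n delta x))\<^sup>2 - inner (op n (A w) (op n delta x)) (op n delta x)" for x
  proof -
    have 1: "inner (op n G x) x = inner (op n G (op n delta x)) (op n delta x)" for G
      unfolding op_op_delta by (simp add: inner_op co_op_delta)
    have 2: "op n (shifted w) (op n delta x) = \<kappa> *\<^sub>R op n delta x - op n (A w) (op n delta x)"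
      using op_scaled_delta[of n \<kappa> "A w" "op n delta x"] by (simp only: op_delta_op)
    show ?thesis unfolding 1[of "shifted w"] 2 by (simp add: inner_simps power2_norm_eq_inner)
  qed
  have "0 \<le> inner (op n (shifted w) x) x" for x
  proof -
    have "(\<kappa> - \<upsilon>) * (norm (op n delta x))\<^sup>2 \<le> \<kappa> * (norm (op n delta x))\<^sup>2"
      using pos by (intro mult_right_mono) auto
    then show ?thesis unfolding e using quad_A[OF w, of "op n delta x"] by linarith
  qed
  then show "psd (op n (shifted w))" using symopD(1)[OF symop_shifted] by (simp add: psd_def)
  have "inner (op n (shifted w) x) x \<le> \<kappa> * (norm (op n delta x))\<^sup>2 + \<kappa> * (norm (op n delta x))\<^sup>2"
  proof -
    have "(\<kappa> - \<upsilon>) * (norm (op n delta x))\<^sup>2 \<le> \<kappa> * (norm (op n delta x))\<^sup>2"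
      using pos by (intro mult_right_mono) auto
    then show ?thesis unfolding e using quad_A[OF w, of "op n delta x"] by linarith
  qed
  also have "\<dots> \<le> 2 * \<kappa> * (norm x)\<^sup>2"
    using mult_left_mono[OF norm_delta_le[of n x], of \<kappa>] kappa_pos by simp
  finally show "inner (op n (shifted w) x) x \<le> 2 * \<kappa> * (norm x)\<^sup>2" .
qed

lemma spectral:
  assumes inv: "greedy_inv n (op n (shifted w)) (\<kappa> + \<theta>) \<epsilon> (2 * \<kappa> * sqrt \<epsilon>) n T"
    and theta: "0 \<le> \<theta>" "\<theta> \<le> \<upsilon> / 4"
  shows "T u = u \<Longrightarrow> inner (op n (A w) u) u \<le> - (\<theta> - \<upsilon> / 32) * (norm u)\<^sup>2"
    and "T z = 0 \<Longrightarrow> inner (op n (A w) z) z \<ge> - (\<theta> + \<upsilon> / 32) * (norm z)\<^sup>2"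
    and "T u = u \<Longrightarrow> T z = 0 \<Longrightarrow> \<bar>inner (op n (A w) u) z\<bar> \<le> \<upsilon> / 32 * norm u * norm z"
proof -
  have "\<epsilon> * (\<kappa> + \<theta>) \<le> \<epsilon> * (\<kappa> + \<upsilon> / 4)" using theta eps_small by (intro mult_left_mono) auto
  then have 1: "\<epsilon> * (\<kappa> + \<theta>) \<le> \<upsilon> / 32" using eps_small by linarith
  \<comment> \<open>This is what \<open>large(1)\<close> is made for: the accumulated error n^2
    \<eta> with \<eta> = 2 \<kappa> sqrt \<epsilon> becomes \<upsilon>/32.\<close>
  have "2 * \<kappa> * ((real n)\<^sup>2 * sqrt \<epsilon>) \<le> 2 * \<kappa> * (\<upsilon> / (64 * \<kappa>))"
    using large(1) kappa_pos by (intro mult_left_mono) auto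
  also have "\<dots> = \<upsilon> / 32" using kappa_pos by simp
  finally have 2: "(real n)\<^sup>2 * (2 * \<kappa> * sqrt \<epsilon>) \<le> \<upsilon> / 32" by (simp add: ac_simps)
  have "2 * \<kappa> * (real n * sqrt \<epsilon>) \<le> 2 * \<kappa> * ((real n)\<^sup>2 * sqrt \<epsilon>)"
    using eps_small(4) kappa_pos by (intro mult_left_mono) auto
  then have 3: "real n * (2 * \<kappa> * sqrt \<epsilon>) \<le> \<upsilon> / 32" using 2 by (simp add: ac_simps)
  have 4: "0 \<le> \<kappa> + \<theta>" using kappa_pos theta by simp
  have 5: "0 \<le> \<upsilon> / 32" using pos by simp
  note g = greedy_spectral[OF Asym inv 4 eps_small(1) 1 2 3 theta(1) 5]
  show "T u = u \<Longrightarrow> inner (op n (A w) u) u \<le> - (\<theta> - \<upsilon> / 32) * (norm u)\<^sup>2"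
    "T z = 0 \<Longrightarrow> inner (op n (A w) z) z \<ge> - (\<theta> + \<upsilon> / 32) * (norm z)\<^sup>2"
    "T u = u \<Longrightarrow> T z = 0 \<Longrightarrow> \<bar>inner (op n (A w) u) z\<bar> \<le> \<upsilon> / 32 * norm u * norm z"
    using g by blast+
qed

section \<open>The potential argument on the weight of the corrupted set\<close>

text \<open>The first alternative is preserved by all later rounds; the second one fails after enough rounds,
  as \<open>Q\<close> is small.\<close>

definition progress :: "nat \<Rightarrow> (nat \<Rightarrow> real) \<Rightarrow> bool" where
  "progress u w \<longleftrightarrow> weights w \<and> (\<Sum>i<n. 1 - w i) \<le> real u \<and>
    (few_negative n (A w) (3 * \<upsilon> / 16) (2 * real r) \<or>
      3 * \<upsilon> / (64 * K) * real u \<le> (\<Sum>q\<in>Q. 1 - w q))"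

lemma progress_0: "(\<And>i. i < n \<Longrightarrow> w i = 1) \<Longrightarrow> progress 0 w"
  using Q by (auto simp: progress_def weights_def intro!: sum_nonneg)

text \<open>If the projection has dimension at most 2r, its kernel certifies the first alternative.
  Otherwise \<open>corrupted_mass\<close> with c = \<upsilon>/8 - \<upsilon>/32 = 3\<upsilon>/32
  shows that \<open>Q\<close> loses at least c/(2K) = 3\<upsilon>/(64K) in this round.\<close>

lemma progress_step:
  assumes pr: "progress u w"
    and inv: "greedy_inv n (op n (shifted w)) (\<kappa> + \<upsilon> / 8) \<epsilon> (2 * \<kappa> * sqrt \<epsilon>) n T"
    and w': "\<And>i. i < n \<Longrightarrow> w' i = w i * (1 - co (T (bv i)) i / trace_on n T)"
  shows "progress (Suc u) w'"
proof -
  have w: "weights w" and tot: "(\<Sum>i<n. 1 - w i) \<le> real u"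
    and alt: "few_negative n (A w) (3 * \<upsilon> / 16) (2 * real r) \<or>
      3 * \<upsilon> / (64 * K) * real u \<le> (\<Sum>q\<in>Q. 1 - w q)"
    using pr by (auto simp: progress_def)
  have T: "projector T" "symop n T" using inv by (auto simp: greedy_inv_def)
  obtain gs :: "fvec list" where gs: "trace_on n T = real (length gs)"
    "\<And>x. T x = (\<Sum>g\<leftarrow>gs. (inner x g / inner g g) *\<^sub>R g)"
    using inv unfolding greedy_inv_def by auto
  let ?d = "trace_on n T" and ?t = "\<lambda>i. co (T (bv i)) i"
  have t0: "0 \<le> ?t i" for i by (simp add: projector_diag[OF T(1)])
  have td: "?t i \<le> ?d" if "i < n" for i
    unfolding trace_on_def by (rule member_le_sum) (use that t0 in auto)
  have d0: "0 \<le> ?d" by (simp add: gs)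
  have q: "0 \<le> ?t i / ?d" "?t i / ?d \<le> 1" if "i < n" for i
    using t0 td[OF that] d0 by (auto simp: divide_le_eq_1)
  have w01: "0 \<le> w i" "w i \<le> 1" if "i < n" for i using w that by (auto simp: weights_def)
  have ww': "weights w'"
    unfolding weights_def using w01 q by (auto simp: w' intro!: mult_le_one)
  have eq: "1 - w' i = (1 - w i) + w i * (?t i / ?d)" if "i < n" for i
    using that by (simp add: w' algebra_simps)
  have "(\<Sum>i<n. 1 - w' i) = (\<Sum>i<n. 1 - w i) + (\<Sum>i<n. w i * (?t i / ?d))"
    by (simp add: eq sum.distrib)
  also have "(\<Sum>i<n. w i * (?t i / ?d)) \<le> (\<Sum>i<n. ?t i / ?d)"
    by (intro sum_mono mult_left_le_one_le) (use q w01 in auto)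
  also have "\<dots> = ?d / ?d" by (simp add: sum_divide_distrib[symmetric] trace_on_def)
  \<comment> \<open>For trace 0 the convention x/0 = 0 leaves all weights unchanged, so the bound
    covers this case too.\<close>
  also have "\<dots> \<le> 1" by simp
  finally have tot': "(\<Sum>i<n. 1 - w' i) \<le> real (Suc u)" using tot by simp
  have keep: "few_negative n (A w') (3 * \<upsilon> / 16) (2 * real r)" if "few_negative n (A w) (3 * \<upsilon> / 16) (2 * real r)"
    by (rule few_negative_scale[OF that, where \<mu> = "\<lambda>i. 1 - ?t i / ?d"])
      (use pos q w' in \<open>auto simp: abs_le_iff\<close>)
  have th: "0 \<le> \<upsilon> / 8" "\<upsilon> / 8 \<le> \<upsilon> / 4" using pos by auto
  note sp = spectral[OF inv th]
  have "few_negative n (A w') (3 * \<upsilon> / 16) (2 * real r) \<or>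
      3 * \<upsilon> / (64 * K) * real (Suc u) \<le> (\<Sum>q\<in>Q. 1 - w' q)"
  proof (cases "few_negative n (A w) (3 * \<upsilon> / 16) (2 * real r)")
    case False
    then have mass: "3 * \<upsilon> / (64 * K) * real u \<le> (\<Sum>q\<in>Q. 1 - w q)" using alt by simp
    have dr: "?d > 2 * real r"
    proof (rule ccontr)
      assume "\<not> ?d > 2 * real r"
      then have "real (length gs) \<le> 2 * real r" using gs(1) by simp
      moreover have "inner (op n (A w) z) z \<ge> - (3 * \<upsilon> / 16) * (norm z)\<^sup>2" if "T z = 0" for z
      proof -
        \<comment> \<open>The threshold 3\<upsilon>/16 is midway between \<upsilon>/8 and
          \<upsilon>/4, so an error of \<upsilon>/32 on either side does not reach it.\<close>
        have "(\<upsilon> / 8 + \<upsilon> / 32) * (norm z)\<^sup>2 \<le> (3 * \<upsilon> / 16) * (norm z)\<^sup>2" using pos by (intro mult_right_mono) auto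
        then show ?thesis using sp(2)[OF that] unfolding mult_minus_left by linarith
      qed
      ultimately show False using few_negative_of_complement[OF gs(2)] False by blast
    qed
    have "3 * \<upsilon> / 32 * ?d / 2 \<le> K * (\<Sum>q\<in>Q. w q * ?t q)"
    proof (rule corrupted_mass[OF T])
      show "inner (op n (A w) u) u \<le> - (3 * \<upsilon> / 32) * (norm u)\<^sup>2" if "T u = u" for u
        using sp(1)[OF that] by simp
    qed (use w01 pos Mpsd dr vs Dsym Dsupp Drow Q in auto)
    then have "3 * \<upsilon> / (64 * K) * ?d \<le> (\<Sum>q\<in>Q. w q * ?t q)"
      using pos by (simp add: field_simps)
    then have "3 * \<upsilon> / (64 * K) \<le> (\<Sum>q\<in>Q. w q * ?t q) / ?d"
      using dr by (subst pos_le_divide_eq) auto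
    also have "\<dots> = (\<Sum>q\<in>Q. w q * (?t q / ?d))" by (simp add: sum_divide_distrib)
    finally have "3 * \<upsilon> / (64 * K) * real (Suc u) \<le> (\<Sum>q\<in>Q. 1 - w q) + (\<Sum>q\<in>Q. w q * (?t q / ?d))"
      using mass by (simp add: distrib_left)
    also have "\<dots> = (\<Sum>q\<in>Q. 1 - w' q)"
      unfolding sum.distrib[symmetric] by (rule sum.cong) (use Q eq in auto)
    finally show ?thesis by simp
  qed (use keep in simp)
  then show ?thesis using ww' tot' by (simp add: progress_def)
qed

text \<open>In the second alternative \<open>Q\<close> would have lost weight proportional to the
  number of rounds, hence to n, but it has only \<gamma> n to lose.\<close>

lemma progress_few_negative:
  assumes pr: "progress u w" and u: "real n \<le> real u \<or> \<upsilon> * real n \<le> real u * (32 * \<kappa> * C)"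
    and Qc: "real (card Q) \<le> \<gamma> * real n"
    and g: "\<gamma> < 3 * \<upsilon> / (64 * K) * min 1 (\<upsilon> / (32 * (2 * K + \<upsilon>) * C))"
  shows "few_negative n (A w) (3 * \<upsilon> / 16) (2 * real r)"
proof (rule ccontr)
  let ?m = "min 1 (\<upsilon> / (32 * (2 * K + \<upsilon>) * C))" and ?c = "3 * \<upsilon> / (64 * K)"
  assume "\<not> few_negative n (A w) (3 * \<upsilon> / 16) (2 * real r)"
  then have "?c * real u \<le> (\<Sum>q\<in>Q. 1 - w q)" using pr by (auto simp: progress_def)
  also have "\<dots> \<le> (\<Sum>q\<in>Q. 1)" using pr Q by (intro sum_mono) (auto simp: progress_def weights_def)
  also have "\<dots> \<le> \<gamma> * real n" using Qc by simp
  finally have a: "?c * real u \<le> \<gamma> * real n" .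
  \<comment> \<open>The loop stops after n rounds or once \<upsilon> n / (32 \<kappa> C) is reached.
    Here \<kappa> is replaced by 2K + \<upsilon>, since the bound on \<gamma> may not depend on the
    matrices.\<close>
  have "?m * real n \<le> real u"
    using u
  proof
    assume "real n \<le> real u"
    moreover have "?m * real n \<le> 1 * real n" by (intro mult_right_mono) auto
    ultimately show ?thesis by simp
  next
    assume b: "\<upsilon> * real n \<le> real u * (32 * \<kappa> * C)"
    also have "\<dots> \<le> real u * (32 * (2 * K + \<upsilon>) * C)"
      using kappa_le pos by (intro mult_left_mono mult_right_mono) auto
    finally have "\<upsilon> * real n / (32 * (2 * K + \<upsilon>) * C) \<le> real u"
      using pos by (subst pos_divide_le_eq) auto
    then have "\<upsilon> / (32 * (2 * K + \<upsilon>) * C) * real n \<le> real u" by simp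
    moreover have "?m * real n \<le> \<upsilon> / (32 * (2 * K + \<upsilon>) * C) * real n" by (intro mult_right_mono) auto
    ultimately show ?thesis by linarith
  qed
  then have "?c * (?m * real n) \<le> ?c * real u" using pos by (intro mult_left_mono) auto
  then have "(?c * ?m) * real n \<le> \<gamma> * real n" using a by (simp add: mult.assoc)
  then have "?c * ?m \<le> \<gamma>" by (rule mult_right_le_imp_le) (use n in simp)
  then show False using g by simp
qed

section \<open>Damping the final projection, and the guarantees for the output\<close>

lemma smoothed_bounds:
  fixes s :: "nat \<Rightarrow> real"
  assumes T: "projector T" "symop n T" and X: "op n TF = T"
    and s: "\<And>i. i < n \<Longrightarrow> 0 \<le> s i \<and> s i \<le> 1"
  defines "X \<equiv> op n (\<lambda>i j. s i * TF i j * s j)"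
  shows "inner (X x) x = (norm (T (dia n s x)))\<^sup>2" and "symop n X" and "psd X"
    and "inner (X x) x \<le> 1 * (norm x)\<^sup>2"
proof -
  have e: "X x = dia n s (T (dia n s x))" for x unfolding X_def by (simp add: op_weighted X)
  show q: "inner (X x) x = (norm (T (dia n s x)))\<^sup>2" for x
    unfolding e inner_dia power2_norm_eq_inner
    using projector_inner[OF T(1), of "T (dia n s x)" "dia n s x"] by (simp only: projector_idem[OF T(1)])
  have "selfadj X"
    unfolding selfadj_def
  proof (intro conjI allI)
    show "linear X" unfolding X_def by (rule linear_op)
    show "inner (X x) y = inner x (X y)" for x y
      by (simp add: e inner_dia projector_inner[OF T(1)])
  qed
  then show "symop n X" "psd X"
    using supp_in_op[of n] by (auto simp: symop_def psd_def q) (simp add: X_def)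
  have "(norm (T (dia n s x)))\<^sup>2 \<le> (norm (dia n s x))\<^sup>2"
    by (intro power_mono projector_norm_le[OF T(1)]) auto
  also have "\<dots> \<le> (norm x)\<^sup>2" by (rule norm_dia_le) (use s in auto)
  finally show "inner (X x) x \<le> 1 * (norm x)\<^sup>2" by (simp add: q)
qed

context
  fixes w s :: "nat \<Rightarrow> real" and u :: nat and \<gamma> \<tau> :: real and T X T' :: "fvec \<Rightarrow> fvec" and TF :: "nat \<Rightarrow> nat \<Rightarrow> real"
  assumes pr: "progress u w"
    and u: "real n \<le> real u \<or> \<upsilon> * real n \<le> real u * (32 * \<kappa> * C)"
    and u_le: "real u \<le> \<upsilon> * real n / (32 * \<kappa> * C) + 1"
    and Qc: "real (card Q) \<le> \<gamma> * real n"
    and gamma: "\<gamma> < 3 * \<upsilon> / (64 * K) * min 1 (\<upsilon> / (32 * (2 * K + \<upsilon>) * C))" "\<gamma> \<le> \<upsilon> / (8 * K * C)"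
    and inv: "greedy_inv n (op n (shifted w)) (\<kappa> + \<upsilon> / 4) \<epsilon> (2 * \<kappa> * sqrt \<epsilon>) n T"
    and TF: "op n TF = T"
    and tau: "\<tau> = 16 * \<kappa> * C\<^sup>2 * trace_on n T / (\<upsilon> * real n)"
    and s: "\<And>i. i < n \<Longrightarrow> s i = \<tau> / (\<tau> + co (T (bv i)) i)"
    and X: "X = op n (\<lambda>i j. s i * TF i j * s j)"
    and inv': "greedy_inv n X (\<upsilon> / (16 * \<kappa>)) \<epsilon> (sqrt \<epsilon>) n T'"
begin

lemma projector_T: "projector T" "symop n T" and projector_T': "projector T'" "symop n T'"
  using inv inv' by (auto simp: greedy_inv_def)

lemma weight_bounds: "i < n \<Longrightarrow> 0 \<le> w i \<and> w i \<le> 1" and weights_w: "weights w"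
  using pr by (auto simp: progress_def weights_def)

lemma diag_nonneg: "0 \<le> co (T (bv i)) i"
  by (simp add: projector_diag[OF projector_T(1)])

text \<open>The trace is the length of a list. The case 0 is separated throughout because then
  \<tau> = 0 and \<kappa> cannot be compared with \<open>K\<close>.\<close>

lemma trace_cases: "trace_on n T = 0 \<or> 1 \<le> trace_on n T"
proof -
  obtain gs :: "fvec list" where "trace_on n T = real (length gs)"
    using inv unfolding greedy_inv_def by auto
  then show ?thesis by (cases gs) auto
qed

lemma tau_nonneg: "0 \<le> \<tau>"
  unfolding tau using trace_cases kappa_pos pos by (intro divide_nonneg_nonneg mult_nonneg_nonneg) auto

lemma damping_bounds: "i < n \<Longrightarrow> 0 \<le> s i \<and> s i \<le> 1"
  using tau_nonneg diag_nonneg[of i] by (auto simp: s divide_le_eq_1)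

lemma spectral_T:
  "T x = x \<Longrightarrow> inner (op n (A w) x) x \<le> - (7 * \<upsilon> / 32) * (norm x)\<^sup>2"
  "T z = 0 \<Longrightarrow> inner (op n (A w) z) z \<ge> - (9 * \<upsilon> / 32) * (norm z)\<^sup>2"
  "T x = x \<Longrightarrow> T z = 0 \<Longrightarrow> \<bar>inner (op n (A w) x) z\<bar> \<le> \<upsilon> / 32 * norm x * norm z"
proof -
  have th: "0 \<le> \<upsilon> / 4" "\<upsilon> / 4 \<le> \<upsilon> / 4" using pos by auto
  show "T x = x \<Longrightarrow> inner (op n (A w) x) x \<le> - (7 * \<upsilon> / 32) * (norm x)\<^sup>2"
    using spectral(1)[OF inv th] by (simp add: field_simps)
  show "T z = 0 \<Longrightarrow> inner (op n (A w) z) z \<ge> - (9 * \<upsilon> / 32) * (norm z)\<^sup>2"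
    using spectral(2)[OF inv th] by (simp add: field_simps)
  show "T x = x \<Longrightarrow> T z = 0 \<Longrightarrow> \<bar>inner (op n (A w) x) z\<bar> \<le> \<upsilon> / 32 * norm x * norm z"
    using spectral(3)[OF inv th] by blast
qed

text \<open>The range of \<open>T\<close> lies below -7\<upsilon>/32, strictly under the threshold
  -6\<upsilon>/32 at which few directions are left after the rounds.\<close>

lemma trace_le: "trace_on n T \<le> 2 * real r"
  by (rule trace_le_of_few_negative[OF projector_T progress_few_negative[OF pr u Qc gamma(1)] spectral_T(1)])
    (use pos in auto)

text \<open>\<open>kappa_le\<close> alone gives no multiple of \<open>K\<close>, as \<upsilon> may
  be large. A nonzero trace supplies a vector on which the form is at most -7\<upsilon>/32 but, by
  the row sums, at least -(\<kappa> - \<upsilon>) \<ge> -2K; so \<upsilon> is O(K).\<close>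

lemma kappa_le_K:
  assumes "trace_on n T \<noteq> 0"
  shows "\<kappa> \<le> 12 * K" "\<upsilon> \<le> 10 * K"
proof -
  have "(\<Sum>i<n. (norm (T (bv i)))\<^sup>2) \<noteq> 0" using assms by (simp add: projector_trace[OF projector_T(1)])
  then obtain i where "norm (T (bv i)) \<noteq> 0"
    by (metis (mono_tags, lifting) power_zero_numeral sum.neutral)
  then have p: "(norm (T (bv i)))\<^sup>2 > 0" by simp
  have "inner (op n (A w) (T (bv i))) (T (bv i)) \<le> - (7 * \<upsilon> / 32) * (norm (T (bv i)))\<^sup>2"
    by (rule spectral_T(1)) (rule projector_idem[OF projector_T(1)])
  then have "(7 * \<upsilon> / 32) * (norm (T (bv i)))\<^sup>2 \<le> (\<kappa> - \<upsilon>) * (norm (T (bv i)))\<^sup>2"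
    using quad_A[OF weights_w, of "T (bv i)"] unfolding mult_minus_left by linarith
  then have "7 * \<upsilon> / 32 \<le> \<kappa> - \<upsilon>" using p by (rule mult_right_le_imp_le)
  then show "\<kappa> \<le> 12 * K" using kappa_le pos by linarith
  show "\<upsilon> \<le> 10 * K" using \<open>7 * \<upsilon> / 32 \<le> \<kappa> - \<upsilon>\<close> kappa_le pos by linarith
qed

lemma smoothed:
  "inner (X x) x = (norm (T (dia n s x)))\<^sup>2" "symop n X" "psd X" "inner (X x) x \<le> 1 * (norm x)\<^sup>2"
  using smoothed_bounds[where s = s, OF projector_T TF damping_bounds, folded X] by blast+

text \<open>The form of \<open>X\<close> lies between 0 and |x|^2, so \<eta> is just sqrt
  \<epsilon>. Around the threshold \<upsilon>/(16\<kappa>) the errors cost at most a factor 1/2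
  below and 3/2 above.\<close>

lemma spectral_T':
  "T' x = x \<Longrightarrow> \<upsilon> / (32 * \<kappa>) * (norm x)\<^sup>2 \<le> inner (X x) x"
  "T' z = 0 \<Longrightarrow> inner (X z) z \<le> 3 * \<upsilon> / (32 * \<kappa>) * (norm z)\<^sup>2"
  "T' x = x \<Longrightarrow> T' z = 0 \<Longrightarrow> \<bar>inner (X x) z\<bar> \<le> real n * sqrt \<epsilon> * norm x * norm z"
proof -
  have g: "\<And>u z. T' u = u \<Longrightarrow> T' z = 0 \<Longrightarrow> \<bar>inner (X u) z\<bar> \<le> real n * sqrt \<epsilon> * norm u * norm z"
    "\<And>u. T' u = u \<Longrightarrow> (\<upsilon> / (16 * \<kappa>) - (real n)\<^sup>2 * sqrt \<epsilon>) * (norm u)\<^sup>2 \<le> inner (X u) u"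
    using inv' unfolding greedy_inv_def by blast+
  show "T' x = x \<Longrightarrow> T' z = 0 \<Longrightarrow> \<bar>inner (X x) z\<bar> \<le> real n * sqrt \<epsilon> * norm x * norm z"
    by (rule g(1))
  have p: "0 \<le> \<upsilon> / (64 * \<kappa>)" using pos kappa_pos by simp
  have e: "\<upsilon> / (32 * \<kappa>) = 2 * (\<upsilon> / (64 * \<kappa>))" "\<upsilon> / (16 * \<kappa>) = 4 * (\<upsilon> / (64 * \<kappa>))"
    "3 * \<upsilon> / (32 * \<kappa>) = 6 * (\<upsilon> / (64 * \<kappa>))" by auto
  show "\<upsilon> / (32 * \<kappa>) * (norm x)\<^sup>2 \<le> inner (X x) x" if "T' x = x"
  proof -
    have "\<upsilon> / (32 * \<kappa>) * (norm x)\<^sup>2 \<le> (\<upsilon> / (16 * \<kappa>) - (real n)\<^sup>2 * sqrt \<epsilon>) * (norm x)\<^sup>2"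
      using large(1) p unfolding e by (intro mult_right_mono) auto
    then show ?thesis using g(2)[OF that] by linarith
  qed
  show "inner (X z) z \<le> 3 * \<upsilon> / (32 * \<kappa>) * (norm z)\<^sup>2" if "T' z = 0"
  proof -
    have p2: "0 \<le> \<upsilon> / (16 * \<kappa>)" using pos kappa_pos by simp
    have "inner (X z) z \<le> (1 + \<epsilon>) * (\<upsilon> / (16 * \<kappa>)) * (norm z)\<^sup>2"
      by (rule greedy_final[OF smoothed(2) inv' _ eps_small(1) that]) (rule p2)
    also have "\<dots> \<le> (3 / 2) * (\<upsilon> / (16 * \<kappa>)) * (norm z)\<^sup>2"
      using eps_small p2 by (intro mult_right_mono) auto
    finally show ?thesis by simp
  qed
qed

text \<open>Each unit of trace of \<open>T'\<close> contributes at least \<upsilon>/(32\<kappa>) to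
  the squared Frobenius norm of T D_s T'. Passing to the adjoint T' D_s T bounds this norm by that
  of \<open>T\<close>, as \<open>T'\<close> and D_s are contractions.\<close>

lemma trace_T'_le: "\<upsilon> / (32 * \<kappa>) * trace_on n T' \<le> trace_on n T"
proof -
  have "\<upsilon> / (32 * \<kappa>) * trace_on n T' = (\<Sum>i<n. \<upsilon> / (32 * \<kappa>) * (norm (T' (bv i)))\<^sup>2)"
    by (simp only: projector_trace[OF projector_T'(1)] sum_distrib_left)
  also have "\<dots> \<le> (\<Sum>i<n. (norm (T (dia n s (T' (bv i)))))\<^sup>2)"
    unfolding smoothed(1)[symmetric] by (intro sum_mono spectral_T'(1) projector_idem[OF projector_T'(1)])
  also have "\<dots> = (\<Sum>i<n. (norm (T' (dia n s (T (bv i)))))\<^sup>2)"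
  proof (rule frobenius_adjoint)
    show "inner (T (dia n s (T' x))) y = inner x (T' (dia n s (T y)))" for x y
      by (simp add: projector_inner[OF projector_T(1)] projector_inner[OF projector_T'(1)] inner_dia)
    show "supp_in n (\<lambda>x. T (dia n s (T' x)))" "supp_in n (\<lambda>x. T' (dia n s (T x)))"
      using symopD(2)[OF projector_T(2)] symopD(2)[OF projector_T'(2)] by (auto simp: supp_in_def)
  qed
  also have "\<dots> \<le> (\<Sum>i<n. (norm (T (bv i)))\<^sup>2)"
  proof (intro sum_mono)
    fix i
    have "(norm (T' (dia n s (T (bv i)))))\<^sup>2 \<le> (norm (dia n s (T (bv i))))\<^sup>2"
      by (intro power_mono projector_norm_le[OF projector_T'(1)]) auto
    also have "\<dots> \<le> (norm (T (bv i)))\<^sup>2" by (rule norm_dia_le) (use damping_bounds in auto)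
    finally show "(norm (T' (dia n s (T (bv i)))))\<^sup>2 \<le> (norm (T (bv i)))\<^sup>2" .
  qed
  also have "\<dots> = trace_on n T" by (simp only: projector_trace[OF projector_T(1)])
  finally show ?thesis .
qed

lemma output_dim: "trace_on n T' \<le> 768 * (K / \<upsilon> * real r)"
proof (cases "trace_on n T = 0")
  case True
  then have "\<upsilon> / (32 * \<kappa>) * trace_on n T' \<le> 0" using trace_T'_le by simp
  then have "trace_on n T' \<le> 0" using pos kappa_pos by (simp add: mult_le_0_iff divide_le_0_iff)
  also have "0 \<le> 768 * (K / \<upsilon> * real r)" using pos by simp
  finally show ?thesis .
next
  case False
  have "\<upsilon> * trace_on n T' \<le> 32 * \<kappa> * trace_on n T"
    using trace_T'_le kappa_pos by (simp add: field_simps)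
  \<comment> \<open>The constant is 768 = 32 * 12 * 2.\<close>
  also have "\<dots> \<le> 32 * (12 * K) * (2 * real r)"
    using kappa_le_K[OF False] trace_le trace_cases kappa_pos pos by (intro mult_mono) auto
  finally show ?thesis using pos by (simp add: field_simps)
qed

text \<open>Split e_i into its parts \<open>?x\<close> in the range and \<open>?z\<close> in the
  kernel of \<open>T'\<close>. The diagonal entry of \<open>X\<close> dominates the form at
  \<open>?x\<close> up to twice the coupling error, and damping bounds it by \<tau> T_ii / (\<tau> +
  T_ii) \<le> \<tau>.\<close>

lemma output_diag_aux:
  assumes i: "i < n" and "trace_on n T \<noteq> 0"
  shows "\<upsilon> / (32 * \<kappa>) * co (T' (bv i)) i \<le> 2 * \<tau>"
proof -
  let ?x = "T' (bv i)" and ?z = "bv i - T' (bv i)"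
  have Tx: "T' ?x = ?x" and Tz: "T' ?z = 0"
    by (simp_all add: projector_idem[OF projector_T'(1)] projector_diff[OF projector_T'(1)])
  have nx: "norm ?x \<le> 1" using projector_norm_le[OF projector_T'(1), of "bv i"] by (simp add: norm_bv)
  have nz: "norm ?z \<le> 1"
  proof -
    have "inner ?x ?z = 0"
      using projector_inner[OF projector_T'(1), of "bv i" ?z] Tz by simp
    then have "(norm (bv i))\<^sup>2 = (norm ?x)\<^sup>2 + (norm ?z)\<^sup>2"
      using norm_sq_add_orthogonal[of ?x ?z] by simp
    moreover have "(norm (bv i))\<^sup>2 = 1\<^sup>2" by (simp add: norm_bv)
    ultimately have "(norm ?z)\<^sup>2 \<le> 1\<^sup>2" using zero_le_power2[of "norm ?x"] by linarith
    then show ?thesis by (rule power2_le_imp_le) simp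
  qed
  have lin: "linear X" and symX: "inner (X a) b = inner a (X b)" and posX: "0 \<le> inner (X a) a" for a b
    using smoothed(3) by (auto simp: psd_def selfadj_def)
  have "X (bv i) = X ?x + X ?z" by (simp add: linear_diff[OF lin])
  then have "inner (X (bv i)) (bv i) = inner (X ?x + X ?z) (?x + ?z)" by simp
  also have "\<dots> = inner (X ?x) ?x + 2 * inner (X ?x) ?z + inner (X ?z) ?z"
    using symX[of ?z ?x] by (simp only: inner_add_left inner_add_right inner_commute[of ?z "X ?x"])
  finally have e: "inner (X (bv i)) (bv i) = inner (X ?x) ?x + 2 * inner (X ?x) ?z + inner (X ?z) ?z" .
  have c: "\<bar>inner (X ?x) ?z\<bar> \<le> real n * sqrt \<epsilon>"
  proof -
    have "\<bar>inner (X ?x) ?z\<bar> \<le> real n * sqrt \<epsilon> * (norm ?x * norm ?z)"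
      using spectral_T'(3)[OF Tx Tz] by (simp add: mult.assoc)
    also have "\<dots> \<le> real n * sqrt \<epsilon> * 1"
      using nx nz eps_small(1) by (intro mult_left_mono mult_le_one) auto
    finally show ?thesis by simp
  qed
  have d1: "1 \<le> trace_on n T" using assms trace_cases by simp
  have Xi: "inner (X (bv i)) (bv i) \<le> \<tau>"
  proof -
    let ?t = "co (T (bv i)) i"
    have di: "dia n s (bv i) = s i *\<^sub>R bv i"
      by (rule fvec_eqI) (use i in \<open>auto simp: co_dia co_simps co_bv\<close>)
    have "inner (X (bv i)) (bv i) = (s i)\<^sup>2 * ?t"
      by (simp add: smoothed(1) di projector_scale[OF projector_T(1)] power_mult_distrib projector_diag[OF projector_T(1)])
    also have "\<dots> = s i * (s i * ?t)" by (simp add: power2_eq_square)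
    also have "\<dots> \<le> 1 * (s i * ?t)" using damping_bounds[OF i] diag_nonneg by (intro mult_right_mono) auto
    also have "s i * ?t \<le> \<tau>"
    proof (cases "\<tau> + ?t = 0")
      case False
      then have "\<tau> + ?t > 0" using tau_nonneg diag_nonneg[of i] by simp
      moreover have "\<tau> * ?t \<le> \<tau> * (\<tau> + ?t)" using tau_nonneg by (intro mult_left_mono) auto
      ultimately show ?thesis by (simp add: s[OF i] pos_divide_le_eq)
    qed (use s[OF i] tau_nonneg in simp)
    finally show ?thesis by simp
  qed
  \<comment> \<open>A trace of at least 1 and \<kappa> \<ge> \<upsilon> give n \<tau> \<ge> 16 C^2,
    which \<open>large(2)\<close> compares with the error.\<close>
  have "2 * (real n * sqrt \<epsilon>) \<le> \<tau>"
  proof -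
    have "real n * (2 * (real n * sqrt \<epsilon>)) \<le> 16 * C\<^sup>2"
      using large(2) by (simp add: power2_eq_square)
    also have "\<dots> \<le> 16 * (\<kappa> / \<upsilon>) * C\<^sup>2 * trace_on n T"
    proof -
      have "16 * 1 * C\<^sup>2 * 1 \<le> 16 * (\<kappa> / \<upsilon>) * C\<^sup>2 * trace_on n T"
        using d1 kappa_ge pos by (intro mult_mono) auto
      then show ?thesis by simp
    qed
    also have "\<dots> = real n * \<tau>" using n pos by (simp add: tau)
    finally show ?thesis using n by simp
  qed
  then have "inner (X ?x) ?x \<le> 2 * \<tau>" using e c Xi posX[of ?z] by linarith
  then show ?thesis
    using spectral_T'(1)[OF Tx] by (simp add: projector_diag[OF projector_T'(1)])
qed

lemma output_diag:
  assumes i: "i < n"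
  shows "co (T' (bv i)) i \<le> 2949120 * (C\<^sup>2 * K ^ 3 / \<upsilon> ^ 3 * (real r / real n))"
proof (cases "trace_on n T = 0")
  case True
  then have "\<upsilon> / (32 * \<kappa>) * trace_on n T' \<le> 0" using trace_T'_le by simp
  then have "trace_on n T' \<le> 0" using pos kappa_pos by (simp add: mult_le_0_iff divide_le_0_iff)
  moreover have "co (T' (bv i)) i \<le> trace_on n T'"
    unfolding trace_on_def using i by (intro member_le_sum) (auto simp: projector_diag[OF projector_T'(1)])
  moreover have "0 \<le> 2949120 * (C\<^sup>2 * K ^ 3 / \<upsilon> ^ 3 * (real r / real n))" using pos by simp
  ultimately show ?thesis by linarith
next
  case False
  note kK = kappa_le_K[OF False]
  have "co (T' (bv i)) i \<le> 64 * \<kappa> * \<tau> / \<upsilon>"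
    using output_diag_aux[OF i False] pos kappa_pos by (simp add: field_simps)
  also have "\<dots> = 1024 * C\<^sup>2 / (\<upsilon>\<^sup>2 * real n) * (\<kappa>\<^sup>2 * trace_on n T)"
    by (simp add: tau power2_eq_square ac_simps)
  also have "\<dots> \<le> 1024 * C\<^sup>2 / (\<upsilon>\<^sup>2 * real n) * ((12 * K)\<^sup>2 * (2 * real r))"
    using kK trace_le trace_cases kappa_pos by (intro mult_left_mono mult_mono power_mono) auto
  also have "\<dots> = 294912 * (C\<^sup>2 * K\<^sup>2 / \<upsilon>\<^sup>2 * (real r / real n)) * 1"
    by (simp add: power2_eq_square)
  \<comment> \<open>Squares become the cubes of the claim because \<upsilon> \<le> 10 K; the
    constant grows to 2949120.\<close>
  also have "\<dots> \<le> 294912 * (C\<^sup>2 * K\<^sup>2 / \<upsilon>\<^sup>2 * (real r / real n)) * (10 * K / \<upsilon>)"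
    using kK pos by (intro mult_left_mono) auto
  also have "\<dots> = 2949120 * (C\<^sup>2 * K ^ 3 / \<upsilon> ^ 3 * (real r / real n))"
    by (simp add: power2_eq_square power3_eq_cube ac_simps)
  finally show ?thesis .
qed

section \<open>A delocalized vector of negative energy is captured\<close>

context
  fixes y :: fvec
  assumes y_supp: "\<And>i. i \<ge> n \<Longrightarrow> co y i = 0" and y_norm: "norm y = 1"
    and y_deloc: "\<And>i. i < n \<Longrightarrow> (co y i)\<^sup>2 \<le> C / real n"
    and y_neg: "inner (op n M y) y < - \<upsilon>"
begin

lemma C_ge_1: "1 \<le> C"
proof -
  have "1 = (\<Sum>i<n. (co y i)\<^sup>2)"
    using inner_lt[of n y y] y_supp y_norm by (simp add: power2_norm_eq_inner[symmetric] power2_eq_square)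
  also have "\<dots> \<le> (\<Sum>i<n. C / real n)" by (intro sum_mono y_deloc) auto
  also have "\<dots> = C" using n by simp
  finally show ?thesis .
qed

lemma upsilon_le_K: "\<upsilon> \<le> K"
proof -
  have "\<bar>inner (op n M y) y\<bar> \<le> (\<Sum>i<n. (\<Sum>j<n. \<bar>M i j\<bar>) * (co y i)\<^sup>2)" by (rule quad_bound[OF Msym])
  also have "\<dots> \<le> (\<Sum>i<n. K * (co y i)\<^sup>2)" by (intro sum_mono mult_right_mono Mrow) auto
  also have "\<dots> = K * (\<Sum>i<n. (co y i)\<^sup>2)" by (simp add: sum_distrib_left)
  also have "\<dots> \<le> K * (norm y)\<^sup>2"
    using pos sum_co_sq_le[where n = n and z = y] by (intro mult_left_mono) (auto simp: power2_norm_eq_inner)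
  finally show ?thesis using y_neg y_norm by simp
qed

text \<open>Delocalization makes \<open>D\<close> cost at most K C \<gamma> \<le> \<upsilon>/8, and
  the weights \<open>w\<close> and \<open>v\<close> together at most \<upsilon>/4, so the weighted
  vector \<open>x\<close> keeps energy below -5\<upsilon>/8. The kernel of \<open>T\<close> can
  account for only a part of this. The extra weights \<open>v\<close> are 1 in the first use and the
  damping \<open>s\<close> in the second.\<close>

lemma captured:
  fixes v :: "nat \<Rightarrow> real"
  assumes v: "\<And>i. i < n \<Longrightarrow> 0 \<le> v i \<and> v i \<le> 1" and tot: "(\<Sum>i<n. 1 - v i) \<le> \<upsilon> * real n / (16 * \<kappa> * C)"
  shows "\<upsilon> / (4 * \<kappa>) \<le> (norm (T (dia n v y)))\<^sup>2"
proof -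
  define x where "x = dia n v y"
  let ?W = "\<lambda>i. w i * v i"
  have wv: "0 \<le> ?W i \<and> ?W i \<le> 1" if "i < n" for i
    using v[OF that] weight_bounds[OF that] by (auto intro: mult_le_one)
  have "\<bar>inner (op n D y) y\<bar> \<le> K * (\<Sum>q\<in>Q. (co y q)\<^sup>2)"
    by (rule supported_quad_bound[OF Dsym _ Drow Q]) (use Dsupp in blast)+
  also have "\<dots> \<le> K * (\<Sum>q\<in>Q. C / real n)"
    using pos Q by (intro mult_left_mono sum_mono y_deloc) auto
  also have "\<dots> = K * C / real n * real (card Q)" by simp
  also have "\<dots> \<le> K * C / real n * (\<gamma> * real n)" using pos by (intro mult_left_mono Qc) auto
  also have "\<dots> = K * C * \<gamma>" using n by simp
  also have "\<dots> \<le> K * C * (\<upsilon> / (8 * K * C))" using pos gamma by (intro mult_left_mono) auto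
  also have "\<dots> = \<upsilon> / 8" using pos by simp
  finally have "\<bar>inner (op n D y) y\<bar> \<le> \<upsilon> / 8" .
  moreover have "op n F y = op n M y + op n D y"
    by (rule fvec_eqI) (simp add: co_op co_simps distrib_right sum.distrib)
  ultimately have 1: "inner (op n F y) y < - \<upsilon> + \<upsilon> / 8" using y_neg by (simp add: inner_add_left)
  have "\<bar>inner (op n F y) y - inner (op n F (dia n ?W y)) (dia n ?W y)\<bar> \<le> 2 * (C / real n) * \<kappa> * (\<Sum>i<n. 1 - ?W i)"
  proof (rule delocalized_weight_change)
    show "(\<Sum>j<n. \<bar>F i j\<bar>) \<le> \<kappa>" if "i < n" for i using Frow[OF that] pos by linarith
  qed (use Msym Dsym y_deloc pos wv in auto)
  \<comment> \<open>Deficits of a product of weights add up. The summand 1 is the overshoot of the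
    last round.\<close>
  also have "\<dots> \<le> 2 * (C / real n) * \<kappa> * (\<upsilon> * real n / (32 * \<kappa> * C) + 1 + \<upsilon> * real n / (16 * \<kappa> * C))"
  proof (rule mult_left_mono)
    have "(\<Sum>i<n. 1 - ?W i) \<le> (\<Sum>i<n. (1 - w i) + (1 - v i))"
    proof (intro sum_mono)
      fix i assume "i \<in> {..<n}"
      then have "0 \<le> (1 - w i) * (1 - v i)" using v[of i] weight_bounds[of i] by (intro mult_nonneg_nonneg) auto
      then show "1 - ?W i \<le> (1 - w i) + (1 - v i)" by (simp add: algebra_simps)
    qed
    also have "\<dots> = (\<Sum>i<n. 1 - w i) + (\<Sum>i<n. 1 - v i)" by (rule sum.distrib)
    also have "\<dots> \<le> \<upsilon> * real n / (32 * \<kappa> * C) + 1 + \<upsilon> * real n / (16 * \<kappa> * C)"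
      using tot u_le pr unfolding progress_def by linarith
    finally show "(\<Sum>i<n. 1 - ?W i) \<le> \<upsilon> * real n / (32 * \<kappa> * C) + 1 + \<upsilon> * real n / (16 * \<kappa> * C)" .
  qed (use pos kappa_pos in auto)
  also have "\<dots> = 3 * \<upsilon> / 16 + 2 * C * \<kappa> / real n"
    using pos kappa_pos n by (simp add: field_simps)
  also have "2 * C * \<kappa> / real n \<le> \<upsilon> / 16"
    using large(3) pos n by (simp add: field_simps)
  finally have 2: "inner (op n F (dia n ?W y)) (dia n ?W y) < - (5 * \<upsilon> / 8)" using 1 by linarith
  have 3: "inner (op n (A w) x) x < - (5 * \<upsilon> / 8)"
    unfolding inner_op_weighted x_def dia_dia by (rule 2)
  let ?a = "T x" and ?z = "x - T x"
  have Ta: "T ?a = ?a" and Tz: "T ?z = 0" by (simp_all add: projector_idem[OF projector_T(1)] projector_diff[OF projector_T(1)])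
  have "(norm x)\<^sup>2 \<le> 1"
    using norm_dia_le[of n v y] v y_norm by (auto simp: x_def)
  moreover have "(norm x)\<^sup>2 = (norm ?a)\<^sup>2 + (norm ?z)\<^sup>2"
  proof -
    have "inner ?a ?z = 0" using projector_inner[OF projector_T(1), of x ?z] Tz by simp
    then show ?thesis using norm_sq_add_orthogonal[of ?a ?z] by simp
  qed
  ultimately have az: "(norm ?a)\<^sup>2 \<le> 1" "(norm ?z)\<^sup>2 \<le> 1"
    using zero_le_power2[of "norm ?a"] zero_le_power2[of "norm ?z"] by linarith+
  then have naz: "norm ?a \<le> 1" "norm ?z \<le> 1" by (simp_all only: abs_square_le_1 abs_norm_cancel)
  have sym: "inner (op n (A w) a) b = inner a (op n (A w) b)" for a b
    by (rule selfadj_inner, rule symopD(1), rule symop_op) (rule Asym)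
  have "op n (A w) x = op n (A w) ?a + op n (A w) ?z" by (simp add: linear_diff[OF linear_op])
  then have "inner (op n (A w) x) x = inner (op n (A w) ?a + op n (A w) ?z) (?a + ?z)" by simp
  also have "\<dots> = inner (op n (A w) ?a) ?a + 2 * inner (op n (A w) ?a) ?z + inner (op n (A w) ?z) ?z"
    using sym[of ?z ?a] by (simp only: inner_add_left inner_add_right inner_commute[of ?z "op n (A w) ?a"])
  finally have e: "inner (op n (A w) x) x =
    inner (op n (A w) ?a) ?a + 2 * inner (op n (A w) ?a) ?z + inner (op n (A w) ?z) ?z" .
  have "\<bar>inner (op n (A w) ?a) ?z\<bar> \<le> \<upsilon> / 32 * (norm ?a * norm ?z)"
    using spectral_T(3)[OF Ta Tz] by (simp add: mult.assoc)
  also have "\<dots> \<le> \<upsilon> / 32 * 1" using naz pos by (intro mult_left_mono mult_le_one) auto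
  finally have c: "\<bar>inner (op n (A w) ?a) ?z\<bar> \<le> \<upsilon> / 32" by simp
  have z: "inner (op n (A w) ?z) ?z \<ge> - (9 * \<upsilon> / 32)"
  proof -
    have "(9 * \<upsilon> / 32) * (norm ?z)\<^sup>2 \<le> (9 * \<upsilon> / 32) * 1" using az pos by (intro mult_left_mono) auto
    then show ?thesis using spectral_T(2)[OF Tz] unfolding mult_minus_left by linarith
  qed
  have a: "inner (op n (A w) ?a) ?a \<ge> - (\<kappa> * (norm ?a)\<^sup>2)"
  proof -
    have "(\<kappa> - \<upsilon>) * (norm ?a)\<^sup>2 \<le> \<kappa> * (norm ?a)\<^sup>2" using pos by (intro mult_right_mono) auto
    then show ?thesis using quad_A[OF weights_w, of ?a] by linarith
  qed
  \<comment> \<open>In units of \<upsilon>/32: of -20, the kernel part takes at most 9 and the two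
    cross terms at most 2, so the range part carries at least 9, more than \<upsilon>/4.\<close>
  have "\<upsilon> / 4 \<le> \<kappa> * (norm ?a)\<^sup>2" using 3 e c z a pos by linarith
  then show ?thesis using kappa_pos by (simp add: x_def field_simps)
qed

text \<open>With v = 1, \<open>captured\<close> excludes trace 0, so \<tau> > 0. With v = s the
  deficit is at most d/\<tau> = \<upsilon> n / (16 \<kappa> C^2), and \<open>C_ge_1\<close> makes
  this admissible; this fixes the value of \<tau>.\<close>

lemma output_captures: "1 / 96 * (\<upsilon> / K) \<le> (norm (T' y))\<^sup>2"
proof -
  have "trace_on n T \<noteq> 0"
  proof
    assume "trace_on n T = 0"
    then have "\<forall>i\<in>{..<n}. (norm (T (bv i)))\<^sup>2 = 0"
      unfolding projector_trace[OF projector_T(1)] by (subst (asm) sum_nonneg_eq_0_iff) auto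
    then have "T x = 0" for x by (subst symop_expand[OF projector_T(2)]) simp
    moreover have "\<upsilon> / (4 * \<kappa>) \<le> (norm (T (dia n (\<lambda>i. 1) y)))\<^sup>2"
      by (rule captured) (use pos kappa_pos in auto)
    ultimately show False using pos kappa_pos by (simp add: divide_le_0_iff)
  qed
  then have d: "1 \<le> trace_on n T" using trace_cases by simp
  have tau0: "\<tau> > 0" unfolding tau using d pos kappa_pos n by simp
  have "\<upsilon> / (4 * \<kappa>) \<le> (norm (T (dia n s y)))\<^sup>2"
  proof (rule captured)
    have "(\<Sum>i<n. 1 - s i) \<le> (\<Sum>i<n. co (T (bv i)) i / \<tau>)"
    proof (intro sum_mono)
      fix i assume "i \<in> {..<n}"
      then have "1 - s i = co (T (bv i)) i / (\<tau> + co (T (bv i)) i)"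
        using tau0 diag_nonneg[of i] by (simp add: s field_simps)
      also have "\<dots> \<le> co (T (bv i)) i / \<tau>"
        using tau0 diag_nonneg[of i] by (intro divide_left_mono) auto
      finally show "1 - s i \<le> co (T (bv i)) i / \<tau>" .
    qed
    also have "\<dots> = trace_on n T / \<tau>" by (simp add: trace_on_def sum_divide_distrib)
    also have "\<dots> = \<upsilon> * real n / (16 * \<kappa> * C\<^sup>2)" using d by (simp add: tau)
    also have "\<dots> \<le> \<upsilon> * real n / (16 * \<kappa> * C)"
      using C_ge_1 pos kappa_pos by (intro divide_left_mono mult_left_mono self_le_power) auto
    finally show "(\<Sum>i<n. 1 - s i) \<le> \<upsilon> * real n / (16 * \<kappa> * C)" .
  qed (rule damping_bounds)
  then have 1: "\<upsilon> / (4 * \<kappa>) \<le> inner (X y) y" by (simp add: smoothed(1))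
  let ?a = "T' y" and ?z = "y - T' y"
  have Tz: "T' ?z = 0" by (simp add: projector_idem[OF projector_T'(1)] projector_diff[OF projector_T'(1)])
  have lin: "linear X" and symX: "inner (X a) b = inner a (X b)" and posX: "0 \<le> inner (X a) a" for a b
    using smoothed(3) by (auto simp: psd_def selfadj_def)
  \<comment> \<open>The parallelogram identity replaces the cross term of \<open>?a\<close> and
    \<open>?z\<close> by a factor 2.\<close>
  have "0 \<le> inner (X (?a - ?z)) (?a - ?z)" by (rule posX)
  also have "\<dots> = 2 * inner (X ?a) ?a + 2 * inner (X ?z) ?z - inner (X (?a + ?z)) (?a + ?z)"
    by (simp only: linear_diff[OF lin] linear_add[OF lin] inner_add_left inner_add_right inner_diff_left
        inner_diff_right) simp
  finally have 2: "inner (X y) y \<le> 2 * inner (X ?a) ?a + 2 * inner (X ?z) ?z" by simp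
  have 3: "inner (X ?a) ?a \<le> (norm ?a)\<^sup>2"
    using smoothed(4) by simp
  have "(norm ?z)\<^sup>2 \<le> 1"
  proof -
    have "inner ?a ?z = 0" using projector_inner[OF projector_T'(1), of y ?z] Tz by simp
    then have "(norm y)\<^sup>2 = (norm ?a)\<^sup>2 + (norm ?z)\<^sup>2"
      using norm_sq_add_orthogonal[of ?a ?z] by simp
    moreover have "(norm y)\<^sup>2 = 1" by (simp add: y_norm)
    ultimately show ?thesis using zero_le_power2[of "norm ?a"] by linarith
  qed
  then have "3 * \<upsilon> / (32 * \<kappa>) * (norm ?z)\<^sup>2 \<le> 3 * \<upsilon> / (32 * \<kappa>) * 1"
    using pos kappa_pos by (intro mult_left_mono) auto
  then have 4: "inner (X ?z) ?z \<le> 3 * \<upsilon> / (32 * \<kappa>)" using spectral_T'(2)[OF Tz] by simp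
  have e: "\<upsilon> / (4 * \<kappa>) = 8 * (\<upsilon> / (32 * \<kappa>))" "3 * \<upsilon> / (32 * \<kappa>) = 3 * (\<upsilon> / (32 * \<kappa>))" by auto
  \<comment> \<open>In units of \<upsilon>/(32\<kappa>): 8 \<le> 2 |?a|^2 + 2 * 3. Then \<kappa>
    \<le> 3K gives the constant 1/96.\<close>
  have "\<upsilon> / (32 * \<kappa>) \<le> (norm ?a)\<^sup>2" using 1 2 3 4 unfolding e by linarith
  moreover have "1 / 96 * (\<upsilon> / K) \<le> \<upsilon> / (32 * \<kappa>)"
  proof -
    have "\<kappa> \<le> 3 * K" using kappa_le upsilon_le_K by linarith
    then have "\<upsilon> / (32 * (3 * K)) \<le> \<upsilon> / (32 * \<kappa>)"
      using pos kappa_pos by (intro divide_left_mono) auto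
    then show ?thesis by simp
  qed
  ultimately show ?thesis by linarith
qed

end

end

end

section \<open>The algorithm\<close>

text \<open>Array usage: 0 is the input matrix and the output, 1 and 2 hold \<open>C\<close> and \<open>\<upsilon>\<close>, 17 holds \<open>\<kappa>\<close>,
  column 0 of 18 the weights, 19 the trace of the current projection, 21 holds \<open>\<tau>\<close>.\<close>

definition kappa_prog :: prog where
  "kappa_prog = seqs [
    fill_abs 22 (el 0 1 2),
    fill_sum 23 (el 22 1 3),
    argmax 6 23,
    fill_exp 17 (RAdd (el0 2) (RElem 23 (NReg 6) (NConst 0)))]"

abbreviation weight_exp :: "vname \<Rightarrow> rexp" where
  "weight_exp x \<equiv> RElem 18 (NReg x) (NConst 0)"

definition shift_prog :: prog where
  "shift_prog = fill_exp 4 (RSub (RMul (el0 17) delta_exp) (RMul (RMul (weight_exp 1) (el 0 1 2)) (weight_exp 2)))"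

abbreviation threshold_exp :: "nat \<Rightarrow> rexp" where
  "threshold_exp k \<equiv> RAdd (el0 17) (RDiv (el0 2) (RNat (NConst k)))"

text \<open>The threshold \<kappa> + \<upsilon>/k for the shifted matrix means -\<upsilon>/k for the
  weighted one; k is 8 in the rounds and 4 at the end.\<close>

definition spectral_prog :: "nat \<Rightarrow> prog" where
  "spectral_prog k = seqs [shift_prog, fill_exp 5 (threshold_exp k), greedy_prog, fill_sum 19 (el 6 3 3)]"

definition round_prog :: prog where
  "round_prog = seqs [
    spectral_prog 8,
    fill_exp 20 (RMul (weight_exp 1) (RSub (RNat (NConst 1)) (RDiv (el 6 1 1) (el0 19)))),
    fill_exp 18 (el 20 1 2)]"

text \<open>A bounded loop cannot be left early, so the test turns all iterations after the intended
  number of rounds into no-ops.\<close>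

definition loop_body :: prog where
  "loop_body = PIf (RLess (RMul (RNat (NReg 7)) (RMul (RMul (RNat (NConst 32)) (el0 17)) (el0 1)))
    (RMul (el0 2) (RNat (NReg 0)))) round_prog PSkip"

text \<open>\<open>X\<close> is already positive semidefinite, so the greedy procedure applies
  without a shift. Register 0 still holds n, hence all columns of the projection are output as
  spanning vectors.\<close>

definition round_off_prog :: prog where
  "round_off_prog = seqs [
    fill_exp 21 (RDiv (RMul (RMul (RMul (RNat (NConst 16)) (el0 17)) (RMul (el0 1) (el0 1))) (el0 19))
      (RMul (el0 2) (RNat (NReg 0)))),
    fill_exp 20 (RDiv (el0 21) (RAdd (el0 21) (el 6 1 1))),
    fill_exp 4 (RMul (RMul (RElem 20 (NReg 1) (NConst 0)) (el 6 1 2)) (RElem 20 (NReg 2) (NConst 0))),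
    fill_exp 5 (RDiv (el0 2) (RMul (RNat (NConst 16)) (el0 17))),
    greedy_prog,
    fill_exp 0 (el 6 1 2)]"

definition main_prog :: prog where
  "main_prog = seqs [kappa_prog, fill_exp 18 (RNat (NConst 1)), PFor 7 loop_body, spectral_prog 4, round_off_prog]"

lemma kappa_prog_simps [simp]:
  "wreg kappa_prog = {1, 2, 3, 6}" "warr kappa_prog = {3, 17, 22, 23}" "wf_prog kappa_prog"
  by (auto simp: kappa_prog_def)

lemma spectral_prog_simps [simp]:
  "wreg (spectral_prog k) = {1, 2, 3, 4, 5, 6}"
  "warr (spectral_prog k) = {3, 4, 5, 6, 7, 8, 9, 10, 11, 12, 13, 14, 15, 16, 19}" "wf_prog (spectral_prog k)"
  by (auto simp: spectral_prog_def shift_prog_def)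

lemma round_prog_simps [simp]:
  "wreg round_prog = {1, 2, 3, 4, 5, 6}"
  "warr round_prog = {3, 4, 5, 6, 7, 8, 9, 10, 11, 12, 13, 14, 15, 16, 18, 19, 20}" "wf_prog round_prog"
  by (auto simp: round_prog_def)

lemma loop_body_simps [simp]:
  "wreg loop_body = {1, 2, 3, 4, 5, 6}"
  "warr loop_body = {3, 4, 5, 6, 7, 8, 9, 10, 11, 12, 13, 14, 15, 16, 18, 19, 20}" "wf_prog loop_body"
  by (auto simp: loop_body_def)

lemma main_prog_simps [simp]: "0 \<notin> wreg main_prog" "wf_prog main_prog"
  by (auto simp: main_prog_def round_off_prog_def)

text \<open>The first fact provides the margin for the shift; the second, attained at some row, is
  what bounds \<kappa> by 2K + \<upsilon>.\<close>

lemma kappa_prog_correct: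
  assumes n: "reg s 0 = n" "n > 0"
  defines "k \<equiv> arr (den kappa_prog s) 17 0 0"
  shows "\<And>i. i < n \<Longrightarrow> (\<Sum>j<n. \<bar>arr s 0 i j\<bar>) \<le> k - arr s 2 0 0"
    and "\<exists>i<n. k = arr s 2 0 0 + (\<Sum>j<n. \<bar>arr s 0 i j\<bar>)"
proof -
  define s1 where "s1 = den (fill_abs 22 (el 0 1 2)) s"
  define s2 where "s2 = den (fill_sum 23 (el 22 1 3)) s1"
  define s3 where "s3 = den (argmax 6 23) s2"
  have r: "reg s1 0 = n" "reg s2 0 = n" "reg s3 0 = n"
    using n by (simp_all add: s1_def s2_def s3_def den_frame)
  have 23: "arr s2 23 i 0 = (\<Sum>j<n. \<bar>arr s 0 i j\<bar>)" if "i < n" for i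
    using that r n by (simp add: s2_def arr_fill_sum s1_def arr_fill_abs)
  have k: "k = arr s 2 0 0 + arr s2 23 (reg s3 6) 0"
  proof -
    have "den kappa_prog s = den (fill_exp 17 (RAdd (el0 2) (RElem 23 (NReg 6) (NConst 0)))) s3"
      by (simp only: kappa_prog_def seqs.simps den.simps(1,4) s1_def s2_def s3_def)
    moreover have "arr s3 2 = arr s 2" "arr s3 23 = arr s2 23" by (simp_all add: s3_def s2_def s1_def den_frame)
    ultimately show ?thesis using n r by (simp add: k_def arr_fill_exp)
  qed
  have b: "reg s3 6 < n" using argmax(1)[of 6 s2 23] r n by (simp add: s3_def)
  then show "\<exists>i<n. k = arr s 2 0 0 + (\<Sum>j<n. \<bar>arr s 0 i j\<bar>)"
    using k 23 by (intro exI[of _ "reg s3 6"]) simp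
  show "(\<Sum>j<n. \<bar>arr s 0 i j\<bar>) \<le> k - arr s 2 0 0" if "i < n" for i
    using argmax(2)[of 6 s2 i 23] r n that 23[OF that] by (simp add: s3_def k)
qed

context corrupted
begin

definition represents :: "store \<Rightarrow> bool" where
  "represents t \<longleftrightarrow> reg t 0 = n \<and> (\<forall>i<n. \<forall>j<n. arr t 0 i j = F i j) \<and>
    arr t 1 0 0 = C \<and> arr t 2 0 0 = \<upsilon> \<and> arr t 17 0 0 = \<kappa>"

abbreviation weights_of :: "store \<Rightarrow> nat \<Rightarrow> real" where
  "weights_of t \<equiv> \<lambda>i. arr t 18 i 0"

lemma represents_frame:
  "represents t \<Longrightarrow> warr p \<inter> {0, 1, 2, 17} = {} \<Longrightarrow> 0 \<notin> wreg p \<Longrightarrow> represents (den p t)"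
  by (auto simp: represents_def den_frame)

lemma spectral_prog_correct:
  assumes t: "represents t" and w: "weights (weights_of t)" and k: "k > 0"
  defines "t' \<equiv> den (spectral_prog k) t"
  shows "greedy_inv n (op n (shifted (weights_of t))) (\<kappa> + \<upsilon> / real k) \<epsilon> (2 * \<kappa> * sqrt \<epsilon>) n (op n (arr t' 6))"
    and "arr t' 19 0 0 = trace_on n (op n (arr t' 6))"
    and "weights_of t' = weights_of t" "represents t'"
proof -
  define s1 where "s1 = den shift_prog t"
  define s2 where "s2 = den (fill_exp 5 (threshold_exp k)) s1"
  define s3 where "s3 = den greedy_prog s2"
  have t': "t' = den (fill_sum 19 (el 6 3 3)) s3"
    by (simp add: t'_def spectral_prog_def s1_def s2_def s3_def)
  have r: "reg t 0 = n" "reg s1 0 = n" "reg s2 0 = n" "reg s3 0 = n"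
    using t by (simp_all add: represents_def s1_def s2_def s3_def shift_prog_def den_frame)
  have "arr s1 4 i j = shifted (weights_of t) i j" if "i < n" "j < n" for i j
    using t that r by (auto simp: represents_def s1_def shift_prog_def arr_fill_exp)
  then have B: "op n (arr s2 4) = op n (shifted (weights_of t))"
    by (intro op_cong) (simp add: s2_def den_frame)
  have beta: "arr s2 5 0 0 = \<kappa> + \<upsilon> / real k"
    using t r n by (simp add: s2_def arr_fill_exp) (simp add: represents_def s1_def shift_prog_def den_frame)
  have "greedy_inv n (op n (arr s2 4)) (arr s2 5 0 0) \<epsilon> (2 * \<kappa> * sqrt \<epsilon>) n (op n (arr (den greedy_prog s2) 6))"
  proof (rule greedy_prog_correct[OF r(3) n _ _ _ _ eps refl])
    show "0 < arr s2 5 0 0" unfolding beta using kappa_pos pos by (intro add_pos_nonneg) auto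
  qed (use shifted_bounds[OF w] symop_shifted B in auto)
  moreover have 6: "arr t' 6 = arr (den greedy_prog s2) 6" by (simp add: t' s3_def den_frame)
  ultimately show "greedy_inv n (op n (shifted (weights_of t))) (\<kappa> + \<upsilon> / real k) \<epsilon> (2 * \<kappa> * sqrt \<epsilon>) n (op n (arr t' 6))"
    by (simp add: B beta)
  show "arr t' 19 0 0 = trace_on n (op n (arr t' 6))"
    unfolding trace_op 6 using r n by (simp add: t' arr_fill_sum s3_def)
  show "weights_of t' = weights_of t" "represents t'"
    using represents_frame[OF t] by (simp_all add: t'_def den_frame)
qed

lemma round_prog_correct:
  assumes t: "represents t" and pr: "progress u (weights_of t)"
  shows "progress (Suc u) (weights_of (den round_prog t))"
proof -
  let ?e = "RMul (weight_exp 1) (RSub (RNat (NConst 1)) (RDiv (el 6 1 1) (el0 19)))"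
  define s1 where "s1 = den (spectral_prog 8) t"
  define s2 where "s2 = den (fill_exp 20 ?e) s1"
  have w: "weights (weights_of t)" using pr by (simp add: progress_def)
  note sp = spectral_prog_correct[OF t w, of 8, folded s1_def]
  have r: "reg s1 0 = n" "reg s2 0 = n" using sp(4) by (simp_all add: represents_def s2_def den_frame)
  have "den round_prog t = den (fill_exp 18 (el 20 1 2)) s2" by (simp add: round_prog_def s1_def s2_def)
  then have e: "arr (den round_prog t) 18 i 0 = arr t 18 i 0 * (1 - arr s1 6 i i / arr s1 19 0 0)" if "i < n" for i
    using that r n sp(3) by (simp add: arr_fill_exp s2_def fun_eq_iff)
  show ?thesis
  proof (rule progress_step[OF pr])
    show "greedy_inv n (op n (shifted (weights_of t))) (\<kappa> + \<upsilon> / 8) \<epsilon> (2 * \<kappa> * sqrt \<epsilon>) n (op n (arr s1 6))"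
      using sp(1) by simp
    show "arr (den round_prog t) 18 i 0 =
        arr t 18 i 0 * (1 - co (op n (arr s1 6) (bv i)) i / trace_on n (op n (arr s1 6)))" if "i < n" for i
      using e[OF that] sp(2) that by (simp add: co_op_bv)
  qed
qed

text \<open>\<open>u\<close> counts the rounds actually performed, as opposed to iterations. Its
  lower bound exhausts the weight of \<open>Q\<close>, its upper bound limits the damage to
  delocalized vectors.\<close>

lemma loop_correct:
  assumes s: "represents s" and w: "\<And>i. i < n \<Longrightarrow> weights_of s i = 1"
  defines "t \<equiv> den (PFor 7 loop_body) s"
  shows "represents t" and "\<exists>u. progress u (weights_of t) \<and>
    (real n \<le> real u \<or> \<upsilon> * real n \<le> real u * (32 * \<kappa> * C)) \<and> real u \<le> \<upsilon> * real n / (32 * \<kappa> * C) + 1"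
proof -
  let ?c = "32 * \<kappa> * C"
  have c: "?c > 0" using kappa_pos pos by simp
  \<comment> \<open>The last conjunct comes from the test before the most recent round, when the
    counter was u - 1.\<close>
  define I where "I = (\<lambda>m (t :: store). represents t \<and> (\<exists>u. progress u (weights_of t) \<and>
    (u = m \<or> u \<le> m \<and> \<upsilon> * real n \<le> real u * ?c) \<and> (u = 0 \<or> (real u - 1) * ?c < \<upsilon> * real n)))"
  have rs: "reg s 0 = n" using s by (simp add: represents_def)
  have "I (reg s 0) (den (PFor 7 loop_body) s)"
  proof (rule for_inv)
    have "progress 0 (weights_of s)" by (rule progress_0) (rule w)
    then show "I 0 (set_reg 7 0 s)" using s by (auto simp: I_def represents_def)
    fix m t
    assume m: "m < reg s 0" "reg t 0 = reg s 0" "reg t 7 = m" "I m t"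
    then obtain u where t: "represents t" and u: "progress u (weights_of t)"
      "u = m \<or> u \<le> m \<and> \<upsilon> * real n \<le> real u * ?c" "u = 0 \<or> (real u - 1) * ?c < \<upsilon> * real n"
      by (auto simp: I_def)
    have test: "bval (RLess (RMul (RNat (NReg 7)) (RMul (RMul (RNat (NConst 32)) (el0 17)) (el0 1)))
        (RMul (el0 2) (RNat (NReg 0)))) t \<longleftrightarrow> real m * ?c < \<upsilon> * real n"
      using t m rs by (simp add: represents_def)
    show "I (Suc m) (set_reg 7 (Suc m) (den loop_body t))"
    proof (cases "real m * ?c < \<upsilon> * real n")
      case True
      have "real u * ?c \<le> real m * ?c" if "u \<le> m"
        by (intro mult_right_mono) (use that c in auto)
      then have "u = m" using u(2) True by linarith
      then have "progress (Suc m) (weights_of (den round_prog t))" using round_prog_correct[OF t u(1)] by simp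
      moreover have "den loop_body t = den round_prog t" using test True by (simp only: loop_body_def den.simps if_True)
      moreover have "represents (den round_prog t)" by (rule represents_frame[OF t]) auto
      ultimately show ?thesis using True unfolding I_def
        by (intro conjI exI[of _ "Suc m"]) (auto simp: represents_def)
    next
      case False
      then have "den loop_body t = t" using test by (simp only: loop_body_def den.simps if_False)
      moreover have "u \<le> Suc m \<and> \<upsilon> * real n \<le> real u * ?c" using u(2) False by auto
      ultimately show ?thesis using t u unfolding I_def
        by (intro conjI exI[of _ u]) (auto simp: represents_def)
    qed
  qed auto
  then have "I n t" using rs by (simp add: t_def)
  then obtain u where u: "progress u (weights_of t)"
      "u = n \<or> u \<le> n \<and> \<upsilon> * real n \<le> real u * ?c" "u = 0 \<or> (real u - 1) * ?c < \<upsilon> * real n"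
    and "represents t" by (auto simp: I_def)
  then show "represents t" by simp
  have "real u \<le> \<upsilon> * real n / ?c + 1"
    using u(3)
  proof
    assume "u = 0"
    then show ?thesis using c pos by simp
  next
    assume "(real u - 1) * ?c < \<upsilon> * real n"
    then have "real u - 1 < \<upsilon> * real n / ?c" using c by (simp only: pos_less_divide_eq)
    then show ?thesis by simp
  qed
  then show "\<exists>u. progress u (weights_of t) \<and>
    (real n \<le> real u \<or> \<upsilon> * real n \<le> real u * (32 * \<kappa> * C)) \<and> real u \<le> \<upsilon> * real n / (32 * \<kappa> * C) + 1"
    using u by auto
qed

lemma output_correct:
  assumes s: "represents s" and w: "\<And>i. i < n \<Longrightarrow> weights_of s i = 1"
    and Qc: "real (card Q) \<le> \<gamma> * real n"
    and gamma: "\<gamma> < 3 * \<upsilon> / (64 * K) * min 1 (\<upsilon> / (32 * (2 * K + \<upsilon>) * C))" "\<gamma> \<le> \<upsilon> / (8 * K * C)"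
  defines "T' \<equiv> op n (arr (den (seqs [PFor 7 loop_body, spectral_prog 4, round_off_prog]) s) 0)"
  shows "projector T'"
    and "\<exists>gs. real (length gs) \<le> 768 * (K / \<upsilon> * real r) \<and> (\<forall>x. T' x = (\<Sum>g\<leftarrow>gs. (inner x g / inner g g) *\<^sub>R g)) \<and>
      (\<forall>g\<in>set gs. T' g = g \<and> (\<forall>i\<ge>n. co g i = 0))"
    and "i < n \<Longrightarrow> co (T' (bv i)) i \<le> 2949120 * (C\<^sup>2 * K ^ 3 / \<upsilon> ^ 3 * (real r / real n))"
    and "\<lbrakk>\<And>i. i \<ge> n \<Longrightarrow> co y i = 0; norm y = 1; \<And>i. i < n \<Longrightarrow> (co y i)\<^sup>2 \<le> C / real n;
      inner (op n M y) y < - \<upsilon>\<rbrakk> \<Longrightarrow> 1 / 96 * (\<upsilon> / K) \<le> (norm (T' y))\<^sup>2"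
proof -
  define s1 where "s1 = den (PFor 7 loop_body) s"
  define s2 where "s2 = den (spectral_prog 4) s1"
  define s3 where "s3 = den (fill_exp 21 (RDiv (RMul (RMul (RMul (RNat (NConst 16)) (el0 17)) (RMul (el0 1) (el0 1))) (el0 19))
      (RMul (el0 2) (RNat (NReg 0))))) s2"
  define s4 where "s4 = den (fill_exp 20 (RDiv (el0 21) (RAdd (el0 21) (el 6 1 1)))) s3"
  define s5 where "s5 = den (fill_exp 4 (RMul (RMul (RElem 20 (NReg 1) (NConst 0)) (el 6 1 2)) (RElem 20 (NReg 2) (NConst 0)))) s4"
  define s6 where "s6 = den (fill_exp 5 (RDiv (el0 2) (RMul (RNat (NConst 16)) (el0 17)))) s5"
  define s7 where "s7 = den greedy_prog s6"
  have den: "den (seqs [PFor 7 loop_body, spectral_prog 4, round_off_prog]) s = den (fill_exp 0 (el 6 1 2)) s7"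
    by (simp only: seqs.simps round_off_prog_def den.simps(1,4) s1_def s2_def s3_def s4_def s5_def s6_def s7_def)
  have rep1: "represents s1" unfolding s1_def by (rule loop_correct(1)[OF s w])
  obtain u where u: "progress u (weights_of s1)" "real n \<le> real u \<or> \<upsilon> * real n \<le> real u * (32 * \<kappa> * C)"
    "real u \<le> \<upsilon> * real n / (32 * \<kappa> * C) + 1"
    using loop_correct(2)[OF s w] unfolding s1_def by blast
  have ww: "weights (weights_of s1)" using u(1) by (simp add: progress_def)
  define T where "T = op n (arr s2 6)"
  have inv: "greedy_inv n (op n (shifted (weights_of s1))) (\<kappa> + \<upsilon> / 4) \<epsilon> (2 * \<kappa> * sqrt \<epsilon>) n T"
    and tr: "arr s2 19 0 0 = trace_on n T" and rep2: "represents s2"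
    using spectral_prog_correct[OF rep1 ww, of 4] by (simp_all add: T_def s2_def)
  have r: "reg s2 0 = n" "reg s3 0 = n" "reg s4 0 = n" "reg s5 0 = n" "reg s6 0 = n" "reg s7 0 = n"
    using rep2 by (simp_all add: represents_def s3_def s4_def s5_def s6_def s7_def den_frame)
  define \<tau> where "\<tau> = 16 * \<kappa> * C\<^sup>2 * trace_on n T / (\<upsilon> * real n)"
  have tau: "arr s3 21 0 0 = \<tau>"
    using r n rep2 by (simp add: s3_def arr_fill_exp tr \<tau>_def represents_def power2_eq_square)
  have 6: "arr s3 6 = arr s2 6" "arr s4 6 = arr s2 6" by (simp_all add: s3_def s4_def den_frame)
  define z where "z = (\<lambda>i. arr s4 20 i 0)"
  have z: "z i = \<tau> / (\<tau> + co (T (bv i)) i)" if "i < n" for i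
    using r n that by (simp add: z_def s4_def arr_fill_exp tau 6 T_def co_op_bv)
  define X where "X = op n (\<lambda>i j. z i * arr s2 6 i j * z j)"
  have X: "op n (arr s6 4) = X"
    unfolding X_def by (rule op_cong) (use r in \<open>simp add: s6_def s5_def den_frame arr_fill_exp z_def 6\<close>)
  have beta: "arr s6 5 0 0 = \<upsilon> / (16 * \<kappa>)"
    using r n rep2 by (simp add: s6_def arr_fill_exp) (simp add: represents_def s5_def s4_def s3_def den_frame)
  have T: "projector T" "symop n T" using inv by (auto simp: greedy_inv_def)
  have t0: "0 \<le> co (T (bv i)) i" for i by (simp add: projector_diag[OF T(1)])
  have tau0: "0 \<le> \<tau>" unfolding \<tau>_def using kappa_pos pos t0
    by (intro divide_nonneg_nonneg mult_nonneg_nonneg) (auto simp: trace_on_def intro: sum_nonneg)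
  have z01: "0 \<le> z i \<and> z i \<le> 1" if "i < n" for i
    using tau0 t0[of i] that by (auto simp: z divide_le_eq_1)
  note sb = smoothed_bounds[where s = z, OF T T_def[symmetric] z01, folded X_def]
  have "greedy_inv n (op n (arr s6 4)) (arr s6 5 0 0) \<epsilon> (1 * sqrt \<epsilon>) n (op n (arr (den greedy_prog s6) 6))"
  proof (rule greedy_prog_correct[OF r(5) n _ _ _ _ eps refl])
    show "0 < arr s6 5 0 0" unfolding beta using kappa_pos pos by simp
  qed (use sb in \<open>auto simp: X\<close>)
  moreover have T': "op n (arr (den greedy_prog s6) 6) = T'"
    unfolding T'_def den by (rule op_cong) (use r in \<open>simp add: arr_fill_exp s7_def\<close>)
  ultimately have inv': "greedy_inv n X (\<upsilon> / (16 * \<kappa>)) \<epsilon> (sqrt \<epsilon>) n T'" by (simp add: X beta)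
  note ctx = u Qc gamma inv T_def[symmetric] \<tau>_def z X_def inv'
  show "projector T'" using inv' by (simp add: greedy_inv_def)
  show "co (T' (bv i)) i \<le> 2949120 * (C\<^sup>2 * K ^ 3 / \<upsilon> ^ 3 * (real r / real n))" if "i < n"
    by (rule output_diag[OF ctx that])
  show "1 / 96 * (\<upsilon> / K) \<le> (norm (T' y))\<^sup>2"
    if "\<And>i. i \<ge> n \<Longrightarrow> co y i = 0" "norm y = 1" "\<And>i. i < n \<Longrightarrow> (co y i)\<^sup>2 \<le> C / real n" "inner (op n M y) y < - \<upsilon>"
    by (rule output_captures[OF ctx that])
  obtain gs where gs: "trace_on n T' = real (length gs)" "\<forall>x. T' x = (\<Sum>g\<leftarrow>gs. (inner x g / inner g g) *\<^sub>R g)"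
      "\<forall>g\<in>set gs. T' g = g \<and> (\<forall>i\<ge>n. co g i = 0)"
    using inv' unfolding greedy_inv_def by auto
  moreover have "trace_on n T' \<le> 768 * (K / \<upsilon> * real r)" by (rule output_dim[OF ctx])
  ultimately show "\<exists>gs. real (length gs) \<le> 768 * (K / \<upsilon> * real r) \<and>
      (\<forall>x. T' x = (\<Sum>g\<leftarrow>gs. (inner x g / inner g g) *\<^sub>R g)) \<and> (\<forall>g\<in>set gs. T' g = g \<and> (\<forall>i\<ge>n. co g i = 0))"
    by (intro exI[of _ gs]) auto
qed

end

text \<open>The bound 2K + \<upsilon> replaces \<kappa>, which depends on the matrices, so that one
  sequence \<delta> serves all inputs of a given dimension.\<close>

definition large_enough :: "real \<Rightarrow> real \<Rightarrow> real \<Rightarrow> nat \<Rightarrow> bool" where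
  "large_enough C \<upsilon> K n \<longleftrightarrow> n > 0 \<and>
    (real n)\<^sup>2 * sqrt (real n / real (2 * 2 ^ n)) \<le> \<upsilon> / (64 * (2 * K + \<upsilon>)) \<and>
    (real n)\<^sup>2 * sqrt (real n / real (2 * 2 ^ n)) \<le> 8 * C\<^sup>2 \<and> 32 * C * (2 * K + \<upsilon>) / \<upsilon> \<le> real n"

lemma eventually_large_enough:
  assumes "C > 0" "\<upsilon> > 0" "K > 0"
  shows "eventually (large_enough C \<upsilon> K) sequentially"
proof -
  have lim: "(\<lambda>n :: nat. (real n)\<^sup>2 * sqrt (real n / real (2 * 2 ^ n))) \<longlonglongrightarrow> 0"
    by (simp, real_asymp)
  have "eventually (\<lambda>n. (real n)\<^sup>2 * sqrt (real n / real (2 * 2 ^ n)) < \<upsilon> / (64 * (2 * K + \<upsilon>))) sequentially"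
    by (rule order_tendstoD[OF lim]) (use assms in simp)
  moreover have "eventually (\<lambda>n. (real n)\<^sup>2 * sqrt (real n / real (2 * 2 ^ n)) < 8 * C\<^sup>2) sequentially"
    by (rule order_tendstoD[OF lim]) (use assms in simp)
  moreover have "eventually (\<lambda>n. 32 * C * (2 * K + \<upsilon>) / \<upsilon> \<le> real n) sequentially"
    using filterlim_real_sequentially by (simp add: filterlim_at_top)
  moreover have "eventually (\<lambda>n :: nat. n > 0) sequentially" by (rule eventually_gt_at_top)
  ultimately show ?thesis by eventually_elim (simp add: large_enough_def)
qed

definition captures :: "nat \<Rightarrow> nat \<Rightarrow> real mat \<Rightarrow> real \<Rightarrow> real \<Rightarrow> real \<Rightarrow> config \<Rightarrow> bool" where
  "captures n r M C \<upsilon> K c \<longleftrightarrow> (let U = output_space n c in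
    real (subspace_dim n U) \<le> 768 * (K / \<upsilon> * real r) \<and>
    (\<exists>P. orth_projection n U P \<and>
      (\<forall>i<n. P $$ (i, i) \<le> 2949120 * (C\<^sup>2 * K ^ 3 / \<upsilon> ^ 3 * (real r / real n))) \<and>
      (\<forall>y \<in> carrier_vec n.
        y \<bullet> y = 1 \<and> delocalized n C y \<and> y \<bullet> (M *\<^sub>v y) < - \<upsilon> \<longrightarrow> y \<bullet> (P *\<^sub>v y) \<ge> 1 / 96 * (\<upsilon> / K))))"

lemma output_of_run:
  fixes M D :: "real mat"
  assumes pos: "C > 0" "\<upsilon> > 0" "K > 0" and n: "large_enough C \<upsilon> K n"
    and M: "symmetric_mat n M" "num_neg_eigenvalues M \<le> r" "rows_cols_l1_le n K M"
    and D: "symmetric_mat n D" "rows_cols_l1_le n K D" "supported_on n Q D"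
    and Qn: "Q \<subseteq> {..<n}" "real (card Q) \<le> \<gamma> * real n"
    and gamma: "\<gamma> < 3 * \<upsilon> / (64 * K) * min 1 (\<upsilon> / (32 * (2 * K + \<upsilon>) * C))" "\<gamma> \<le> \<upsilon> / (8 * K * C)"
  defines "c \<equiv> ([], den main_prog (input_store n (M + D) C \<upsilon>))"
  shows "captures n r M C \<upsilon> K c"
proof -
  have Mc: "M \<in> carrier_mat n n" and Dc: "D \<in> carrier_mat n n" using M D by (auto simp: symmetric_mat_def)
  have sym: "B $$ (i, j) = B $$ (j, i)" if "symmetric_mat n B" "i < n" "j < n" for B :: "real mat" and i j
  proof -
    have "B \<in> carrier_mat n n" "transpose_mat B = B" using that by (auto simp: symmetric_mat_def)
    moreover from this have "transpose_mat B $$ (i, j) = B $$ (j, i)"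
      using that by (intro index_transpose_mat) auto
    ultimately show ?thesis by simp
  qed
  have n0: "n > 0" using n by (simp add: large_enough_def)
  define s0 where "s0 = input_store n (M + D) C \<upsilon>"
  have r0: "reg s0 0 = n" by (simp add: s0_def input_store_def)
  have a0: "arr s0 0 i j = M $$ (i, j) + D $$ (i, j)" if "i < n" "j < n" for i j
    using that Mc Dc by (simp add: s0_def input_store_def)
  have a12: "arr s0 1 0 0 = C" "arr s0 2 0 0 = \<upsilon>" by (simp_all add: s0_def input_store_def)
  define \<kappa> where "\<kappa> = arr (den kappa_prog s0) 17 0 0"
  have rowM: "(\<Sum>j<n. \<bar>M $$ (i, j)\<bar>) \<le> K" and rowD: "(\<Sum>j<n. \<bar>D $$ (i, j)\<bar>) \<le> K" if "i < n" for i
    using M(3) D(2) that by (auto simp: rows_cols_l1_le_def)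
  have e: "(\<Sum>j<n. \<bar>arr s0 0 i j\<bar>) = (\<Sum>j<n. \<bar>M $$ (i, j) + D $$ (i, j)\<bar>)" if "i < n" for i
    using that a0 by simp
  have krow: "(\<Sum>j<n. \<bar>M $$ (i, j) + D $$ (i, j)\<bar>) \<le> \<kappa> - \<upsilon>" if "i < n" for i
    using kappa_prog_correct(1)[OF r0 n0 that] a12 e[OF that] by (simp add: \<kappa>_def)
  obtain i where i: "i < n" "\<kappa> = \<upsilon> + (\<Sum>j<n. \<bar>M $$ (i, j) + D $$ (i, j)\<bar>)"
    using kappa_prog_correct(2)[OF r0 n0] a12 e by (auto simp: \<kappa>_def)
  have "(\<Sum>j<n. \<bar>M $$ (i, j) + D $$ (i, j)\<bar>) \<le> (\<Sum>j<n. \<bar>M $$ (i, j)\<bar> + \<bar>D $$ (i, j)\<bar>)"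
    by (intro sum_mono abs_triangle_ineq)
  also have "\<dots> \<le> 2 * K" using rowM[OF i(1)] rowD[OF i(1)] by (simp add: sum.distrib)
  finally have kK: "\<kappa> \<le> 2 * K + \<upsilon>" using i by simp
  have kpos: "\<kappa> > 0" using i pos by (simp add: add_pos_nonneg sum_nonneg)
  obtain vs where vs: "length vs = num_neg_eigenvalues M"
    "\<And>x. (\<forall>g\<in>set vs. inner x g = 0) \<Longrightarrow> 0 \<le> inner (op n (\<lambda>i j. M $$ (i, j)) x) x"
    using psd_on_complement_fvec[OF M(1)] by blast
  let ?\<epsilon> = "real n / real (2 * 2 ^ n)"
  interpret corrupted n "\<lambda>i j. M $$ (i, j)" "\<lambda>i j. D $$ (i, j)" Q K \<upsilon> C \<kappa> ?\<epsilon> r vs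
  proof
    have "\<upsilon> / (64 * (2 * K + \<upsilon>)) \<le> \<upsilon> / (64 * \<kappa>)" using kK kpos pos by (intro divide_left_mono) auto
    then show "(real n)\<^sup>2 * sqrt ?\<epsilon> \<le> \<upsilon> / (64 * \<kappa>)" using n by (simp add: large_enough_def)
    have "32 * C * \<kappa> / \<upsilon> \<le> 32 * C * (2 * K + \<upsilon>) / \<upsilon>"
      using kK pos by (intro divide_right_mono mult_left_mono) auto
    then show "32 * C * \<kappa> / \<upsilon> \<le> real n" using n by (simp add: large_enough_def)
    show "(real n)\<^sup>2 * sqrt ?\<epsilon> \<le> 8 * C\<^sup>2" using n by (simp add: large_enough_def)
    show "i \<in> Q" if "i < n" "j < n" "D $$ (i, j) \<noteq> 0" for i j
      using D(3) that by (auto simp: supported_on_def)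
  qed (use n0 sym M D Qn rowM rowD vs pos krow kK in auto)
  define s1 where "s1 = den (fill_exp 18 (RNat (NConst 1))) (den kappa_prog s0)"
  have rep: "represents s1"
    unfolding represents_def s1_def using r0 a0 a12 by (simp add: den_frame \<kappa>_def)
  have w1: "weights_of s1 i = 1" if "i < n" for i
    using that r0 n0 by (simp add: s1_def arr_fill_exp den_frame)
  have c: "snd c = den (seqs [PFor 7 loop_body, spectral_prog 4, round_off_prog]) s1"
    by (simp only: c_def main_prog_def seqs.simps den.simps(1,4) s1_def s0_def snd_conv)
  define TF where "TF = arr (snd c) 0"
  note out = output_correct[OF rep w1 Qn(2) gamma, folded c, folded TF_def]
  obtain gs where gs: "real (length gs) \<le> 768 * (K / \<upsilon> * real r)"
    "\<And>x. op n TF x = (\<Sum>g\<leftarrow>gs. (inner x g / inner g g) *\<^sub>R g)"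
    "\<And>g. g \<in> set gs \<Longrightarrow> op n TF g = g" "\<And>g i. g \<in> set gs \<Longrightarrow> i \<ge> n \<Longrightarrow> co g i = 0"
    using out(2) by blast
  have "reg (snd c) 0 = n"
    using den_frame(1)[of 0 main_prog s0] r0 by (simp add: c_def s0_def)
  then have om: "output_mat n c = mat n n (\<lambda>(i, j). TF i j)"
    by (simp add: output_mat_def TF_def)
  let ?P = "mat n n (\<lambda>(i, j). TF i j)" and ?U = "output_space n c"
  have "projector (op n TF)" using out(1) by blast
  note sp = subspace_of_projector[OF refl this, of gs]
  have sub: "orth_projection n ?U ?P" "subspace_dim n ?U \<le> length gs"
    "\<And>y. y \<in> carrier_vec n \<Longrightarrow> y \<bullet> (?P *\<^sub>v y) = (norm (op n TF (fv n y)))\<^sup>2"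
    unfolding output_space_def om using sp gs(2,3,4) by blast+
  have 1: "real (subspace_dim n ?U) \<le> 768 * (K / \<upsilon> * real r)"
    using sub(2) gs(1) by linarith
  have 2: "\<forall>i<n. ?P $$ (i, i) \<le> 2949120 * (C\<^sup>2 * K ^ 3 / \<upsilon> ^ 3 * (real r / real n))"
    using out(3) by (simp add: co_op_bv)
  have 3: "1 / 96 * (\<upsilon> / K) \<le> y \<bullet> (?P *\<^sub>v y)"
    if y: "y \<in> carrier_vec n" "y \<bullet> y = 1" "delocalized n C y" "y \<bullet> (M *\<^sub>v y) < - \<upsilon>" for y
  proof -
    have "1 / 96 * (\<upsilon> / K) \<le> (norm (op n TF (fv n y)))\<^sup>2"
    proof (rule out(4))
      show "co (fv n y) i = 0" if "i \<ge> n" for i using that by (simp add: co_fv)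
      show "norm (fv n y) = 1" using y by (simp add: norm_eq_sqrt_inner inner_fv)
      show "(co (fv n y) i)\<^sup>2 \<le> C / real n" if "i < n" for i
        using y that by (simp add: co_fv delocalized_def)
      have "inner (op n (\<lambda>i j. M $$ (i, j)) (fv n y)) (fv n y) = y \<bullet> (M *\<^sub>v y)"
        using y Mc by (simp add: op_fv inner_commute inner_fv)
      then show "inner (op n (\<lambda>i j. M $$ (i, j)) (fv n y)) (fv n y) < - \<upsilon>" using y by simp
    qed
    then show ?thesis using sub(3)[OF y(1)] by simp
  qed
  show ?thesis
    unfolding captures_def Let_def
    using 1 2 3 sub(1) by (intro conjI exI[of _ ?P]) auto
qed

theorem mainTheorem3:
  shows "\<exists>(alg :: cmd) (q :: nat poly) (a\<^sub>1 :: real) (a\<^sub>2 :: real) (a\<^sub>3 :: real).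
    a\<^sub>1 > 0 \<and> a\<^sub>2 > 0 \<and> a\<^sub>3 > 0 \<and> runs_within alg q \<and>
    (\<forall>C > 0. \<forall>\<upsilon> > 0. \<forall>K > 0. \<exists>\<gamma>\<^sub>0 > 0. \<forall>\<gamma>. 0 < \<gamma> \<and> \<gamma> \<le> \<gamma>\<^sub>0 \<longrightarrow>
      (\<exists>\<delta> :: nat \<Rightarrow> real. \<delta> \<longlonglongrightarrow> 0 \<and>
        (\<forall>(n :: nat) (r :: nat) (M :: real mat) (D :: real mat) (Q :: nat set).
          symmetric_mat n M \<and> num_neg_eigenvalues M \<le> r \<and>
          symmetric_mat n D \<and> Q \<subseteq> {..<n} \<and> real (card Q) \<le> \<gamma> * real n \<and>
          supported_on n Q D \<and>
          rows_cols_l1_le n K M \<and> rows_cols_l1_le n K D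
          \<longrightarrow>
          measure_pmf.prob (run alg (poly q n) n (M + D) C \<upsilon>)
            {c. let U = output_space n c in
                real (subspace_dim n U) \<le> a\<^sub>1 * (K / \<upsilon> * real r) \<and>
                (\<exists>P. orth_projection n U P \<and>
                  (\<forall>i<n. P $$ (i, i) \<le> a\<^sub>2 * (C\<^sup>2 * K ^ 3 / \<upsilon> ^ 3 * (real r / real n))) \<and>
                  (\<forall>y \<in> carrier_vec n.
                    y \<bullet> y = 1 \<and> delocalized n C y \<and> y \<bullet> (M *\<^sub>v y) < - \<upsilon> \<longrightarrow>
                    y \<bullet> (P *\<^sub>v y) \<ge> a\<^sub>3 * (\<upsilon> / K)))}
            \<ge> 1 - \<delta> n)))"
proof -
  obtain q :: "nat poly" where q: "\<forall>n. time main_prog n = poly q n" using time_poly by blast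
  have run: "run (compile main_prog) (poly q n) n A C \<upsilon> = return_pmf ([], den main_prog (input_store n A C \<upsilon>))" for n A C \<upsilon>
    by (rule run_compile[OF main_prog_simps(2,1) q])
  have runs: "runs_within (compile main_prog) q" by (simp add: runs_within_def run halted_def)
  have main: "\<exists>\<gamma>\<^sub>0 > 0. \<forall>\<gamma>. 0 < \<gamma> \<and> \<gamma> \<le> \<gamma>\<^sub>0 \<longrightarrow>
      (\<exists>\<delta> :: nat \<Rightarrow> real. \<delta> \<longlonglongrightarrow> 0 \<and>
        (\<forall>(n :: nat) (r :: nat) (M :: real mat) (D :: real mat) (Q :: nat set).
          symmetric_mat n M \<and> num_neg_eigenvalues M \<le> r \<and>
          symmetric_mat n D \<and> Q \<subseteq> {..<n} \<and> real (card Q) \<le> \<gamma> * real n \<and>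
          supported_on n Q D \<and> rows_cols_l1_le n K M \<and> rows_cols_l1_le n K D \<longrightarrow>
          measure_pmf.prob (run (compile main_prog) (poly q n) n (M + D) C \<upsilon>) {c. captures n r M C \<upsilon> K c}
            \<ge> 1 - \<delta> n))"
    if pos: "C > 0" "\<upsilon> > 0" "K > 0" for C \<upsilon> K :: real
  proof -
    define g where "g = 3 * \<upsilon> / (64 * K) * min 1 (\<upsilon> / (32 * (2 * K + \<upsilon>) * C))"
    have g: "g > 0" using pos by (simp add: g_def)
    \<comment> \<open>The algorithm is deterministic, so the failure probability only has to cover
      the finitely many small n.\<close>
    define \<delta> where "\<delta> = (\<lambda>n. if large_enough C \<upsilon> K n then 0 else 1 :: real)"
    have lim: "\<delta> \<longlonglongrightarrow> 0"
      by (rule tendsto_eventually, rule eventually_mono[OF eventually_large_enough[OF pos]]) (simp add: \<delta>_def)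
    have prob: "1 - \<delta> n \<le> measure_pmf.prob (run (compile main_prog) (poly q n) n (M + D) C \<upsilon>) {c. captures n r M C \<upsilon> K c}"
      if h: "symmetric_mat n M" "num_neg_eigenvalues M \<le> r" "symmetric_mat n D" "Q \<subseteq> {..<n}"
        "real (card Q) \<le> \<gamma> * real n" "supported_on n Q D" "rows_cols_l1_le n K M" "rows_cols_l1_le n K D"
        and gamma: "\<gamma> \<le> min (\<upsilon> / (8 * K * C)) (g / 2)" for n r M D Q \<gamma>
    proof (cases "large_enough C \<upsilon> K n")
      case True
      have gamma': "\<gamma> < g" "\<gamma> \<le> \<upsilon> / (8 * K * C)" using gamma g by auto
      have "captures n r M C \<upsilon> K ([], den main_prog (input_store n (M + D) C \<upsilon>))"
        by (rule output_of_run[OF pos True h(1,2,7,3,8,6,4,5) gamma'[unfolded g_def]])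
      then have "measure_pmf.prob (run (compile main_prog) (poly q n) n (M + D) C \<upsilon>) {c. captures n r M C \<upsilon> K c} = 1"
        unfolding run by (simp add: measure_return_pmf indicator_def)
      then show ?thesis by (simp add: \<delta>_def)
    qed (simp add: \<delta>_def)
    show ?thesis
    \<comment> \<open>The first bound keeps the contribution of \<open>D\<close> to a delocalized
      vector below \<upsilon>/8; halving g gives the strict inequality of the potential
      argument.\<close>
    proof (intro exI[of _ "min (\<upsilon> / (8 * K * C)) (g / 2)"] conjI allI impI)
      show "0 < min (\<upsilon> / (8 * K * C)) (g / 2)" using pos g by simp
    qed (use lim prob in blast)
  qed
  show ?thesis
    by (intro exI[of _ "compile main_prog"] exI[of _ q] exI[of _ 768] exI[of _ 2949120] exI[of _ "1 / 96"],
        unfold captures_def[symmetric]) (use runs main in simp)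
qed

end
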